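(* Let $n\ge 1$, let $V\subset\mathbb{R}^n$ be compact, let $r>0$, and let $M\in L^1(V)$ be a probability density on $V$ with $\int_V vM(v)\,dv=0$. For $\varepsilon>0$ let $\varphi^\varepsilon:\mathbb{R}_+\times\mathbb{R}^n\times V\to[0,\infty)$ be the solution of $$\partial_t \varphi^{\varepsilon} + v \cdot \nabla_x \varphi^{\varepsilon} + r = (1+r)\int_{V} M(v') \left( 1-e^{\frac{\varphi^\varepsilon(t,x,v) - \varphi^\varepsilon(t,x,v')}{\varepsilon}} \right) dv' + r \rho^{\varepsilon},\qquad \rho^\varepsilon(t,x)=\int_V M(v)e^{-\varphi^\varepsilon(t,x,v)/\varepsilon}\,dv,$$ and suppose that the initial data satisfies $\varphi^\varepsilon(0,x,v)=\varphi_0(x,v)$ for all $(x,v)\in\mathbb{R}^n\times V$, with $\varphi_0\ge 0$ independent of $\varepsilon$. Then $(\varphi^\varepsilon)_\varepsilon$ converges, as $\varepsilon\to 0$, uniformly on all compact subsets of $\mathbb{R}_+^*\times\mathbb{R}^n\times V$ towards a function $\varphi^0$ which does not depend on $v$. Moreover $\varphi^0$ is the unique viscosity solution of the Hamilton-Jacobi equation $$\begin{cases} \min\left \lbrace \partial_t \varphi^0 + (1+r) \mathcal{H} \left(\frac{\nabla_x \varphi^0}{1+r} \right) + r , \varphi^0 \right\rbrace = 0, & (t,x) \in \mathbb{R}_+^* \times \mathbb{R}^n, \\ \varphi^0(0,x)= \min_{v\in V}\varphi_0(x,v),& x \in \mathbb{R}^n, \end{cases}$$ where $\mathcal{H}$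 is the Hamiltonian defined in the context.
   Context: $\mathbb{R}_+^*=(0,\infty)$. Origin of the equation: consider the kinetic equation $\partial_t f+v\cdot\nabla_x f=M(v)\rho-f+r\rho(M(v)-f)$ with $\rho(t,x)=\int_V f(t,x,v)\,dv$ and $0\le f\le M$. After the hyperbolic scaling $(t,x,v)\to(t/\varepsilon,x/\varepsilon,v)$, writing $f^\varepsilon(t,x,v)=M(v)e^{-\varphi^\varepsilon(t,x,v)/\varepsilon}$ gives the equation for $\varphi^\varepsilon$ in the claim. The bound $0\le f^\varepsilon\le M$ holds initially and is preserved in time, so $\varphi^\varepsilon\ge 0$. Hamiltonian. For $p\in\mathbb{R}^n$ let $\mu(p)=\max\{v\cdot p: v\in V\}$. Define $$\mathrm{Sing}(M)=\left\{p\in\mathbb{R}^n:\ \int_V\frac{M(v)}{\mu(p)-v\cdot p}\,dv\le 1\right\}$$ (the integral may equal $+\infty$; in particular $0\notin\mathrm{Sing}(M)$). If $p\notin\mathrm{Sing}(M)$, $\mathcal{H}(p)$ is the unique number in $(\mu(p)-1,+\infty)$ satisfying $$\int_V\frac{M(v)}{1+\mathcal{H}(p)-v\cdot p}\,dv=1.$$ If $p\in\mathrm{Sing}(M)$, $\mathcal{H}(p)=\mu(p)-1$.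
   Formalization: It is additionally assumed that V is the support of M (every neighbourhood of a point of V has positive M-mass), without which the limit can depend on v; solutions are taken continuous up to t=0, with the transport derivative along characteristics. *)

theory Defs
  imports "HOL-Analysis.Analysis"
begin

section \<open>The Hamiltonian\<close>

text \<open>\<open>V\<close> is compact and nonempty below, so the supremum is a maximum (\<open>support_fun_attained\<close>).\<close>

definition support_fun :: "(real ^ 'n) set \<Rightarrow> real ^ 'n \<Rightarrow> real" where
  "support_fun V p = (SUP v\<in>V. v \<bullet> p)"

lemma support_fun_attained:
  fixes V :: "(real ^ 'n) set"
  assumes "compact V" "V \<noteq> {}"
  shows "\<exists>v\<in>V. v \<bullet> p = support_fun V p \<and> (\<forall>w\<in>V. w \<bullet> p \<le> support_fun V p)"
proof -
  have "continuous_on V (\<lambda>v. v \<bullet> p)"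
    by (intro continuous_intros)
  then obtain v where v: "v \<in> V" "\<And>w. w \<in> V \<Longrightarrow> w \<bullet> p \<le> v \<bullet> p"
    using continuous_attains_sup[OF assms] by blast
  then have "support_fun V p = v \<bullet> p"
    unfolding support_fun_def by (intro cSup_eq_maximum) auto
  with v show ?thesis by auto
qed

text \<open>The quotient is taken in \<^typ>\<open>ennreal\<close>, where a positive number divided by \<open>0\<close> is
  \<open>\<infinity>\<close>, so that the integral has its value in \<open>[0, \<infinity>]\<close>. Division in \<^typ>\<open>real\<close> would yield \<open>0\<close>
  at \<open>v \<bullet> p = \<mu>(p)\<close> and would put \<open>p = 0\<close> into the singular set (cf. \<open>zero_notin_Sing\<close>).\<close>

definition Sing :: "(real ^ 'n) set \<Rightarrow> (real ^ 'n \<Rightarrow> real) \<Rightarrow> (real ^ 'n) set" where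
  "Sing V M =
    {p. (\<integral>\<^sup>+ v\<in>V. (ennreal (M v) / ennreal (support_fun V p - v \<bullet> p)) \<partial>lebesgue) \<le> 1}"

definition Ham :: "(real ^ 'n) set \<Rightarrow> (real ^ 'n \<Rightarrow> real) \<Rightarrow> real ^ 'n \<Rightarrow> real" where
  "Ham V M p =
    (if p \<in> Sing V M then support_fun V p - 1
     else (THE h. h > support_fun V p - 1 \<and>
                  (LINT v:V|lebesgue. M v / (1 + h - v \<bullet> p)) = 1))"


section \<open>Velocity distributions\<close>

text \<open>\<open>M\<close> is a representative of a class in \<open>L\<^sup>1(V)\<close>, hence the sign condition holds
  only almost everywhere.\<close>

definition prob_density_on :: "(real ^ 'n) set \<Rightarrow> (real ^ 'n \<Rightarrow> real) \<Rightarrow> bool" where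
  "prob_density_on V M \<longleftrightarrow>
     set_integrable lebesgue V M \<and>
     (AE v\<in>V in lebesgue. 0 \<le> M v) \<and>
     (LINT v:V|lebesgue. M v) = 1"

text \<open>\<open>V\<close> is the support of \<open>M\<close>. The function \<open>\<phi>\<close> with \<open>f = M exp (- \<phi> / \<epsilon>)\<close> is determined on
  \<open>V\<close> by \<open>f\<close> and continuity exactly under this condition. On a part of \<open>V\<close> that does not
  meet the support, the integral terms of the kinetic equation do not see \<open>\<phi>\<close>.\<close>

definition full_support :: "(real ^ 'n) set \<Rightarrow> (real ^ 'n \<Rightarrow> real) \<Rightarrow> bool" where
  "full_support V M \<longleftrightarrow> (\<forall>v\<in>V. \<forall>\<delta>>0. (LINT w:V \<inter> ball v \<delta>|lebesgue. M w) > 0)"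

lemma zero_notin_Sing:
  fixes V :: "(real ^ 'n) set"
  assumes "compact V" "prob_density_on V M"
  shows "0 \<notin> Sing V M"
proof -
  have "V \<noteq> {}"
    using assms(2) by (auto simp: prob_density_on_def set_lebesgue_integral_def)
  then have mu: "support_fun V 0 = 0"
    by (simp add: support_fun_def)
  have meas: "(\<lambda>v. indicator V v * M v) \<in> borel_measurable lebesgue"
    using assms(2) by (simp add: prob_density_on_def set_integrable_def integrable_iff_bounded)
  have eq: "(ennreal (M v) / ennreal 0) * indicator V v = top * ennreal (indicator V v * M v)" for v
    by (auto simp: divide_ennreal_def indicator_def mult.commute split: split_indicator)
  have "(\<integral>\<^sup>+ v. ennreal (indicator V v * M v) \<partial>lebesgue) = ennreal (LINT v:V|lebesgue. M v)"
    unfolding set_lebesgue_integral_def real_scaleR_def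
  proof (rule nn_integral_eq_integral)
    show "integrable lebesgue (\<lambda>v. indicator V v * M v)"
      using assms(2) by (simp add: prob_density_on_def set_integrable_def)
    have "AE v\<in>V in lebesgue. 0 \<le> M v"
      using assms(2) by (simp add: prob_density_on_def)
    then show "AE v in lebesgue. 0 \<le> indicator V v * M v"
      by eventually_elim (auto simp: indicator_def)
  qed
  also have "\<dots> = 1"
    using assms(2) by (simp add: prob_density_on_def)
  finally have "(\<integral>\<^sup>+ v\<in>V. (ennreal (M v) / ennreal (support_fun V 0 - v \<bullet> 0)) \<partial>lebesgue) = top"
    using meas by (simp add: mu eq[simplified] nn_integral_cmult)
  then show ?thesis
    by (simp add: Sing_def top_unique)
qed


section \<open>The rescaled kinetic equation\<close>

definition rho ::
    "(real ^ 'n) set \<Rightarrow> (real ^ 'n \<Rightarrow> real) \<Rightarrow> real \<Rightarrow> (real \<Rightarrow> real ^ 'n \<Rightarrow> real ^ 'n \<Rightarrow> real)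
      \<Rightarrow> real \<Rightarrow> real ^ 'n \<Rightarrow> real" where
  "rho V M \<epsilon> \<phi> t x = (LINT v:V|lebesgue. M v * exp (- \<phi> t x v / \<epsilon>))"

text \<open>\<open>\<partial>\<^sub>t\<phi> + v \<bullet> \<nabla>\<^sub>x\<phi>\<close> is the derivative of \<open>\<phi>\<close> along the characteristic
  \<open>s \<mapsto> (t + s, x + s v)\<close>. Requiring only this derivative to exist is the usual notion of
  solution of a transport equation with initial data that are merely continuous, and it
  covers the classical solutions (\<open>transport_derivative_classical\<close>).\<close>

definition kinetic_solution ::
    "(real ^ 'n) set \<Rightarrow> (real ^ 'n \<Rightarrow> real) \<Rightarrow> real \<Rightarrow> real \<Rightarrow> (real ^ 'n \<Rightarrow> real ^ 'n \<Rightarrow> real)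
      \<Rightarrow> (real \<Rightarrow> real ^ 'n \<Rightarrow> real ^ 'n \<Rightarrow> real) \<Rightarrow> bool" where
  "kinetic_solution V M r \<epsilon> \<phi>\<^sub>0 \<phi> \<longleftrightarrow>
     continuous_on ({0..} \<times> UNIV \<times> V) (\<lambda>(t, x, v). \<phi> t x v) \<and>
     (\<forall>t\<ge>0. \<forall>x. \<forall>v\<in>V. 0 \<le> \<phi> t x v) \<and>
     (\<forall>x. \<forall>v\<in>V. \<phi> 0 x v = \<phi>\<^sub>0 x v) \<and>
     (\<forall>t>0. \<forall>x. \<forall>v\<in>V. \<exists>d.
        ((\<lambda>s. \<phi> (t + s) (x + s *\<^sub>R v) v) has_real_derivative d) (at 0) \<and>
        d + r = (1 + r) * (LINT v':V|lebesgue. M v' * (1 - exp ((\<phi> t x v - \<phi> t x v') / \<epsilon>)))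
                + r * rho V M \<epsilon> \<phi> t x)"

lemma transport_derivative_classical:
  fixes \<phi> :: "real \<Rightarrow> real ^ 'n \<Rightarrow> real ^ 'n \<Rightarrow> real"
  assumes "GDERIV (\<lambda>(t, x). \<phi> t x v) (t, x) :> (a, p)"
  shows "((\<lambda>s. \<phi> (t + s) (x + s *\<^sub>R v) v) has_real_derivative a + v \<bullet> p) (at 0)"
proof -
  have "((\<lambda>s. (t + s, x + s *\<^sub>R v)) has_derivative (\<lambda>s. (s, s *\<^sub>R v))) (at 0)"
    by (auto intro!: derivative_eq_intros)
  moreover have "((\<lambda>(t, x). \<phi> t x v) has_derivative (\<lambda>h. h \<bullet> (a, p)))
      (at (t + 0, x + 0 *\<^sub>R v))"
    using assms by (simp add: gderiv_def)
  ultimately have "((\<lambda>s. (\<lambda>(t, x). \<phi> t x v) (t + s, x + s *\<^sub>R v)) has_derivative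
      (\<lambda>s. (s, s *\<^sub>R v) \<bullet> (a, p))) (at 0)"
    by (rule has_derivative_compose)
  moreover have "(\<lambda>s. (s, s *\<^sub>R v) \<bullet> (a, p)) = (*) (a + v \<bullet> p)"
    by (auto simp: algebra_simps)
  ultimately show ?thesis
    by (simp add: has_field_derivative_def)
qed


section \<open>Viscosity solutions\<close>

text \<open>Continuous viscosity solutions of \<open>F (u, \<partial>\<^sub>tu, \<nabla>\<^sub>xu) = 0\<close> in \<open>(0, \<infinity>) \<times> \<real>\<^sup>n\<close>. The
  test functions are the \<open>C\<^sup>1\<close> functions on \<open>(0, \<infinity>) \<times> \<real>\<^sup>n\<close>; \<open>D\<close> is the space-time
  gradient \<open>(\<partial>\<^sub>t\<psi>, \<nabla>\<^sub>x\<psi>)\<close>. The filter \<^term>\<open>nhds\<close> expresses local extrema.\<close>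

definition test_function ::
    "(real \<times> (real ^ 'n) \<Rightarrow> real) \<Rightarrow> (real \<times> (real ^ 'n) \<Rightarrow> real \<times> (real ^ 'n)) \<Rightarrow> bool" where
  "test_function \<psi> D \<longleftrightarrow>
     (\<forall>z\<in>{0<..} \<times> UNIV. GDERIV \<psi> z :> D z) \<and> continuous_on ({0<..} \<times> UNIV) D"

definition viscosity_subsolution ::
    "(real \<Rightarrow> real \<Rightarrow> real ^ 'n \<Rightarrow> real) \<Rightarrow> (real \<Rightarrow> real ^ 'n \<Rightarrow> real) \<Rightarrow> bool" where
  "viscosity_subsolution F u \<longleftrightarrow>
     (\<forall>\<psi> D t x. test_function \<psi> D \<and> t > 0 \<and>
        (\<forall>\<^sub>F (s, y) in nhds (t, x). u s y - \<psi> (s, y) \<le> u t x - \<psi> (t, x)) \<longrightarrow>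
        F (u t x) (fst (D (t, x))) (snd (D (t, x))) \<le> 0)"

definition viscosity_supersolution ::
    "(real \<Rightarrow> real \<Rightarrow> real ^ 'n \<Rightarrow> real) \<Rightarrow> (real \<Rightarrow> real ^ 'n \<Rightarrow> real) \<Rightarrow> bool" where
  "viscosity_supersolution F u \<longleftrightarrow>
     (\<forall>\<psi> D t x. test_function \<psi> D \<and> t > 0 \<and>
        (\<forall>\<^sub>F (s, y) in nhds (t, x). u s y - \<psi> (s, y) \<ge> u t x - \<psi> (t, x)) \<longrightarrow>
        F (u t x) (fst (D (t, x))) (snd (D (t, x))) \<ge> 0)"

definition viscosity_solution ::
    "(real \<Rightarrow> real \<Rightarrow> real ^ 'n \<Rightarrow> real) \<Rightarrow> (real ^ 'n \<Rightarrow> real) \<Rightarrow> (real \<Rightarrow> real ^ 'n \<Rightarrow> real)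
      \<Rightarrow> bool" where
  "viscosity_solution F g u \<longleftrightarrow>
     continuous_on ({0..} \<times> UNIV) (\<lambda>(t, x). u t x) \<and>
     viscosity_subsolution F u \<and> viscosity_supersolution F u \<and>
     (\<forall>x. u 0 x = g x)"

end

theory Submission
  imports Defs
begin

text \<open>
  Along the characteristic of velocity \<open>v\<close> the equation prescribes the derivative
  \<open>1 + r \<rho> - (1 + r) g(v)\<close> of \<open>\<phi>\<close>, where
  \<open>g(v) = \<integral> M(v') exp ((\<phi>(v) - \<phi>(v')) / \<epsilon>) dv' = \<rho> exp (\<phi>(v) / \<epsilon>)\<close>. Only differences of \<open>\<phi>\<close> in
  the velocity enter \<open>g\<close>, and \<open>\<rho>\<close> vanishes in the limit wherever \<open>\<phi>\<close> stays positive. The proof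
  is the method of half-relaxed limits with perturbed test functions, applied to this formula.

  Let \<open>U \<ge> L\<close> be the upper and the lower limit of \<open>\<phi>\<close> as \<open>\<epsilon> \<rightarrow> 0\<close> and the point moves to a given
  one, extremal over all velocities. Suppose that a test function \<open>\<psi>\<close> touches \<open>U > 0\<close> from above at
  \<open>z\<^sub>0\<close>, and let \<open>Q\<close> be any positive continuous profile on \<open>V\<close> with \<open>\<integral> M Q \<ge> 1\<close>. At the maxima of
  \<open>\<phi>(z, v) - \<psi>(z) - |z - z\<^sub>0|\<^sup>2 + \<epsilon> ln Q(v)\<close> the maximality in \<open>v\<close> gives \<open>g(v) \<ge> 1 / Q(v)\<close>, and the
  maximality in \<open>z\<close> identifies the derivative along the characteristic with that of \<open>\<psi>\<close>. In the
  limit, \<open>\<partial>\<^sub>t\<psi> + v \<bullet> \<nabla>\<psi> \<le> 1 - (1 + r) / Q(v)\<close> for some \<open>v\<close> (\<open>upper_phase_sub_inequality\<close>). The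
  resolvent profile \<open>Q(v) = 1 / (1 + h - v \<bullet> p)\<close> with \<open>p = \<nabla>\<psi> / (1 + r)\<close> cancels the dependence on
  \<open>v\<close> and leaves \<open>\<partial>\<^sub>t\<psi> + (1 + r) h + r \<le> 0\<close>. Profiles with \<open>\<integral> M Q \<le> 1\<close> yield the reverse
  inequality for \<open>L\<close>.

  One description of the Hamiltonian serves regular and singular \<open>p\<close>: \<open>H(p)\<close> is the infimum of
  the \<open>h > \<mu>(p) - 1\<close> whose resolvent profile has average at most \<open>1\<close>. When \<open>H(p) = \<mu>(p) - 1\<close>, no
  resolvent profile has \<open>h < H(p)\<close>; there the subsolution inequality comes from profiles with a
  high peak at a velocity that maximises \<open>v \<bullet> p\<close>. Such peaks have a large average because \<open>M\<close>
  charges every neighbourhood of every velocity (\<open>HJ_le_0_if_sub_inequality\<close>).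

  At time \<open>0\<close> the functions \<open>\<phi>\<close> depend on \<open>v\<close>. The exponential growth of \<open>g\<close> pulls \<open>\<phi>\<close> down to the
  minimum over the velocities within a time that tends to \<open>0\<close> with \<open>\<epsilon>\<close>
  (\<open>phase_upper_initial_layer\<close>), and \<open>\<phi>\<close> cannot fall below this minimum faster than at rate \<open>r\<close>
  (\<open>phase_lower_bound\<close>), so that \<open>U\<close> and \<open>L\<close> have the initial value \<open>min \<phi>\<^sub>0\<close>. Finally, \<open>H\<close> is
  Lipschitz with constant \<open>max |v|\<close>; information travels with finite speed, and semicontinuous sub-
  and supersolutions can be compared inside backward cones, whatever their growth
  (\<open>viscosity_comparison\<close>). Hence \<open>U = L\<close>, which is locally uniform convergence, and
  the limit is the only viscosity solution.
\<close>

section \<open>Averages over the velocity distribution\<close>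

locale velocity_law =
  fixes V :: "(real ^ 'n) set" and M :: "real ^ 'n \<Rightarrow> real"
  assumes compact_V: "compact V" and density: "prob_density_on V M"
begin

text \<open>Once the singular set is expressed by it, the velocity distribution enters only through
  this positive normalised functional on the continuous functions on \<open>V\<close>.\<close>

definition avg :: "(real ^ 'n \<Rightarrow> real) \<Rightarrow> real" where
  "avg f = (LINT v:V|lebesgue. M v * f v)"

lemma V_nonempty: "V \<noteq> {}"
  using density by (auto simp: prob_density_on_def set_lebesgue_integral_def)

lemma bounded_on_V:
  assumes "continuous_on V f"
  obtains B where "B > 0" "\<And>v. v \<in> V \<Longrightarrow> \<bar>f v :: real\<bar> \<le> B"
proof -
  have "bounded (f ` V)"
    using assms compact_V compact_continuous_image compact_imp_bounded by blast
  then show ?thesis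
    using that unfolding bounded_pos by auto
qed

lemma set_integrable_density_mult:
  assumes "continuous_on V f"
  shows "set_integrable lebesgue V (\<lambda>v. M v * f v)"
proof -
  obtain B where B: "B > 0" "\<And>v. v \<in> V \<Longrightarrow> \<bar>f v\<bar> \<le> B"
    using bounded_on_V[OF assms] by blast
  have M: "integrable lebesgue (\<lambda>v. indicator V v *\<^sub>R M v)"
    using density by (simp add: prob_density_on_def set_integrable_def)
  have f: "(\<lambda>v. indicator V v *\<^sub>R f v) \<in> borel_measurable lebesgue"
    using borel_measurable_continuous_on_indicator[OF _ assms] compact_V
    by (simp add: borel_compact measurable_completion)
  have "(\<lambda>v. (indicator V v *\<^sub>R M v) * (indicator V v *\<^sub>R f v)) \<in> borel_measurable lebesgue"
    using M f by (intro borel_measurable_times) auto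
  also have "(\<lambda>v. (indicator V v *\<^sub>R M v) * (indicator V v *\<^sub>R f v))
      = (\<lambda>v. indicator V v *\<^sub>R (M v * f v))"
    by (auto simp: indicator_def)
  finally have meas: "(\<lambda>v. indicator V v *\<^sub>R (M v * f v)) \<in> borel_measurable lebesgue" .
  show ?thesis
    unfolding set_integrable_def
  proof (rule Bochner_Integration.integrable_bound[OF _ meas])
    show "integrable lebesgue (\<lambda>v. B * (indicator V v *\<^sub>R M v))"
      using M by simp
    show "AE v in lebesgue. norm (indicator V v *\<^sub>R (M v * f v)) \<le> norm (B * (indicator V v *\<^sub>R M v))"
    proof (rule AE_I2)
      fix v
      show "norm (indicator V v *\<^sub>R (M v * f v)) \<le> norm (B * (indicator V v *\<^sub>R M v))"
      proof (cases "v \<in> V")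
        case True
        then have "\<bar>M v\<bar> * \<bar>f v\<bar> \<le> \<bar>M v\<bar> * B"
          using B(2) by (intro mult_left_mono) auto
        then show ?thesis
          using True B(1) by (simp add: abs_mult mult.commute)
      qed simp
    qed
  qed
qed

lemma avg_const [simp]: "avg (\<lambda>_. a) = a"
  using density by (simp add: avg_def prob_density_on_def set_lebesgue_integral_def
      flip: mult.assoc)

lemma avg_cmult: "avg (\<lambda>v. a * f v) = a * avg f"
  unfolding avg_def using set_integral_mult_right[of lebesgue V a "\<lambda>v. M v * f v"]
  by (simp add: algebra_simps)

lemma avg_diff:
  assumes "continuous_on V f" "continuous_on V g"
  shows "avg (\<lambda>v. f v - g v) = avg f - avg g"
  unfolding avg_def
  using set_integral_diff(2)[OF assms[THEN set_integrable_density_mult]]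
  by (simp add: algebra_simps)

lemma avg_mono:
  assumes "continuous_on V f" "continuous_on V g" "\<And>v. v \<in> V \<Longrightarrow> f v \<le> g v"
  shows "avg f \<le> avg g"
  unfolding avg_def
proof (rule set_integral_mono_AE[OF assms(1,2)[THEN set_integrable_density_mult]])
  have "AE v\<in>V in lebesgue. 0 \<le> M v"
    using density by (simp add: prob_density_on_def)
  then show "AE v\<in>V in lebesgue. M v * f v \<le> M v * g v"
    by eventually_elim (auto intro: mult_left_mono assms(3))
qed

lemma avg_ge_const: "continuous_on V f \<Longrightarrow> (\<And>v. v \<in> V \<Longrightarrow> b \<le> f v) \<Longrightarrow> b \<le> avg f"
  using avg_mono[of "\<lambda>_. b" f] by simp

lemma avg_le_const: "continuous_on V f \<Longrightarrow> (\<And>v. v \<in> V \<Longrightarrow> f v \<le> b) \<Longrightarrow> avg f \<le> b"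
  using avg_mono[of f "\<lambda>_. b"] by simp

lemma avg_pos:
  assumes f: "continuous_on V f" "\<And>v. v \<in> V \<Longrightarrow> 0 < f v"
  shows "0 < avg f"
proof -
  obtain w where "w \<in> V" "\<And>v. v \<in> V \<Longrightarrow> f w \<le> f v"
    using continuous_attains_inf[OF compact_V V_nonempty f(1)] by blast
  then show ?thesis
    using avg_ge_const[OF f(1), of "f w"] f(2)[of w] by simp
qed

text \<open>The quantitative form of full support: a continuous profile that is large near a single
  velocity has a large average. It feeds the peaked profiles and the initial layer.\<close>

lemma avg_ge_on_ball:
  assumes full: "full_support V M" and "v\<^sub>0 \<in> V" "0 < \<delta>"
  obtains m where "0 < m"
    "\<And>f (b::real). continuous_on V f \<Longrightarrow> (\<And>v. v \<in> V \<Longrightarrow> 0 \<le> f v) \<Longrightarrow> 0 \<le> b \<Longrightarrow>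
       (\<And>v. v \<in> V \<Longrightarrow> dist v\<^sub>0 v < \<delta> \<Longrightarrow> b \<le> f v) \<Longrightarrow> b * m \<le> avg f"
proof
  let ?W = "V \<inter> ball v\<^sub>0 \<delta>"
  let ?m = "LINT w:?W|lebesgue. M w"
  show "0 < ?m"
    using assms by (auto simp: full_support_def)
  fix f and b :: real
  assume f: "continuous_on V f" "\<And>v. v \<in> V \<Longrightarrow> 0 \<le> f v" and b: "0 \<le> b"
    "\<And>v. v \<in> V \<Longrightarrow> dist v\<^sub>0 v < \<delta> \<Longrightarrow> b \<le> f v"
  have pos: "AE v\<in>V in lebesgue. 0 \<le> M v"
    using density by (simp add: prob_density_on_def)
  have W: "?W \<in> sets lebesgue"
    using compact_V by (auto simp: borel_compact)
  have M: "set_integrable lebesgue ?W M"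
    using density W by (auto simp: prob_density_on_def intro: set_integrable_subset)
  have "b * ?m = (LINT v|lebesgue. indicator ?W v *\<^sub>R (b * M v))"
    using set_integral_mult_right[of lebesgue ?W b M]
    by (simp add: set_lebesgue_integral_def del: Bochner_Integration.integral_mult_right_zero set_integral_mult_right)
  also have "\<dots> \<le> (LINT v|lebesgue. indicator V v *\<^sub>R (M v * f v))"
  proof (rule integral_mono_AE)
    show "integrable lebesgue (\<lambda>v. indicator ?W v *\<^sub>R (b * M v))"
      using set_integrable_mult_right[of b lebesgue ?W M] M by (simp add: set_integrable_def)
    show "integrable lebesgue (\<lambda>v. indicator V v *\<^sub>R (M v * f v))"
      using set_integrable_density_mult[OF f(1)] by (simp add: set_integrable_def)
    show "AE v in lebesgue. indicator ?W v *\<^sub>R (b * M v) \<le> indicator V v *\<^sub>R (M v * f v)"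
      using pos
    proof eventually_elim
      case (elim v)
      show ?case
      proof (cases "v \<in> ?W")
        case True
        then have "M v * b \<le> M v * f v"
          using elim b(2) by (intro mult_left_mono) auto
        then show ?thesis
          using True by (simp add: mult.commute)
      next
        case False
        then show ?thesis
          using elim f(2) by (auto simp: indicator_def)
      qed
    qed
  qed
  finally show "b * ?m \<le> avg f"
    by (simp add: avg_def set_lebesgue_integral_def)
qed

section \<open>The Hamiltonian as an infimum\<close>

lemma inner_le_support: "v \<in> V \<Longrightarrow> v \<bullet> p \<le> support_fun V p"
  using support_fun_attained[OF compact_V V_nonempty, of p] by auto

text \<open>The function \<open>h \<mapsto> \<integral> M(v) / (1 + h - v \<bullet> p) dv\<close>, whose crossing of the level \<open>1\<close> defines
  the Hamiltonian.\<close>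

definition resolvent_avg :: "real ^ 'n \<Rightarrow> real \<Rightarrow> real" where
  "resolvent_avg p h = avg (\<lambda>v. 1 / (1 + h - v \<bullet> p))"

lemma resolvent_denominator_pos:
  "support_fun V p - 1 < h \<Longrightarrow> v \<in> V \<Longrightarrow> 0 < 1 + h - v \<bullet> p"
  using inner_le_support[of v p] by simp

lemma continuous_on_resolvent:
  assumes "support_fun V p - 1 < h"
  shows "continuous_on V (\<lambda>v. 1 / (1 + h - v \<bullet> p))"
  using resolvent_denominator_pos[OF assms]
  by (intro continuous_intros) force

lemma resolvent_avg_strict_antimono:
  assumes "support_fun V p - 1 < h" "h < k"
  shows "resolvent_avg p k < resolvent_avg p h"
proof -
  have k: "support_fun V p - 1 < k"
    using assms by simp
  have "0 < avg (\<lambda>v. 1 / (1 + h - v \<bullet> p) - 1 / (1 + k - v \<bullet> p))"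
  proof (rule avg_pos)
    show "0 < 1 / (1 + h - v \<bullet> p) - 1 / (1 + k - v \<bullet> p)" if "v \<in> V" for v
      using resolvent_denominator_pos[OF assms(1) that] assms(2)
      by (simp add: divide_strict_left_mono)
  qed (intro continuous_on_diff continuous_on_resolvent assms k)
  also have "\<dots> = resolvent_avg p h - resolvent_avg p k"
    unfolding resolvent_avg_def by (intro avg_diff continuous_on_resolvent assms k)
  finally show ?thesis by simp
qed

lemma resolvent_avg_Lipschitz:
  assumes h: "support_fun V p - 1 + d \<le> h" and "h \<le> k" and d: "0 < d"
  shows "resolvent_avg p h - resolvent_avg p k \<le> (k - h) / (d * d)"
proof -
  have h': "support_fun V p - 1 < h" "support_fun V p - 1 < k"
    using assms by auto
  have "resolvent_avg p h - resolvent_avg p k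
      = avg (\<lambda>v. 1 / (1 + h - v \<bullet> p) - 1 / (1 + k - v \<bullet> p))"
    unfolding resolvent_avg_def by (intro avg_diff[symmetric] continuous_on_resolvent h')
  also have "\<dots> \<le> (k - h) / (d * d)"
  proof (rule avg_le_const)
    fix v
    assume v: "v \<in> V"
    have ge: "d \<le> 1 + h - v \<bullet> p" "d \<le> 1 + k - v \<bullet> p"
      using inner_le_support[OF v, of p] assms by auto
    have "1 / (1 + h - v \<bullet> p) - 1 / (1 + k - v \<bullet> p)
        = (k - h) / ((1 + h - v \<bullet> p) * (1 + k - v \<bullet> p))"
      using ge d by (simp add: divide_simps)
    also have "\<dots> \<le> (k - h) / (d * d)"
      using ge d \<open>h \<le> k\<close> by (intro divide_left_mono mult_mono mult_pos_pos) auto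
    finally show "1 / (1 + h - v \<bullet> p) - 1 / (1 + k - v \<bullet> p) \<le> (k - h) / (d * d)" .
  qed (intro continuous_on_diff continuous_on_resolvent h')
  finally show ?thesis .
qed

lemma nn_integral_resolvent:
  assumes "support_fun V p - 1 < h"
  shows "(\<integral>\<^sup>+ v\<in>V. (ennreal (M v) / ennreal (1 + h - v \<bullet> p)) \<partial>lebesgue)
    = ennreal (resolvent_avg p h)"
proof -
  have pos: "AE v\<in>V in lebesgue. 0 \<le> M v"
    using density by (simp add: prob_density_on_def)
  have "(\<integral>\<^sup>+ v\<in>V. (ennreal (M v) / ennreal (1 + h - v \<bullet> p)) \<partial>lebesgue)
      = (\<integral>\<^sup>+ v. ennreal (indicator V v *\<^sub>R (M v * (1 / (1 + h - v \<bullet> p)))) \<partial>lebesgue)"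
  proof (rule nn_integral_cong_AE, use pos in eventually_elim)
    case (elim v)
    then show ?case
      using resolvent_denominator_pos[OF assms, of v]
      by (auto simp: indicator_def divide_ennreal)
  qed
  also have "\<dots> = ennreal (LINT v|lebesgue. indicator V v *\<^sub>R (M v * (1 / (1 + h - v \<bullet> p))))"
  proof (rule nn_integral_eq_integral)
    show "integrable lebesgue (\<lambda>v. indicator V v *\<^sub>R (M v * (1 / (1 + h - v \<bullet> p))))"
      using set_integrable_density_mult[OF continuous_on_resolvent[OF assms]]
      by (simp add: set_integrable_def)
    show "AE v in lebesgue. 0 \<le> indicator V v *\<^sub>R (M v * (1 / (1 + h - v \<bullet> p)))"
      using pos
    proof eventually_elim
      case (elim v)
      then show ?case
        using resolvent_denominator_pos[OF assms, of v] by (auto simp: indicator_def)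
    qed
  qed
  finally show ?thesis
    by (simp add: resolvent_avg_def avg_def set_lebesgue_integral_def)
qed

text \<open>The extended integral in \<^const>\<open>Sing\<close> is the limit of the resolvent averages as
  \<open>h\<close> decreases to \<open>\<mu>(p) - 1\<close>: they are bounded by it, and Fatou's lemma gives the converse. The
  singular set thus consists of those \<open>p\<close> for which the averages never exceed \<open>1\<close>.\<close>

lemma Sing_iff_resolvent_avg_le_1:
  "p \<in> Sing V M \<longleftrightarrow> (\<forall>h>support_fun V p - 1. resolvent_avg p h \<le> 1)"
proof
  assume p: "p \<in> Sing V M"
  show "\<forall>h>support_fun V p - 1. resolvent_avg p h \<le> 1"
  proof (intro allI impI)
    fix h
    assume h: "support_fun V p - 1 < h"
    have "ennreal (resolvent_avg p h)
        = (\<integral>\<^sup>+ v\<in>V. (ennreal (M v) / ennreal (1 + h - v \<bullet> p)) \<partial>lebesgue)"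
      by (rule nn_integral_resolvent[OF h, symmetric])
    also have "\<dots> \<le> (\<integral>\<^sup>+ v\<in>V. (ennreal (M v) / ennreal (support_fun V p - v \<bullet> p)) \<partial>lebesgue)"
    proof (intro nn_integral_mono)
      fix v
      have "inverse (ennreal (1 + h - v \<bullet> p)) \<le> inverse (ennreal (support_fun V p - v \<bullet> p))" if "v \<in> V"
        using inner_le_support[OF that, of p] h
        by (cases "support_fun V p = v \<bullet> p") (simp_all add: inverse_ennreal le_imp_inverse_le)
      then show "ennreal (M v) / ennreal (1 + h - v \<bullet> p) * indicator V v
          \<le> ennreal (M v) / ennreal (support_fun V p - v \<bullet> p) * indicator V v"
        unfolding divide_ennreal_def by (auto simp: indicator_def intro: mult_left_mono)
    qed
    also have "\<dots> \<le> 1"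
      using p by (simp add: Sing_def)
    finally show "resolvent_avg p h \<le> 1"
      by simp
  qed
next
  assume le1: "\<forall>h>support_fun V p - 1. resolvent_avg p h \<le> 1"
  define \<mu> where "\<mu> = support_fun V p"
  define h where "h n = \<mu> - 1 + 1 / real (Suc n)" for n
  define q where "q n v = ennreal (indicator V v *\<^sub>R M v) / ennreal (1 + h n - v \<bullet> p)" for n v
  have M: "(\<lambda>v. indicator V v *\<^sub>R M v) \<in> borel_measurable lebesgue"
    using density by (auto simp: prob_density_on_def set_integrable_def)
  have lim: "(\<lambda>n. q n v) \<longlonglongrightarrow> ennreal (indicator V v *\<^sub>R M v) / ennreal (\<mu> - v \<bullet> p)" for v
  proof -
    have "(\<lambda>n. 1 + h n - v \<bullet> p) \<longlonglongrightarrow> 1 + (\<mu> - 1 + 0) - v \<bullet> p"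
      unfolding h_def by (intro tendsto_intros LIMSEQ_Suc[OF lim_1_over_n])
    then have "(\<lambda>n. ennreal (1 + h n - v \<bullet> p)) \<longlonglongrightarrow> ennreal (\<mu> - v \<bullet> p)"
      by (intro tendsto_ennrealI) simp
    then have "(\<lambda>n. inverse (ennreal (1 + h n - v \<bullet> p))) \<longlonglongrightarrow> inverse (ennreal (\<mu> - v \<bullet> p))"
      using continuous_on_inverse_ennreal[OF continuous_on_id, of UNIV]
      by (auto simp: continuous_on_def intro: tendsto_compose[where g=inverse] elim: tendsto_compose)
    then show ?thesis
      unfolding q_def divide_ennreal_def by (intro ennreal_tendsto_cmult) simp_all
  qed
  have q_meas: "q n \<in> borel_measurable lebesgue" for n
  proof -
    have "(\<lambda>v. ennreal (1 + h n - v \<bullet> p)) \<in> borel_measurable lebesgue"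
      by (intro measurable_completion) (simp add: borel_measurable_continuous_onI continuous_intros)
    then show ?thesis
      using M unfolding q_def by measurable
  qed
  have ind: "ennreal (indicator V v *\<^sub>R M v) / e = ennreal (M v) / e * indicator V v" for v e
    by (auto simp: indicator_def)
  have "(\<integral>\<^sup>+ v\<in>V. (ennreal (M v) / ennreal (\<mu> - v \<bullet> p)) \<partial>lebesgue)
      = (\<integral>\<^sup>+ v. liminf (\<lambda>n. q n v) \<partial>lebesgue)"
  proof (intro nn_integral_cong)
    show "ennreal (M v) / ennreal (\<mu> - v \<bullet> p) * indicator V v = liminf (\<lambda>n. q n v)" for v
      using lim_imp_Liminf[OF _ lim[of v]] by (simp add: ind del: real_scaleR_def)
  qed
  also have "\<dots> \<le> liminf (\<lambda>n. \<integral>\<^sup>+ v. q n v \<partial>lebesgue)"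
    by (rule nn_integral_liminf[OF q_meas])
  also have "\<dots> \<le> 1"
  proof -
    have "(\<integral>\<^sup>+ v. q n v \<partial>lebesgue) \<le> 1" for n
    proof -
      have hn: "support_fun V p - 1 < h n"
        by (simp add: h_def \<mu>_def)
      have "(\<integral>\<^sup>+ v. q n v \<partial>lebesgue) = ennreal (resolvent_avg p (h n))"
        using nn_integral_resolvent[OF hn] by (simp add: q_def ind del: real_scaleR_def)
      also have "\<dots> \<le> 1"
        using le1 hn by simp
      finally show ?thesis .
    qed
    then show ?thesis
      by (simp add: Liminf_le)
  qed
  finally show "p \<in> Sing V M"
    by (simp add: Sing_def \<mu>_def)
qed

lemma Ham_eqI:
  assumes "support_fun V p - 1 < h" "resolvent_avg p h = 1"
  shows "Ham V M p = h"
proof -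
  have "p \<notin> Sing V M"
  proof
    assume "p \<in> Sing V M"
    define k where "k = (support_fun V p - 1 + h) / 2"
    have k: "support_fun V p - 1 < k" "k < h"
      using assms(1) unfolding k_def by (simp_all add: field_simps)
    have "resolvent_avg p k \<le> 1"
      using \<open>p \<in> Sing V M\<close> k(1) by (auto simp: Sing_iff_resolvent_avg_le_1)
    with resolvent_avg_strict_antimono[OF k] assms(2) show False
      by simp
  qed
  moreover have "(THE h. h > support_fun V p - 1 \<and> resolvent_avg p h = 1) = h"
  proof (rule the_equality)
    fix k
    assume "support_fun V p - 1 < k \<and> resolvent_avg p k = 1"
    then show "k = h"
      using assms resolvent_avg_strict_antimono[of p h k] resolvent_avg_strict_antimono[of p k h]
      by (cases h k rule: linorder_cases) auto
  qed (use assms in simp)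
  ultimately show ?thesis
    by (simp add: Ham_def resolvent_avg_def avg_def)
qed

lemma resolvent_avg_Ham:
  assumes "p \<notin> Sing V M"
  shows "support_fun V p - 1 < Ham V M p" "resolvent_avg p (Ham V M p) = 1"
proof -
  define \<mu> where "\<mu> = support_fun V p"
  obtain h\<^sub>0 where h0: "\<mu> - 1 < h\<^sub>0" "1 < resolvent_avg p h\<^sub>0"
    using assms by (auto simp: Sing_iff_resolvent_avg_le_1 \<mu>_def not_le)
  have \<mu>_le: "resolvent_avg p \<mu> \<le> 1"
    unfolding resolvent_avg_def
  proof (rule avg_le_const)
    show "1 / (1 + \<mu> - v \<bullet> p) \<le> 1" if "v \<in> V" for v
      using inner_le_support[OF that, of p] by (simp add: \<mu>_def)
  qed (simp add: \<mu>_def continuous_on_resolvent)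
  have "h\<^sub>0 < \<mu>"
    using h0 \<mu>_le resolvent_avg_strict_antimono[of p \<mu> h\<^sub>0]
    by (cases h\<^sub>0 \<mu> rule: linorder_cases) (auto simp: \<mu>_def)
  define d where "d = h\<^sub>0 - (\<mu> - 1)"
  have d: "0 < d"
    using h0 by (simp add: d_def)
  have "continuous_on {h\<^sub>0..\<mu>} (resolvent_avg p)"
  proof (rule lipschitz_on_continuous_on)
    show "(1 / (d * d))-lipschitz_on {h\<^sub>0..\<mu>} (resolvent_avg p)"
    proof (rule lipschitz_onI)
      have main: "dist (resolvent_avg p h) (resolvent_avg p k) \<le> 1 / (d * d) * dist h k"
        if "h\<^sub>0 \<le> h" "h \<le> k" for h k
      proof -
        have le: "resolvent_avg p k \<le> resolvent_avg p h"
          using resolvent_avg_strict_antimono[of p h k] that h0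
          by (cases "h = k") (auto simp: \<mu>_def)
        show ?thesis
          using resolvent_avg_Lipschitz[of p d h k] le that d
          by (simp add: d_def \<mu>_def dist_real_def)
      qed
      show "dist (resolvent_avg p h) (resolvent_avg p k) \<le> 1 / (d * d) * dist h k"
        if "h \<in> {h\<^sub>0..\<mu>}" "k \<in> {h\<^sub>0..\<mu>}" for h k
        using main[of h k] main[of k h] that by (cases "h \<le> k") (auto simp: dist_commute)
    qed (use d in simp)
  qed
  then obtain h where "h\<^sub>0 \<le> h" "h \<le> \<mu>" "resolvent_avg p h = 1"
    using IVT2'[of "resolvent_avg p" \<mu> 1 h\<^sub>0] h0 \<mu>_le \<open>h\<^sub>0 < \<mu>\<close> by auto
  with h0 Ham_eqI[of p h] show "support_fun V p - 1 < Ham V M p" "resolvent_avg p (Ham V M p) = 1"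
    by (auto simp: \<mu>_def)
qed

text \<open>The next three lemmas are the only properties of the Hamiltonian used below. They say
  that it is the infimum of the admissible \<open>h\<close>, whether \<open>p\<close> is singular or not.\<close>

lemma Ham_ge_support: "support_fun V p - 1 \<le> Ham V M p"
  using resolvent_avg_Ham[of p] by (cases "p \<in> Sing V M") (auto simp: Ham_def)

lemma resolvent_avg_le_1_above_Ham:
  assumes "Ham V M p < h"
  shows "resolvent_avg p h \<le> 1"
proof (cases "p \<in> Sing V M")
  case True
  then show ?thesis
    using assms by (auto simp: Ham_def Sing_iff_resolvent_avg_le_1)
next
  case False
  then show ?thesis
    using resolvent_avg_Ham[OF False] resolvent_avg_strict_antimono[of p "Ham V M p" h] assms by simp
qed

lemma resolvent_avg_gt_1_below_Ham:
  assumes "support_fun V p - 1 < h" "h < Ham V M p"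
  shows "1 < resolvent_avg p h"
proof -
  have "p \<notin> Sing V M"
    using assms by (auto simp: Ham_def)
  then show ?thesis
    using resolvent_avg_Ham resolvent_avg_strict_antimono[OF assms] by simp
qed

text \<open>If \<open>h\<close> is admissible for \<open>p\<close>, then \<open>h + R |p - q|\<close> is admissible for \<open>q\<close>, as the
  denominator only grows; taking infima transfers this to the Hamiltonian.\<close>

lemma Ham_Lipschitz:
  assumes R: "\<And>v. v \<in> V \<Longrightarrow> norm v \<le> R"
  shows "Ham V M q \<le> Ham V M p + R * norm (p - q)"
proof (rule field_le_epsilon)
  fix e :: real
  assume "0 < e"
  define h where "h = Ham V M p + e"
  define k where "k = h + R * norm (p - q)"
  have h: "support_fun V p - 1 < h"
    using Ham_ge_support[of p] \<open>0 < e\<close> by (simp add: h_def)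
  have shift: "v \<bullet> q \<le> v \<bullet> p + R * norm (p - q)" if "v \<in> V" for v
  proof -
    have "v \<bullet> q - v \<bullet> p = v \<bullet> (q - p)"
      by (simp add: inner_diff_right)
    also have "\<dots> \<le> norm v * norm (q - p)"
      by (rule norm_cauchy_schwarz)
    also have "\<dots> \<le> R * norm (p - q)"
      using R[OF that] by (simp add: mult_right_mono norm_minus_commute)
    finally show ?thesis by simp
  qed
  obtain w where w: "w \<in> V" "w \<bullet> q = support_fun V q"
    using support_fun_attained[OF compact_V V_nonempty] by blast
  have k: "support_fun V q - 1 < k"
    using shift[OF w(1)] inner_le_support[OF w(1), of p] h w(2) by (simp add: k_def)
  have "resolvent_avg q k \<le> resolvent_avg p h"
    unfolding resolvent_avg_def
  proof (rule avg_mono[OF continuous_on_resolvent[OF k] continuous_on_resolvent[OF h]])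
    show "1 / (1 + k - v \<bullet> q) \<le> 1 / (1 + h - v \<bullet> p)" if "v \<in> V" for v
      using shift[OF that] resolvent_denominator_pos[OF h that]
      by (intro divide_left_mono mult_pos_pos) (auto simp: k_def)
  qed
  also have "\<dots> \<le> 1"
    using resolvent_avg_le_1_above_Ham \<open>0 < e\<close> by (simp add: h_def)
  finally have "Ham V M q \<le> k"
    using resolvent_avg_gt_1_below_Ham[OF k] by fastforce
  then show "Ham V M q \<le> Ham V M p + R * norm (p - q) + e"
    by (simp add: k_def h_def)
qed

end

section \<open>Half-relaxed limits\<close>

lemma eventually_ball_compact:
  assumes "compact K" "\<And>k. k \<in> K \<Longrightarrow> \<forall>\<^sub>F q in F \<times>\<^sub>F nhds k. P (fst q) (snd q)"
  shows "\<forall>\<^sub>F x in F. \<forall>k\<in>K. P x k"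
proof -
  have "\<forall>k\<in>K. \<exists>U. open U \<and> k \<in> U \<and> (\<forall>\<^sub>F x in F. \<forall>k'\<in>U. P x k')"
  proof
    fix k
    assume "k \<in> K"
    then obtain A B where AB: "eventually A F" "eventually B (nhds k)"
        "\<And>x k'. A x \<Longrightarrow> B k' \<Longrightarrow> P x k'"
      using assms(2)[of k] unfolding eventually_prod_filter by auto
    then obtain U where "open U" "k \<in> U" "\<And>k'. k' \<in> U \<Longrightarrow> B k'"
      unfolding eventually_nhds by blast
    with AB show "\<exists>U. open U \<and> k \<in> U \<and> (\<forall>\<^sub>F x in F. \<forall>k'\<in>U. P x k')"
      by (intro exI[of _ U]) (auto elim: eventually_mono)
  qed
  from bchoice[OF this] obtain U
    where U: "\<forall>k\<in>K. open (U k) \<and> k \<in> U k \<and> (\<forall>\<^sub>F x in F. \<forall>k'\<in>U k. P x k')" ..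
  then obtain C where C: "C \<subseteq> K" "finite C" "K \<subseteq> (\<Union>k\<in>C. U k)"
    using compactE_image[OF assms(1), of K U] U by blast
  have "\<forall>\<^sub>F x in F. \<forall>k\<in>C. \<forall>k'\<in>U k. P x k'"
    using C U by (intro eventually_ball_finite) auto
  then show ?thesis
    by eventually_elim (use C in blast)
qed

text \<open>The upper half-relaxed limit \<open>limsup f \<epsilon> z' v\<close> over \<open>\<epsilon> \<rightarrow> 0\<close>, \<open>z' \<rightarrow> z\<close> and all \<open>v \<in> V\<close>. The
  infimum is taken in the reals, hence it is meaningful only for locally bounded families. The lower
  half-relaxed limit is obtained by changing signs.\<close>

definition upper_limit :: "'b set \<Rightarrow> (real \<Rightarrow> 'a::topological_space \<Rightarrow> 'b \<Rightarrow> real) \<Rightarrow> 'a \<Rightarrow> real" where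
  "upper_limit V f z = Inf {a. \<forall>\<^sub>F q in at_right (0::real) \<times>\<^sub>F nhds z. \<forall>v\<in>V. f (fst q) (snd q) v \<le> a}"

definition locally_bounded_family ::
    "'b set \<Rightarrow> (real \<Rightarrow> 'a::topological_space \<Rightarrow> 'b \<Rightarrow> real) \<Rightarrow> 'a \<Rightarrow> bool" where
  "locally_bounded_family V f z \<longleftrightarrow>
     (\<exists>B. \<forall>\<^sub>F q in at_right (0::real) \<times>\<^sub>F nhds z. \<forall>v\<in>V. \<bar>f (fst q) (snd q) v\<bar> \<le> B)"

lemma locally_bounded_family_uminus:
  "locally_bounded_family V (\<lambda>\<epsilon> z v. - f \<epsilon> z v) z \<longleftrightarrow> locally_bounded_family V f z"
  by (simp add: locally_bounded_family_def)

lemma at_right_nhds_nontrivial: "at_right (0::real) \<times>\<^sub>F nhds z \<noteq> bot"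
  by (simp add: prod_filter_eq_bot)

lemma upper_limit_bounds_below:
  assumes "V \<noteq> {}" "locally_bounded_family V f z"
  shows "bdd_below {a. \<forall>\<^sub>F q in at_right (0::real) \<times>\<^sub>F nhds z. \<forall>v\<in>V. f (fst q) (snd q) v \<le> a}"
proof -
  obtain B where B: "\<forall>\<^sub>F q in at_right (0::real) \<times>\<^sub>F nhds z. \<forall>v\<in>V. \<bar>f (fst q) (snd q) v\<bar> \<le> B"
    using assms(2) by (auto simp: locally_bounded_family_def)
  show ?thesis
  proof (rule bdd_belowI[of _ "- B"], safe)
    fix a
    assume "\<forall>\<^sub>F q in at_right (0::real) \<times>\<^sub>F nhds z. \<forall>v\<in>V. f (fst q) (snd q) v \<le> a"
    with B have "\<forall>\<^sub>F q in at_right (0::real) \<times>\<^sub>F nhds z. - B \<le> a"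
    proof eventually_elim
      case (elim q)
      obtain v where "v \<in> V"
        using assms(1) by blast
      then have "\<bar>f (fst q) (snd q) v\<bar> \<le> B" "f (fst q) (snd q) v \<le> a"
        using elim by auto
      then show ?case by simp
    qed
    then show "- B \<le> a"
      using at_right_nhds_nontrivial[of z] by (simp add: eventually_const)
  qed
qed

lemma eventually_less_upper_limit:
  assumes "V \<noteq> {}" "locally_bounded_family V f z" "upper_limit V f z < a"
  shows "\<forall>\<^sub>F q in at_right (0::real) \<times>\<^sub>F nhds z. \<forall>v\<in>V. f (fst q) (snd q) v \<le> a"
proof -
  let ?A = "{a. \<forall>\<^sub>F q in at_right (0::real) \<times>\<^sub>F nhds z. \<forall>v\<in>V. f (fst q) (snd q) v \<le> a}"
  obtain B where B: "\<forall>\<^sub>F q in at_right (0::real) \<times>\<^sub>F nhds z. \<forall>v\<in>V. \<bar>f (fst q) (snd q) v\<bar> \<le> B"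
    using assms(2) by (auto simp: locally_bounded_family_def)
  have "B \<in> ?A"
    unfolding mem_Collect_eq using B by (rule eventually_mono) (auto simp: abs_le_iff)
  then obtain b where "b \<in> ?A" "b < a"
    using cInf_lessD[of ?A a] assms(3) by (auto simp: upper_limit_def)
  then show ?thesis
    by (auto elim!: eventually_mono intro: order.trans less_imp_le)
qed

lemma upper_limit_le:
  assumes "V \<noteq> {}" "locally_bounded_family V f z"
    "\<forall>\<^sub>F q in at_right (0::real) \<times>\<^sub>F nhds z. \<forall>v\<in>V. f (fst q) (snd q) v \<le> a"
  shows "upper_limit V f z \<le> a"
  unfolding upper_limit_def using assms(3)
  by (intro cInf_lower upper_limit_bounds_below[OF assms(1,2)]) simp

lemma frequently_greater_upper_limit:
  assumes "V \<noteq> {}" "locally_bounded_family V f z" "a < upper_limit V f z"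
  shows "\<exists>\<^sub>F q in at_right (0::real) \<times>\<^sub>F nhds z. \<exists>v\<in>V. a < f (fst q) (snd q) v"
proof (rule ccontr)
  assume "\<not> ?thesis"
  then have "\<forall>\<^sub>F q in at_right (0::real) \<times>\<^sub>F nhds z. \<forall>v\<in>V. f (fst q) (snd q) v \<le> a"
    by (simp add: frequently_def not_less)
  then have "upper_limit V f z \<le> a"
    by (rule upper_limit_le[OF assms(1,2)])
  with assms(3) show False by simp
qed

lemma upper_limit_usc:
  assumes "V \<noteq> {}" "locally_bounded_family V f z" "upper_limit V f z < a"
    and near: "\<forall>\<^sub>F z' in nhds z. locally_bounded_family V f z'"
  shows "\<forall>\<^sub>F z' in nhds z. upper_limit V f z' < a"
proof -
  obtain b where b: "upper_limit V f z < b" "b < a"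
    using assms(3) dense by blast
  obtain A B where AB: "eventually A (at_right 0)" "eventually B (nhds z)"
      "\<And>\<epsilon> z'. A \<epsilon> \<Longrightarrow> B z' \<Longrightarrow> \<forall>v\<in>V. f \<epsilon> z' v \<le> b"
    using eventually_less_upper_limit[OF assms(1,2) b(1)] unfolding eventually_prod_filter by auto
  have "\<forall>\<^sub>F z' in nhds z. eventually B (nhds z')"
    using AB(2) by (simp add: eventually_eventually)
  then show ?thesis
    using near
  proof eventually_elim
    case (elim z')
    have "\<forall>\<^sub>F q in at_right (0::real) \<times>\<^sub>F nhds z'. \<forall>v\<in>V. f (fst q) (snd q) v \<le> b"
      unfolding eventually_prod_filter using AB elim by (intro exI[of _ A] exI[of _ B]) auto
    then show ?case
      using upper_limit_le[OF assms(1) elim(2)] b(2) by (meson le_less_trans)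
  qed
qed

lemma lower_limit_le_upper_limit:
  assumes "V \<noteq> {}" "locally_bounded_family V f z"
  shows "- upper_limit V (\<lambda>\<epsilon> z v. - f \<epsilon> z v) z \<le> upper_limit V f z"
proof (rule ccontr)
  let ?L = "- upper_limit V (\<lambda>\<epsilon> z v. - f \<epsilon> z v) z"
  assume "\<not> ?L \<le> upper_limit V f z"
  then obtain b where b: "upper_limit V f z < b" "b < ?L"
    using dense by (metis not_le)
  then obtain b' where b': "b < b'" "b' < ?L"
    using dense by blast
  have "\<forall>\<^sub>F q in at_right (0::real) \<times>\<^sub>F nhds z. \<forall>v\<in>V. - f (fst q) (snd q) v \<le> - b'"
    using assms b'(2)
    by (intro eventually_less_upper_limit) (auto simp: locally_bounded_family_uminus)
  with eventually_less_upper_limit[OF assms b(1)]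
  have "\<forall>\<^sub>F q in at_right (0::real) \<times>\<^sub>F nhds z. False"
    by eventually_elim (use assms(1) b'(1) in force)
  then show False
    using at_right_nhds_nontrivial[of z] by simp
qed

text \<open>The perturbed test function argument, independent of any equation. A local maximum of
  \<open>U - \<psi>\<close> is made strict by the square of the distance, and the maxima of
  \<open>f \<epsilon> z v - \<psi> z - (dist z z\<^sub>0)\<^sup>2 - \<epsilon> \<eta> v\<close> over a small compact set are then forced to approach \<open>z\<^sub>0\<close>,
  because the values of \<open>f\<close> there come close to \<open>U z\<^sub>0\<close>. The corrector \<open>\<eta>\<close> is scaled by \<open>\<epsilon>\<close>, so it
  disappears in the limit, but it governs the dependence on \<open>v\<close>, which is resolved at this scale.\<close>

lemma perturbed_maximum:
  fixes f :: "real \<Rightarrow> 'a::heine_borel \<Rightarrow> 'b::topological_space \<Rightarrow> real"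
  assumes V: "compact V" "V \<noteq> {}" and S: "open S" "z\<^sub>0 \<in> S"
    and f: "\<And>\<epsilon>. 0 < \<epsilon> \<Longrightarrow> continuous_on (S \<times> V) (\<lambda>(z, v). f \<epsilon> z v)"
    and bdd: "\<And>z. z \<in> S \<Longrightarrow> locally_bounded_family V f z"
    and \<psi>: "continuous_on S \<psi>" and \<eta>: "continuous_on V \<eta>"
    and max: "\<forall>\<^sub>F z in nhds z\<^sub>0. upper_limit V f z - \<psi> z \<le> upper_limit V f z\<^sub>0 - \<psi> z\<^sub>0"
    and "0 < \<gamma>"
  obtains \<epsilon> z v where "0 < \<epsilon>" "\<epsilon> < \<gamma>" "z \<in> S" "dist z z\<^sub>0 < \<gamma>" "v \<in> V"
    "\<bar>f \<epsilon> z v - upper_limit V f z\<^sub>0\<bar> < \<gamma>"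
    "\<And>v'. v' \<in> V \<Longrightarrow> f \<epsilon> z v' - \<epsilon> * \<eta> v' \<le> f \<epsilon> z v - \<epsilon> * \<eta> v"
    "\<forall>\<^sub>F z' in nhds z. f \<epsilon> z' v - \<psi> z' - (dist z' z\<^sub>0)\<^sup>2 \<le> f \<epsilon> z v - \<psi> z - (dist z z\<^sub>0)\<^sup>2"
proof -
  define U where "U = upper_limit V f"
  have \<psi>_at: "\<forall>\<^sub>F z' in nhds z. \<bar>\<psi> z' - \<psi> z\<bar> < e" if "z \<in> S" "0 < e" for z e
  proof -
    have "(\<psi> \<longlongrightarrow> \<psi> z) (nhds z)"
      using \<psi> S that by (simp add: continuous_on_eq_continuous_at isCont_def tendsto_at_iff_tendsto_nhds)
    then show ?thesis
      using tendstoD[of \<psi> "\<psi> z" "nhds z" e] that by (simp add: dist_real_def)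
  qed
  have "\<forall>\<^sub>F z in nhds z\<^sub>0. z \<in> S \<and> \<bar>\<psi> z - \<psi> z\<^sub>0\<bar> < \<gamma> / 4 \<and> U z - \<psi> z \<le> U z\<^sub>0 - \<psi> z\<^sub>0"
    using max \<psi>_at[of z\<^sub>0 "\<gamma> / 4"] eventually_nhds_in_open[OF S] S(2) \<open>0 < \<gamma>\<close>
    by (auto simp: U_def eventually_conj_iff)
  then obtain d\<^sub>0 where d0: "0 < d\<^sub>0" "\<And>z. dist z z\<^sub>0 < d\<^sub>0 \<Longrightarrow>
      z \<in> S \<and> \<bar>\<psi> z - \<psi> z\<^sub>0\<bar> < \<gamma> / 4 \<and> U z - \<psi> z \<le> U z\<^sub>0 - \<psi> z\<^sub>0"
    unfolding eventually_nhds_metric by blast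
  define d where "d = min (d\<^sub>0 / 2) (\<gamma> / 2)"
  have d: "0 < d" "d < \<gamma>" "\<And>z. dist z z\<^sub>0 \<le> d \<Longrightarrow>
      z \<in> S \<and> \<bar>\<psi> z - \<psi> z\<^sub>0\<bar> < \<gamma> / 4 \<and> U z - \<psi> z \<le> U z\<^sub>0 - \<psi> z\<^sub>0"
    using d0 \<open>0 < \<gamma>\<close> by (auto simp: d_def)
  \<comment> \<open>A tolerance for which the loss of \<open>6 \<kappa>\<close> below keeps the maximum off the sphere of radius \<open>d\<close>.\<close>
  define \<kappa> where "\<kappa> = min (\<gamma> / 8) (d\<^sup>2 / 8)"
  have \<kappa>: "0 < \<kappa>" "8 * \<kappa> \<le> \<gamma>" "8 * \<kappa> \<le> d\<^sup>2"
    using d(1) \<open>0 < \<gamma>\<close> by (auto simp: \<kappa>_def)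
  have "bounded (\<eta> ` V)"
    using \<eta> V(1) compact_continuous_image compact_imp_bounded by blast
  then obtain E where E: "0 < E" "\<And>v. v \<in> V \<Longrightarrow> \<bar>\<eta> v\<bar> \<le> E"
    unfolding bounded_pos by auto
  let ?B = "cball z\<^sub>0 d"
  have BS: "?B \<subseteq> S"
    using d(3) by (auto simp: dist_commute)
  have above: "\<forall>\<^sub>F \<epsilon> in at_right 0. \<forall>z\<in>?B. \<forall>v\<in>V. f \<epsilon> z v - \<psi> z \<le> U z\<^sub>0 - \<psi> z\<^sub>0 + \<kappa>"
  proof (rule eventually_ball_compact)
    show "compact ?B" by simp
    fix z
    assume "z \<in> ?B"
    then have z: "z \<in> S" "U z - \<psi> z \<le> U z\<^sub>0 - \<psi> z\<^sub>0"
      using d(3)[of z] by (auto simp: dist_commute)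
    have "\<forall>\<^sub>F q in at_right (0::real) \<times>\<^sub>F nhds z. \<forall>v\<in>V. f (fst q) (snd q) v \<le> U z + \<kappa> / 2"
      using \<kappa>(1) bdd[OF z(1)] V(2) by (intro eventually_less_upper_limit) (auto simp: U_def)
    moreover have "\<forall>\<^sub>F q::real \<times> _ in at_right (0::real) \<times>\<^sub>F nhds z. \<bar>\<psi> (snd q) - \<psi> z\<bar> < \<kappa> / 2"
      using eventually_prodI[OF always_eventually \<psi>_at[OF z(1), of "\<kappa> / 2"], of "\<lambda>_. True"] \<kappa>(1) by simp
    ultimately show "\<forall>\<^sub>F q in at_right (0::real) \<times>\<^sub>F nhds z. \<forall>v\<in>V. f (fst q) (snd q) v - \<psi> (snd q) \<le> U z\<^sub>0 - \<psi> z\<^sub>0 + \<kappa>"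
    proof eventually_elim
      case (elim q)
      show ?case
      proof
        fix v
        assume "v \<in> V"
        then have "f (fst q) (snd q) v \<le> U z + \<kappa> / 2" "\<bar>\<psi> (snd q) - \<psi> z\<bar> < \<kappa> / 2"
          using elim by auto
        then show "f (fst q) (snd q) v - \<psi> (snd q) \<le> U z\<^sub>0 - \<psi> z\<^sub>0 + \<kappa>"
          using z(2) by linarith
      qed
    qed
  qed
  have small: "\<forall>\<^sub>F \<epsilon> in at_right 0. 0 < \<epsilon> \<and> \<epsilon> < \<gamma> \<and> \<epsilon> * E < \<kappa>"
  proof -
    have "\<forall>\<^sub>F \<epsilon> in at_right (0::real). \<epsilon> < min \<gamma> (\<kappa> / E)"
      using \<open>0 < \<gamma>\<close> \<kappa>(1) E(1) by (intro order_tendstoD(2)[OF tendsto_ident_at]) auto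
    with eventually_at_right_less[of "0::real"] show ?thesis
      by eventually_elim (use E(1) in \<open>auto simp: field_simps\<close>)
  qed
  have close: "\<forall>\<^sub>F z in nhds z\<^sub>0. dist z z\<^sub>0 \<le> d \<and> \<bar>\<psi> z - \<psi> z\<^sub>0\<bar> < \<kappa> \<and> (dist z z\<^sub>0)\<^sup>2 < \<kappa>"
  proof -
    have "\<forall>\<^sub>F z in nhds z\<^sub>0. dist z z\<^sub>0 < min d (sqrt \<kappa>)"
      unfolding eventually_nhds_metric using d(1) \<kappa>(1) by (intro exI[of _ "min d (sqrt \<kappa>)"]) simp
    with \<psi>_at[OF S(2) \<kappa>(1)] show ?thesis
    proof eventually_elim
      case (elim z)
      then have "(dist z z\<^sub>0)\<^sup>2 < (sqrt \<kappa>)\<^sup>2"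
        by (intro power_strict_mono) auto
      with elim \<kappa>(1) show ?case by simp
    qed
  qed
  have "\<exists>\<^sub>F q in at_right (0::real) \<times>\<^sub>F nhds z\<^sub>0. \<exists>v\<in>V. U z\<^sub>0 - \<kappa> < f (fst q) (snd q) v"
    using \<kappa>(1) bdd[OF S(2)] V(2) by (intro frequently_greater_upper_limit) (auto simp: U_def)
  moreover have "\<forall>\<^sub>F q in at_right (0::real) \<times>\<^sub>F nhds z\<^sub>0.
      (\<forall>z\<in>?B. \<forall>v\<in>V. f (fst q) z v - \<psi> z \<le> U z\<^sub>0 - \<psi> z\<^sub>0 + \<kappa>) \<and> 0 < fst q \<and> fst q < \<gamma> \<and>
      fst q * E < \<kappa> \<and> dist (snd q) z\<^sub>0 \<le> d \<and> \<bar>\<psi> (snd q) - \<psi> z\<^sub>0\<bar> < \<kappa> \<and> (dist (snd q) z\<^sub>0)\<^sup>2 < \<kappa>"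
    using eventually_prodI[OF eventually_conj[OF above small] close] by (rule eventually_mono) simp
  ultimately have "\<exists>\<^sub>F q in at_right (0::real) \<times>\<^sub>F nhds z\<^sub>0. (\<exists>v\<in>V. U z\<^sub>0 - \<kappa> < f (fst q) (snd q) v) \<and>
      (\<forall>z\<in>?B. \<forall>v\<in>V. f (fst q) z v - \<psi> z \<le> U z\<^sub>0 - \<psi> z\<^sub>0 + \<kappa>) \<and> 0 < fst q \<and> fst q < \<gamma> \<and>
      fst q * E < \<kappa> \<and> dist (snd q) z\<^sub>0 \<le> d \<and> \<bar>\<psi> (snd q) - \<psi> z\<^sub>0\<bar> < \<kappa> \<and> (dist (snd q) z\<^sub>0)\<^sup>2 < \<kappa>"
    by (rule frequently_eventually_frequently)
  then obtain q where "(\<exists>v\<in>V. U z\<^sub>0 - \<kappa> < f (fst q) (snd q) v) \<and>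
      (\<forall>z\<in>?B. \<forall>v\<in>V. f (fst q) z v - \<psi> z \<le> U z\<^sub>0 - \<psi> z\<^sub>0 + \<kappa>) \<and> 0 < fst q \<and> fst q < \<gamma> \<and>
      fst q * E < \<kappa> \<and> dist (snd q) z\<^sub>0 \<le> d \<and> \<bar>\<psi> (snd q) - \<psi> z\<^sub>0\<bar> < \<kappa> \<and> (dist (snd q) z\<^sub>0)\<^sup>2 < \<kappa>"
    by (rule frequentlyE)
  then obtain \<epsilon> z\<^sub>1 v\<^sub>1 where \<epsilon>: "0 < \<epsilon>" "\<epsilon> < \<gamma>" "\<epsilon> * E < \<kappa>"
      and above: "\<And>z v. z \<in> ?B \<Longrightarrow> v \<in> V \<Longrightarrow> f \<epsilon> z v - \<psi> z \<le> U z\<^sub>0 - \<psi> z\<^sub>0 + \<kappa>"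
      and 1: "v\<^sub>1 \<in> V" "U z\<^sub>0 - \<kappa> < f \<epsilon> z\<^sub>1 v\<^sub>1" "dist z\<^sub>1 z\<^sub>0 \<le> d" "\<bar>\<psi> z\<^sub>1 - \<psi> z\<^sub>0\<bar> < \<kappa>"
        "(dist z\<^sub>1 z\<^sub>0)\<^sup>2 < \<kappa>"
    by metis
  define G where "G = (\<lambda>(z, v). f \<epsilon> z v - \<psi> z - (dist z z\<^sub>0)\<^sup>2 - \<epsilon> * \<eta> v)"
  have "continuous_on (?B \<times> V) (\<lambda>q. (case q of (z, v) \<Rightarrow> f \<epsilon> z v)
      - \<psi> (fst q) - (dist (fst q) z\<^sub>0)\<^sup>2 - \<epsilon> * \<eta> (snd q))"
    using BS
    by (intro continuous_intros continuous_on_subset[OF f[OF \<epsilon>(1)]]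
        continuous_on_compose2[OF \<psi>] continuous_on_compose2[OF \<eta>]) auto
  then have "continuous_on (?B \<times> V) G"
    by (simp add: G_def case_prod_beta)
  then obtain q where q: "q \<in> ?B \<times> V" "\<And>q'. q' \<in> ?B \<times> V \<Longrightarrow> G q' \<le> G q"
    using continuous_attains_sup[of "?B \<times> V" G] compact_Times[of ?B V] V d(1) by auto
  obtain z v where zv: "q = (z, v)" "z \<in> ?B" "v \<in> V"
    using q(1) by auto
  have \<eta>_small: "\<bar>\<epsilon> * \<eta> w\<bar> \<le> \<kappa>" if "w \<in> V" for w
  proof -
    have "\<bar>\<epsilon> * \<eta> w\<bar> = \<epsilon> * \<bar>\<eta> w\<bar>"
      using \<epsilon>(1) by (simp add: abs_mult)
    also have "\<dots> \<le> \<epsilon> * E"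
      using E(2)[OF that] \<epsilon>(1) by (intro mult_left_mono) auto
    finally show ?thesis
      using \<epsilon>(3) by simp
  qed
  have "G (z\<^sub>1, v\<^sub>1) \<le> G (z, v)"
    using q(2)[of "(z\<^sub>1, v\<^sub>1)"] 1 zv(1) by (simp add: dist_commute)
  then have low: "U z\<^sub>0 - \<psi> z\<^sub>0 - 4 * \<kappa> \<le> f \<epsilon> z v - \<psi> z - (dist z z\<^sub>0)\<^sup>2 - \<epsilon> * \<eta> v"
    using 1 \<eta>_small[OF 1(1)] unfolding G_def by simp
  have up: "f \<epsilon> z v - \<psi> z \<le> U z\<^sub>0 - \<psi> z\<^sub>0 + \<kappa>"
    using above zv by blast
  have "(dist z z\<^sub>0)\<^sup>2 \<le> 6 * \<kappa>"
    using low up \<eta>_small[OF zv(3)] by linarith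
  also have "\<dots> < d\<^sup>2"
    using \<kappa> by linarith
  finally have dz: "dist z z\<^sub>0 < d"
    using d(1) by (simp add: power_less_imp_less_base)
  have \<psi>z: "\<bar>\<psi> z - \<psi> z\<^sub>0\<bar> < \<gamma> / 4"
    using d(3)[of z] dz by simp
  show thesis
  proof (rule that[OF \<epsilon>(1,2) _ _ zv(3)])
    show "z \<in> S" "dist z z\<^sub>0 < \<gamma>"
      using BS zv dz d(2) by auto
    have "0 \<le> (dist z z\<^sub>0)\<^sup>2"
      by simp
    then show "\<bar>f \<epsilon> z v - upper_limit V f z\<^sub>0\<bar> < \<gamma>"
      unfolding U_def[symmetric] using low up \<psi>z \<eta>_small[OF zv(3)] \<kappa>(1,2) \<open>0 < \<gamma>\<close> by linarith
    show "f \<epsilon> z v' - \<epsilon> * \<eta> v' \<le> f \<epsilon> z v - \<epsilon> * \<eta> v" if "v' \<in> V" for v'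
      using q(2)[of "(z, v')"] zv that by (simp add: G_def)
    have "\<forall>\<^sub>F z' in nhds z. z' \<in> ball z\<^sub>0 d"
      using dz by (intro eventually_nhds_in_open) (auto simp: dist_commute)
    then show "\<forall>\<^sub>F z' in nhds z. f \<epsilon> z' v - \<psi> z' - (dist z' z\<^sub>0)\<^sup>2 \<le> f \<epsilon> z v - \<psi> z - (dist z z\<^sub>0)\<^sup>2"
    proof eventually_elim
      case (elim z')
      then show ?case
        using q(2)[of "(z', v)"] zv by (simp add: G_def)
    qed
  qed
qed

section \<open>Comparison of viscosity solutions\<close>

lemma viscosity_subsolutionD:
  assumes "viscosity_subsolution F u" "test_function \<psi> D" "0 < fst z"
    "\<forall>\<^sub>F q in nhds z. u (fst q) (snd q) - \<psi> q \<le> u (fst z) (snd z) - \<psi> z"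
  shows "F (u (fst z) (snd z)) (fst (D z)) (snd (D z)) \<le> 0"
  using assms unfolding viscosity_subsolution_def case_prod_beta by (cases z) auto

lemma viscosity_supersolutionD:
  assumes "viscosity_supersolution F u" "test_function \<psi> D" "0 < fst z"
    "\<forall>\<^sub>F q in nhds z. u (fst q) (snd q) - \<psi> q \<ge> u (fst z) (snd z) - \<psi> z"
  shows "0 \<le> F (u (fst z) (snd z)) (fst (D z)) (snd (D z))"
  using assms unfolding viscosity_supersolution_def case_prod_beta by (cases z) auto

text \<open>Upper semicontinuity relative to \<open>S\<close>; lower semicontinuity of \<open>f\<close> is expressed as upper
  semicontinuity of \<open>- f\<close>.\<close>

definition usc_on :: "'a::topological_space set \<Rightarrow> ('a \<Rightarrow> real) \<Rightarrow> bool" where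
  "usc_on S f \<longleftrightarrow> (\<forall>z\<in>S. \<forall>a>f z. \<forall>\<^sub>F z' in nhds z. z' \<in> S \<longrightarrow> f z' < a)"

lemma usc_onD: "usc_on S f \<Longrightarrow> z \<in> S \<Longrightarrow> f z < a \<Longrightarrow> \<forall>\<^sub>F z' in nhds z. z' \<in> S \<longrightarrow> f z' < a"
  by (auto simp: usc_on_def)

lemma usc_on_subset: "usc_on S f \<Longrightarrow> T \<subseteq> S \<Longrightarrow> usc_on T f"
  unfolding usc_on_def by (blast intro: eventually_mono)

lemma usc_on_continuous: "continuous_on S f \<Longrightarrow> usc_on S f"
  unfolding usc_on_def continuous_on_def
proof safe
  fix z a
  assume "\<forall>x\<in>S. (f \<longlongrightarrow> f x) (at x within S)" "z \<in> S" "f z < a"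
  then have "\<forall>\<^sub>F z' in at z within S. f z' < a"
    by (auto intro: order_tendstoD(2))
  then show "\<forall>\<^sub>F z' in nhds z. z' \<in> S \<longrightarrow> f z' < a"
    unfolding eventually_at_filter by eventually_elim (use \<open>f z < a\<close> in auto)
qed

lemma usc_on_add:
  assumes "usc_on S f" "usc_on S g"
  shows "usc_on S (\<lambda>z. f z + g z)"
  unfolding usc_on_def
proof safe
  fix z a
  assume z: "z \<in> S" "f z + g z < a"
  define e where "e = (a - f z - g z) / 2"
  have "f z < f z + e" "g z < g z + e"
    using z by (auto simp: e_def)
  from usc_onD[OF assms(1) z(1) this(1)] usc_onD[OF assms(2) z(1) this(2)]
  show "\<forall>\<^sub>F z' in nhds z. z' \<in> S \<longrightarrow> f z' + g z' < a"
    by eventually_elim (auto simp: e_def field_simps)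
qed

lemma usc_on_compose:
  assumes "usc_on S f" "continuous_on UNIV h" "h ` T \<subseteq> S"
  shows "usc_on T (\<lambda>z. f (h z))"
  unfolding usc_on_def
proof safe
  fix z a
  assume z: "z \<in> T" "f (h z) < a"
  have "\<forall>\<^sub>F y in nhds (h z). y \<in> S \<longrightarrow> f y < a"
    using usc_onD[OF assms(1)] z assms(3) by blast
  moreover have "filterlim h (nhds (h z)) (nhds z)"
    using assms(2) by (simp add: continuous_on_def tendsto_at_iff_tendsto_nhds)
  ultimately have "\<forall>\<^sub>F z' in nhds z. h z' \<in> S \<longrightarrow> f (h z') < a"
    unfolding filterlim_iff by blast
  then show "\<forall>\<^sub>F z' in nhds z. z' \<in> T \<longrightarrow> f (h z') < a"
    by eventually_elim (use assms(3) in auto)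
qed

lemma usc_attains_sup:
  assumes "compact K" "K \<noteq> {}" "usc_on K f"
  shows "\<exists>x\<in>K. \<forall>y\<in>K. f y \<le> f x"
proof (rule ccontr)
  assume "\<not> (\<exists>x\<in>K. \<forall>y\<in>K. f y \<le> f x)"
  then have "\<forall>x\<in>K. \<exists>y. y \<in> K \<and> f x < f y"
    by (meson not_le)
  from bchoice[OF this] obtain Y where Y: "\<forall>x\<in>K. Y x \<in> K \<and> f x < f (Y x)" ..
  have "\<forall>x\<in>K. \<exists>U. open U \<and> x \<in> U \<and> (\<forall>z\<in>U. z \<in> K \<longrightarrow> f z < f (Y x))"
    using Y usc_onD[OF assms(3)] unfolding eventually_nhds by blast
  from bchoice[OF this] obtain U
    where U: "\<forall>x\<in>K. open (U x) \<and> x \<in> U x \<and> (\<forall>z\<in>U x. z \<in> K \<longrightarrow> f z < f (Y x))" ..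
  obtain C where C: "C \<subseteq> K" "finite C" "K \<subseteq> (\<Union>x\<in>C. U x)"
    using compactE_image[OF assms(1), of K U] U by blast
  have "C \<noteq> {}"
    using C(3) assms(2) by auto
  then obtain c where c: "c \<in> C" "\<And>x. x \<in> C \<Longrightarrow> f (Y x) \<le> f (Y c)"
    using obtains_MAX[OF C(2), of "\<lambda>x. f (Y x)"] Max_ge[of "(\<lambda>x. f (Y x)) ` C"] C(2)
    by (metis finite_imageI imageI)
  have "Y c \<in> K"
    using c(1) C(1) Y by blast
  then obtain x where "x \<in> C" "Y c \<in> U x"
    using C(3) by blast
  then have "f (Y c) < f (Y x)"
    using U C(1) \<open>Y c \<in> K\<close> by blast
  with c(2)[OF \<open>x \<in> C\<close>] show False by simp
qed

lemma GDERIV_halfsquare: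
  fixes z :: "'a::real_inner"
  shows "GDERIV (\<lambda>z. k / 2 * (norm (z - a))\<^sup>2) z :> k *\<^sub>R (z - a)"
  unfolding gderiv_def power2_norm_eq_inner
  by (auto intro!: derivative_eq_intros simp: inner_commute algebra_simps)

text \<open>A smooth substitute for \<open>|x - x\<^sub>0| + R t\<close>. For \<open>R > 0\<close> its sublevel sets are bounded in \<open>t \<ge> 0\<close>, and
  its space gradient has norm at most \<open>1\<close>, so an equation with speed of propagation below \<open>R\<close> is
  strictly monotone along it.\<close>

definition cone_gauge :: "real \<Rightarrow> real ^ 'n \<Rightarrow> real \<times> (real ^ 'n) \<Rightarrow> real" where
  "cone_gauge R x\<^sub>0 z = sqrt (1 + (norm (snd z - x\<^sub>0))\<^sup>2) + R * fst z"

definition cone_gradient :: "real \<Rightarrow> real ^ 'n \<Rightarrow> real \<times> (real ^ 'n) \<Rightarrow> real \<times> (real ^ 'n)" where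
  "cone_gradient R x\<^sub>0 z = (R, (snd z - x\<^sub>0) /\<^sub>R sqrt (1 + (norm (snd z - x\<^sub>0))\<^sup>2))"

lemma one_plus_norm_pos: "0 < 1 + (norm x)\<^sup>2"
  by (simp add: add_pos_nonneg)

lemma GDERIV_cone_gauge: "GDERIV (cone_gauge R x\<^sub>0) z :> cone_gradient R x\<^sub>0 z"
proof -
  have pos: "0 < 1 + (snd z - x\<^sub>0) \<bullet> (snd z - x\<^sub>0)"
    using one_plus_norm_pos[of "snd z - x\<^sub>0"] by (simp add: power2_norm_eq_inner)
  have "((\<lambda>z. sqrt (1 + (snd z - x\<^sub>0) \<bullet> (snd z - x\<^sub>0)) + R * fst z) has_derivative
      (\<lambda>h. (snd h \<bullet> (snd z - x\<^sub>0)) / sqrt (1 + (snd z - x\<^sub>0) \<bullet> (snd z - x\<^sub>0)) + R * fst h)) (at z)"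
    using pos by (auto intro!: derivative_eq_intros simp: inner_commute divide_simps)
  then show ?thesis
    unfolding gderiv_def cone_gauge_def cone_gradient_def power2_norm_eq_inner
    by (simp add: inner_prod_def inner_commute divide_inverse mult.commute add.commute)
qed

lemma continuous_on_cone_gradient:
  fixes x\<^sub>0 :: "real ^ 'n"
  shows "continuous_on S (cone_gradient R x\<^sub>0)"
proof -
  have "1 + (norm (snd z - x\<^sub>0))\<^sup>2 \<noteq> 0" for z :: "real \<times> (real ^ 'n)"
    using one_plus_norm_pos[of "snd z - x\<^sub>0"] by linarith
  then show ?thesis
    unfolding cone_gradient_def by (intro continuous_intros) simp
qed

lemma norm_snd_cone_gradient: "norm (snd (cone_gradient R x\<^sub>0 z)) \<le> 1"
proof -
  have "norm (snd z - x\<^sub>0) = sqrt ((norm (snd z - x\<^sub>0))\<^sup>2)"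
    by simp
  also have "\<dots> \<le> sqrt (1 + (norm (snd z - x\<^sub>0))\<^sup>2)"
    by (rule real_sqrt_le_mono) simp
  finally show ?thesis
    using one_plus_norm_pos[of "snd z - x\<^sub>0"] by (simp add: cone_gradient_def divide_simps)
qed

lemma norm_le_cone_gauge:
  assumes "0 \<le> R" "0 \<le> fst z"
  shows "norm (snd z - x\<^sub>0) \<le> cone_gauge R x\<^sub>0 z"
proof -
  have "norm (snd z - x\<^sub>0) = sqrt ((norm (snd z - x\<^sub>0))\<^sup>2)"
    by simp
  also have "\<dots> \<le> sqrt (1 + (norm (snd z - x\<^sub>0))\<^sup>2)"
    by (rule real_sqrt_le_mono) simp
  also have "\<dots> \<le> cone_gauge R x\<^sub>0 z"
    using assms by (simp add: cone_gauge_def)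
  finally show ?thesis .
qed

lemma time_le_cone_gauge:
  assumes "1 \<le> R" "0 \<le> fst z"
  shows "fst z \<le> cone_gauge R x\<^sub>0 z"
proof -
  have "1 * fst z \<le> R * fst z"
    using assms by (intro mult_right_mono)
  moreover have "0 \<le> sqrt (1 + (norm (snd z - x\<^sub>0))\<^sup>2)"
    by simp
  ultimately show ?thesis
    unfolding cone_gauge_def by linarith
qed

lemma continuous_on_cone_gauge: "continuous_on S (cone_gauge R x\<^sub>0)"
  unfolding cone_gauge_def by (intro continuous_intros)

text \<open>Doubling of variables, localised to a backward cone. The penalty \<open>\<theta>\<close> is small at
  \<open>(t\<^sub>1, x\<^sub>1)\<close>, exceeds the bound \<open>C\<close> of \<open>u\<close> outside a compact part of the cone, and increases in time
  faster than the Hamiltonian can compensate, because the cone opens with speed \<open>R + 1\<close> while the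
  Hamiltonian has Lipschitz constant \<open>R\<close>. The penalty thus confines the maximum to a bounded set,
  whatever the growth of \<open>u\<close> and \<open>w\<close>, and supplies the strict inequality that ends the argument.
  The obstacle is harmless: at the maximum \<open>u > w \<ge> 0\<close>, so for \<open>u\<close> the differential inequality
  itself holds.\<close>

lemma viscosity_comparison:
  fixes u w :: "real \<Rightarrow> real ^ 'n \<Rightarrow> real" and G :: "real ^ 'n \<Rightarrow> real"
  assumes sub: "viscosity_subsolution (\<lambda>u a p. min (a + G p) u) u"
    and super: "viscosity_supersolution (\<lambda>u a p. min (a + G p) u) w"
    and u: "usc_on ({0..} \<times> UNIV) (\<lambda>z. u (fst z) (snd z))"
    and w: "usc_on ({0..} \<times> UNIV) (\<lambda>z. - w (fst z) (snd z))"
    and w_nonneg: "\<And>t x. 0 \<le> t \<Longrightarrow> 0 \<le> w t x"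
    and init: "\<And>x. u 0 x \<le> w 0 x"
    and R: "0 \<le> R" and G: "\<And>p q. G p \<le> G q + R * norm (p - q)"
    and "0 \<le> t\<^sub>1"
  shows "u t\<^sub>1 x\<^sub>1 \<le> w t\<^sub>1 x\<^sub>1"
proof (rule ccontr)
  assume less: "\<not> u t\<^sub>1 x\<^sub>1 \<le> w t\<^sub>1 x\<^sub>1"
  define \<delta> where "\<delta> = (u t\<^sub>1 x\<^sub>1 - w t\<^sub>1 x\<^sub>1) / 2"
  have \<delta>: "0 < \<delta>" "u t\<^sub>1 x\<^sub>1 - w t\<^sub>1 x\<^sub>1 = 2 * \<delta>"
    using less by (auto simp: \<delta>_def)
  define R\<^sub>1 where "R\<^sub>1 = R + 1"
  define \<sigma> where "\<sigma> = cone_gauge R\<^sub>1 x\<^sub>1"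
  define L where "L = \<sigma> (t\<^sub>1, x\<^sub>1)"
  define B where "B = L + 2"
  define A :: "(real \<times> (real ^ 'n)) set" where "A = {0..B} \<times> cball x\<^sub>1 B"
  have L: "0 \<le> L" "t\<^sub>1 \<le> L"
    using time_le_cone_gauge[of R\<^sub>1 "(t\<^sub>1, x\<^sub>1)" x\<^sub>1] R \<open>0 \<le> t\<^sub>1\<close> by (auto simp: L_def \<sigma>_def R\<^sub>1_def)
  have A: "compact A" "(t\<^sub>1, x\<^sub>1) \<in> A" "A \<subseteq> {0..} \<times> UNIV"
    using L \<open>0 \<le> t\<^sub>1\<close> by (auto simp: A_def B_def intro: compact_Times)
  define U where "U z = u (fst z) (snd z)" for z
  define W where "W z = w (fst z) (snd z)" for z
  have U: "usc_on A U" and W: "usc_on A (\<lambda>z. - W z)"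
    using u w A(3) by (auto simp: U_def[abs_def] W_def[abs_def] intro: usc_on_subset)
  have W_nonneg: "0 \<le> W z" if "z \<in> A" for z
    using that A(3) w_nonneg by (auto simp: W_def)
  obtain C where C: "0 < C" "\<And>z. z \<in> A \<Longrightarrow> U z \<le> C"
  proof -
    obtain z where "z \<in> A" "\<And>y. y \<in> A \<Longrightarrow> U y \<le> U z"
      using usc_attains_sup[OF A(1) _ U] A(2) by blast
    then show ?thesis
      using that[of "max 1 (U z)"] by fastforce
  qed
  \<comment> \<open>The weight \<open>\<delta>\<close> costs half of the gap at \<open>(t\<^sub>1, x\<^sub>1)\<close>, and \<open>k\<close> makes \<open>\<theta> > C\<close> one unit of \<open>\<sigma>\<close> further out.\<close>
  define k where "k = C / \<delta>"
  have k: "0 < k" "C < \<delta> * exp k"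
  proof -
    show "0 < k"
      using C \<delta> by (simp add: k_def)
    have "\<delta> * (1 + k) \<le> \<delta> * exp k"
      using \<delta>(1) exp_ge_add_one_self[of k] by (intro mult_left_mono) auto
    then show "C < \<delta> * exp k"
      using \<delta>(1) by (simp add: k_def algebra_simps)
  qed
  define \<theta> where "\<theta> z = \<delta> * exp (k * (\<sigma> z - L))" for z
  have \<theta>_pos: "0 < \<theta> z" for z
    using \<delta> by (simp add: \<theta>_def)
  have \<theta>_deriv: "GDERIV \<theta> z :> (k * \<theta> z) *\<^sub>R cone_gradient R\<^sub>1 x\<^sub>1 z" for z
  proof -
    have "DERIV (\<lambda>s. \<delta> * exp (k * (s - L))) (\<sigma> z) :> k * \<theta> z"
      unfolding \<theta>_def by (auto intro!: derivative_eq_intros)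
    from GDERIV_DERIV_compose[OF GDERIV_cone_gauge this[unfolded \<sigma>_def]] show ?thesis
      by (simp add: \<theta>_def[abs_def] \<sigma>_def)
  qed
  have \<theta>_cont: "continuous_on S \<theta>" for S
    unfolding \<theta>_def \<sigma>_def by (intro continuous_intros continuous_on_cone_gauge)
  define \<Phi> where "\<Phi> n q = U (fst q) - W (snd q) - real n / 2 * (norm (fst q - snd q))\<^sup>2 - \<theta> (fst q)"
    for n q
  have "\<forall>n. \<exists>q. q \<in> A \<times> A \<and> (\<forall>q'\<in>A \<times> A. \<Phi> n q' \<le> \<Phi> n q)"
  proof
    fix n
    have "usc_on (A \<times> A) (\<lambda>q. (U (fst q) + - W (snd q)) + (- (real n / 2 * (norm (fst q - snd q))\<^sup>2) - \<theta> (fst q)))"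
      by (intro usc_on_add usc_on_compose[OF U] usc_on_compose[OF W] usc_on_continuous
          continuous_intros continuous_on_compose2[OF \<theta>_cont]) auto
    also have "(\<lambda>q. (U (fst q) + - W (snd q)) + (- (real n / 2 * (norm (fst q - snd q))\<^sup>2) - \<theta> (fst q)))
        = \<Phi> n"
      by (rule ext) (simp add: \<Phi>_def)
    finally have usc: "usc_on (A \<times> A) (\<Phi> n)" .
    have "A \<times> A \<noteq> {}"
      using A(2) by auto
    from usc_attains_sup[OF compact_Times[OF A(1) A(1)] this usc]
    show "\<exists>q. q \<in> A \<times> A \<and> (\<forall>q'\<in>A \<times> A. \<Phi> n q' \<le> \<Phi> n q)"
      by (simp only: Bex_def)
  qed
  from choice[OF this] obtain q
    where "\<forall>n. q n \<in> A \<times> A \<and> (\<forall>q'\<in>A \<times> A. \<Phi> n q' \<le> \<Phi> n (q n))" ..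
  then have q: "\<And>n. q n \<in> A \<times> A" "\<And>n q'. q' \<in> A \<times> A \<Longrightarrow> \<Phi> n q' \<le> \<Phi> n (q n)"
    by blast+
  have \<Phi>_ge: "\<delta> \<le> \<Phi> n (q n)" for n
  proof -
    have "\<Phi> n ((t\<^sub>1, x\<^sub>1), (t\<^sub>1, x\<^sub>1)) = \<delta>"
      using \<delta> by (simp add: \<Phi>_def U_def W_def \<theta>_def L_def)
    then show ?thesis
      using q(2)[of "((t\<^sub>1, x\<^sub>1), (t\<^sub>1, x\<^sub>1))" n] A(2) by simp
  qed
  define Z where "Z n = fst (q n)" for n
  define Z' where "Z' n = snd (q n)" for n
  have ZA: "Z n \<in> A" "Z' n \<in> A" for n
    using q(1)[of n] by (auto simp: Z_def Z'_def)
  have est: "\<delta> + real n / 2 * (norm (Z n - Z' n))\<^sup>2 + \<theta> (Z n) \<le> U (Z n) - W (Z' n)" for n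
    using \<Phi>_ge[of n] by (simp add: \<Phi>_def Z_def Z'_def)
  have pen: "real n / 2 * (norm (Z n - Z' n))\<^sup>2 \<le> C" for n
    using est[of n] C(2)[OF ZA(1)[of n]] W_nonneg[OF ZA(2)[of n]] \<theta>_pos[of "Z n"] \<delta>(1) by linarith
  have \<sigma>_less: "\<sigma> (Z n) < L + 1" for n
  proof (rule ccontr)
    assume "\<not> \<sigma> (Z n) < L + 1"
    then have "\<delta> * exp k \<le> \<theta> (Z n)"
      using k(1) \<delta>(1) by (simp add: \<theta>_def)
    moreover have "0 \<le> real n / 2 * (norm (Z n - Z' n))\<^sup>2"
      by simp
    ultimately show False
      using est[of n] C(2)[OF ZA(1)[of n]] W_nonneg[OF ZA(2)[of n]] k(2) \<delta>(1) by linarith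
  qed
  obtain z s where zs: "z \<in> A" "strict_mono s" "(Z \<circ> s) \<longlonglongrightarrow> z"
    using A(1) ZA(1) unfolding compact_def by metis
  have lim1: "(\<lambda>n. Z (s n)) \<longlonglongrightarrow> z"
    using zs(3) by (simp add: o_def)
  have lim2: "(\<lambda>n. Z' (s n)) \<longlonglongrightarrow> z"
  proof -
    have "(\<lambda>n. Z n - Z' n) \<longlonglongrightarrow> 0"
    proof (rule tendsto_norm_zero_cancel,
        rule tendsto_sandwich[where f="\<lambda>_. 0" and h="\<lambda>n. sqrt (2 * C * (1 / real n))"])
      show "\<forall>\<^sub>F n in sequentially. norm (Z n - Z' n) \<le> sqrt (2 * C * (1 / real n))"
        using eventually_gt_at_top[of 0]
      proof eventually_elim
        case (elim n)
        then have "(norm (Z n - Z' n))\<^sup>2 \<le> 2 * C * (1 / real n)"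
          using pen[of n] by (simp add: field_simps)
        then show ?case
          by (rule real_le_rsqrt)
      qed
      have "(\<lambda>n. sqrt (2 * C * (1 / real n))) \<longlonglongrightarrow> sqrt (2 * C * 0)"
        by (intro tendsto_intros lim_1_over_n)
      then show "(\<lambda>n. sqrt (2 * C * (1 / real n))) \<longlonglongrightarrow> 0"
        by simp
    qed auto
    from tendsto_diff[OF lim1 LIMSEQ_subseq_LIMSEQ[OF this zs(2)]] show ?thesis
      by (simp add: o_def)
  qed
  \<comment> \<open>The limit point keeps a positive gap, hence it is not at time \<open>0\<close>.\<close>
  have "W z < U z"
  proof -
    have "\<forall>\<^sub>F n in sequentially. Z (s n) \<in> A \<longrightarrow> U (Z (s n)) < U z + \<delta> / 2"
      using usc_onD[OF U zs(1), of "U z + \<delta> / 2"] lim1 \<delta>(1) unfolding filterlim_iff by auto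
    moreover have "\<forall>\<^sub>F n in sequentially. Z' (s n) \<in> A \<longrightarrow> - W (Z' (s n)) < - W z + \<delta> / 2"
      using usc_onD[OF W zs(1), of "- W z + \<delta> / 2"] lim2 \<delta>(1) unfolding filterlim_iff by auto
    ultimately have "\<forall>\<^sub>F n in sequentially. W z < U z"
    proof eventually_elim
      case (elim n)
      have "0 \<le> real (s n) / 2 * (norm (Z (s n) - Z' (s n)))\<^sup>2"
        by simp
      then show ?case
        using elim(1)[rule_format, OF ZA(1)] elim(2)[rule_format, OF ZA(2)]
          est[of "s n"] \<theta>_pos[of "Z (s n)"] by linarith
    qed
    then show ?thesis by simp
  qed
  then have "fst z \<noteq> 0"
    using init[of "snd z"] by (auto simp: U_def W_def)
  moreover have "0 \<le> fst z"
    using zs(1) A(3) by (auto simp: mem_Times_iff)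
  ultimately have "0 < fst z"
    by simp
  have "\<sigma> z \<le> L + 1"
  proof (rule tendsto_upperbound)
    show "(\<lambda>n. \<sigma> (Z (s n))) \<longlonglongrightarrow> \<sigma> z"
      using lim1 by (intro continuous_on_tendsto_compose[OF continuous_on_cone_gauge[of UNIV R\<^sub>1 x\<^sub>1, folded \<sigma>_def]]) auto
    show "\<forall>\<^sub>F n in sequentially. \<sigma> (Z (s n)) \<le> L + 1"
      by (intro always_eventually allI less_imp_le \<sigma>_less)
  qed simp
  define I where "I = {0<..<B} \<times> ball x\<^sub>1 B"
  have I: "open I" "z \<in> I" "I \<subseteq> A"
  proof -
    show "z \<in> I"
      using \<open>\<sigma> z \<le> L + 1\<close> \<open>0 < fst z\<close> R norm_le_cone_gauge[of R\<^sub>1 z x\<^sub>1] time_le_cone_gauge[of R\<^sub>1 z x\<^sub>1]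
      by (cases z) (auto simp: I_def B_def \<sigma>_def R\<^sub>1_def dist_norm norm_minus_commute)
  qed (auto simp: I_def A_def open_Times)
  have "\<forall>\<^sub>F n in sequentially. Z (s n) \<in> I \<and> Z' (s n) \<in> I"
    using topological_tendstoD[OF lim1 I(1,2)] topological_tendstoD[OF lim2 I(1,2)]
    by (rule eventually_conj)
  then obtain m where m: "Z m \<in> I" "Z' m \<in> I"
    by (auto dest!: eventually_happens)
  define N where "N = real m"
  define a b where "a = Z m" and "b = Z' m"
  have ab: "a \<in> I" "b \<in> I" "fst a > 0" "fst b > 0"
    using m by (auto simp: a_def b_def I_def)
  have max: "\<Phi> m (c, d) \<le> \<Phi> m (a, b)" if "c \<in> A" "d \<in> A" for c d
    using q(2)[of "(c, d)" m] that by (simp add: a_def b_def Z_def Z'_def)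
  have U_pos: "0 < U a"
  proof -
    have "0 \<le> real m / 2 * (norm (a - b))\<^sup>2"
      by simp
    then show ?thesis
      using est[of m] W_nonneg[OF ZA(2)[of m]] \<theta>_pos[of a] \<delta>(1) unfolding a_def b_def by linarith
  qed
  define D where "D c = N *\<^sub>R (c - b) + (k * \<theta> c) *\<^sub>R cone_gradient R\<^sub>1 x\<^sub>1 c" for c
  have "min (fst (D a) + G (snd (D a))) (U a) \<le> 0"
  proof -
    have "test_function (\<lambda>c. N / 2 * (norm (c - b))\<^sup>2 + \<theta> c) D"
      unfolding test_function_def D_def
      by (intro conjI ballI GDERIV_add GDERIV_halfsquare \<theta>_deriv continuous_intros \<theta>_cont
          continuous_on_cone_gradient)
    moreover have "\<forall>\<^sub>F c in nhds a. U c - (N / 2 * (norm (c - b))\<^sup>2 + \<theta> c)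
        \<le> U a - (N / 2 * (norm (a - b))\<^sup>2 + \<theta> a)"
      using eventually_nhds_in_open[OF I(1) ab(1)]
    proof eventually_elim
      case (elim c)
      then have "c \<in> A" "b \<in> A"
        using I(3) ab by blast+
      from max[OF this] show ?case
        by (simp add: \<Phi>_def N_def algebra_simps)
    qed
    ultimately show ?thesis
      unfolding U_def using ab(3) by (intro viscosity_subsolutionD[OF sub])
  qed
  then have 1: "fst (D a) + G (snd (D a)) \<le> 0"
    using U_pos by (simp add: min_le_iff_disj)
  define D' where "D' c = - (N *\<^sub>R (c - a))" for c
  have "0 \<le> min (fst (D' b) + G (snd (D' b))) (W b)"
  proof -
    have "test_function (\<lambda>c. - (N / 2 * (norm (c - a))\<^sup>2)) D'"
      unfolding test_function_def D'_def
      by (intro conjI ballI GDERIV_minus GDERIV_halfsquare continuous_intros)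
    moreover have "\<forall>\<^sub>F c in nhds b. W c - - (N / 2 * (norm (c - a))\<^sup>2)
        \<ge> W b - - (N / 2 * (norm (b - a))\<^sup>2)"
      using eventually_nhds_in_open[OF I(1) ab(2)]
    proof eventually_elim
      case (elim c)
      then have "a \<in> A" "c \<in> A"
        using I(3) ab by blast+
      from max[OF this] show ?case
        by (simp add: \<Phi>_def N_def norm_minus_commute algebra_simps)
    qed
    ultimately show ?thesis
      unfolding W_def using ab(4) by (intro viscosity_supersolutionD[OF super])
  qed
  then have 2: "0 \<le> fst (D' b) + G (snd (D' b))"
    by simp
  define \<beta> where "\<beta> = k * \<theta> a"
  define g where "g = snd (cone_gradient R\<^sub>1 x\<^sub>1 a)"
  have \<beta>: "0 < \<beta>"
    using k(1) \<theta>_pos by (simp add: \<beta>_def)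
  have D: "fst (D a) = fst (D' b) + \<beta> * R\<^sub>1" "snd (D a) = snd (D' b) + \<beta> *\<^sub>R g"
    by (auto simp: D_def D'_def \<beta>_def g_def cone_gradient_def algebra_simps)
  have "G (snd (D' b)) \<le> G (snd (D a)) + R * norm (snd (D' b) - snd (D a))"
    by (rule G)
  also have "R * norm (snd (D' b) - snd (D a)) = \<beta> * (R * norm g)"
    using \<beta> by (simp add: D)
  also have "\<dots> \<le> \<beta> * (R * 1)"
    using \<beta> R norm_snd_cone_gradient[of R\<^sub>1 x\<^sub>1 a] unfolding g_def
    by (intro mult_left_mono) auto
  finally have "\<beta> * R\<^sub>1 \<le> \<beta> * R"
    using 1 2 D(1) by linarith
  with \<beta> show False
    by (simp add: R\<^sub>1_def)
qed

text \<open>The obstacle part of the equation only speaks about points that can be touched from below by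
  test functions. Near a point where a continuous \<open>u\<close> is negative there is such a point with a
  negative value: subtract a sufficiently steep paraboloid.\<close>

lemma viscosity_supersolution_nonneg:
  fixes u :: "real \<Rightarrow> real ^ 'n \<Rightarrow> real"
  assumes super: "viscosity_supersolution (\<lambda>u a p. min (H a p) u) u"
    and u: "continuous_on ({0..} \<times> UNIV) (\<lambda>(t, x). u t x)"
    and "0 < t"
  shows "0 \<le> u t x"
proof (rule ccontr)
  assume neg: "\<not> 0 \<le> u t x"
  define z\<^sub>0 where "z\<^sub>0 = (t, x)"
  define U where "U z = u (fst z) (snd z)" for z
  define d where "d = t / 2"
  let ?B = "cball z\<^sub>0 d"
  have pos: "0 < fst z" if "z \<in> ?B" for z
  proof -
    have "\<bar>fst z\<^sub>0 - fst z\<bar> \<le> d"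
      using that dist_fst_le[of z\<^sub>0 z] by (simp add: dist_real_def)
    from abs_le_D1[OF this] show ?thesis
      using \<open>0 < t\<close> by (simp add: z\<^sub>0_def d_def)
  qed
  have d: "0 < d"
    using \<open>0 < t\<close> by (simp add: d_def)
  have U: "continuous_on ?B U"
  proof -
    have "?B \<subseteq> {0..} \<times> UNIV"
      using pos by (auto simp: mem_Times_iff intro: less_imp_le)
    from continuous_on_subset[OF u this] show ?thesis
      by (simp add: U_def[abs_def] case_prod_beta)
  qed
  obtain y where y: "y \<in> ?B" "\<And>z. z \<in> ?B \<Longrightarrow> U y \<le> U z"
    using continuous_attains_inf[OF _ _ U] d by auto
  define k where "k = (U z\<^sub>0 - U y + 1) / d\<^sup>2"
  have "continuous_on ?B (\<lambda>z. U z + k * (norm (z - z\<^sub>0))\<^sup>2)"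
    by (intro continuous_intros U)
  then obtain z where z: "z \<in> ?B"
      "\<And>c. c \<in> ?B \<Longrightarrow> U z + k * (norm (z - z\<^sub>0))\<^sup>2 \<le> U c + k * (norm (c - z\<^sub>0))\<^sup>2"
    using continuous_attains_inf[of ?B "\<lambda>z. U z + k * (norm (z - z\<^sub>0))\<^sup>2"] d by auto
  have k: "0 \<le> k"
    using y(2)[of z\<^sub>0] d by (simp add: k_def)
  have z0: "U z + k * (norm (z - z\<^sub>0))\<^sup>2 \<le> U z\<^sub>0"
    using z(2)[of z\<^sub>0] d by simp
  have "norm (z - z\<^sub>0) \<noteq> d"
  proof
    assume "norm (z - z\<^sub>0) = d"
    then have "U z + (U z\<^sub>0 - U y + 1) \<le> U z\<^sub>0"
      using z0 d by (simp add: k_def)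
    with y(2)[OF z(1)] show False by simp
  qed
  then have inner: "z \<in> ball z\<^sub>0 d"
    using z(1) by (simp add: dist_norm norm_minus_commute)
  define D where "D c = - ((2 * k) *\<^sub>R (c - z\<^sub>0))" for c
  have "0 \<le> min (H (fst (D z)) (snd (D z))) (U z)"
  proof -
    have "test_function (\<lambda>c. - (2 * k / 2 * (norm (c - z\<^sub>0))\<^sup>2)) D"
      unfolding test_function_def D_def
      by (intro conjI ballI GDERIV_minus GDERIV_halfsquare continuous_intros)
    moreover have "\<forall>\<^sub>F c in nhds z. U c - - (2 * k / 2 * (norm (c - z\<^sub>0))\<^sup>2)
        \<ge> U z - - (2 * k / 2 * (norm (z - z\<^sub>0))\<^sup>2)"
      using eventually_nhds_in_open[OF open_ball inner]
    proof eventually_elim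
      case (elim c)
      then show ?case
        using z(2)[of c] by simp
    qed
    ultimately show ?thesis
      unfolding U_def using pos[OF z(1)] by (intro viscosity_supersolutionD[OF super])
  qed
  then have "0 \<le> U z"
    by simp
  moreover have "U z\<^sub>0 < 0"
    using neg by (simp add: U_def z\<^sub>0_def)
  ultimately show False
    using z0 mult_nonneg_nonneg[OF k zero_le_power2[of "norm (z - z\<^sub>0)"]] by linarith
qed

lemma continuous_on_if_usc_on:
  assumes "usc_on S f" "usc_on S (\<lambda>z. - f z)"
  shows "continuous_on S f"
  unfolding continuous_on_def
proof
  fix z
  assume z: "z \<in> S"
  show "(f \<longlongrightarrow> f z) (at z within S)"
  proof (rule order_tendstoI)
    fix a
    assume "a < f z"
    then show "\<forall>\<^sub>F q in at z within S. a < f q"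
      using usc_onD[OF assms(2) z, of "- a"] unfolding eventually_at_filter
      by (auto elim: eventually_mono)
  next
    fix a
    assume "f z < a"
    then show "\<forall>\<^sub>F q in at z within S. f q < a"
      using usc_onD[OF assms(1) z, of a] unfolding eventually_at_filter
      by (auto elim: eventually_mono)
  qed
qed

lemma viscosity_supersolution_cong:
  assumes "viscosity_supersolution F u" and eq: "\<And>t x. 0 < t \<Longrightarrow> u t x = w t x"
  shows "viscosity_supersolution F (w :: real \<Rightarrow> real ^ 'n \<Rightarrow> real)"
  unfolding viscosity_supersolution_def
proof (intro allI impI, elim conjE)
  fix \<psi> D t and x :: "real ^ 'n"
  assume *: "test_function \<psi> D" "0 < t"
    and min: "\<forall>\<^sub>F (s, y) in nhds (t, x). w s y - \<psi> (s, y) \<ge> w t x - \<psi> (t, x)"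
  have "\<forall>\<^sub>F q in nhds (t, x). q \<in> {0<..} \<times> UNIV"
    using *(2) by (intro eventually_nhds_in_open) (auto simp: open_Times)
  with min have "\<forall>\<^sub>F q in nhds (t, x). u (fst q) (snd q) - \<psi> q \<ge> u (fst (t, x)) (snd (t, x)) - \<psi> (t, x)"
    by eventually_elim (use *(2) eq in auto)
  from viscosity_supersolutionD[OF assms(1) *(1) _ this] *(2) eq
  show "0 \<le> F (w t x) (fst (D (t, x))) (snd (D (t, x)))"
    by simp
qed

section \<open>Bounds on the kinetic solutions\<close>

text \<open>A barrier principle on a time interval: a positive maximum would have to be attained at a
  positive time, where \<open>f\<close> decreases.\<close>

lemma nonpos_if_decreasing_where_positive:
  fixes f :: "real \<Rightarrow> real"
  assumes "0 \<le> t" "continuous_on {0..t} f" "f 0 \<le> 0"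
    "\<And>s. 0 < s \<Longrightarrow> s \<le> t \<Longrightarrow> 0 < f s \<Longrightarrow> \<exists>d<0. (f has_real_derivative d) (at s)"
  shows "f t \<le> 0"
proof (rule ccontr)
  assume "\<not> f t \<le> 0"
  obtain s where s: "s \<in> {0..t}" "\<And>y. y \<in> {0..t} \<Longrightarrow> f y \<le> f s"
    using continuous_attains_sup[of "{0..t}" f] assms(1,2) by auto
  have "0 < f s"
    using s(2)[of t] assms(1) \<open>\<not> f t \<le> 0\<close> by simp
  moreover have "0 < s"
    using s(1) assms(3) \<open>0 < f s\<close> by (cases "s = 0") auto
  ultimately obtain d where "d < 0" "(f has_real_derivative d) (at s)"
    using assms(4)[of s] s(1) by auto
  then obtain e where e: "0 < e" "\<And>h. 0 < h \<Longrightarrow> h < e \<Longrightarrow> f s < f (s - h)"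
    using DERIV_neg_dec_left by blast
  define h where "h = min (e / 2) s"
  have "f s < f (s - h)"
    using e \<open>0 < s\<close> by (auto simp: h_def)
  moreover have "f (s - h) \<le> f s"
    using s(1) e(1) \<open>0 < s\<close> by (intro s(2)) (auto simp: h_def)
  ultimately show False by simp
qed

locale kinetic_family = velocity_law V M
  for V :: "(real ^ 'n) set" and M :: "real ^ 'n \<Rightarrow> real" +
  fixes r :: real
    and \<phi>\<^sub>0 :: "real ^ 'n \<Rightarrow> real ^ 'n \<Rightarrow> real"
    and \<phi> :: "real \<Rightarrow> real \<Rightarrow> real ^ 'n \<Rightarrow> real ^ 'n \<Rightarrow> real"
  assumes r: "0 < r" and full: "full_support V M"
    and \<phi>\<^sub>0_nonneg: "\<And>x v. v \<in> V \<Longrightarrow> 0 \<le> \<phi>\<^sub>0 x v"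
    and solution: "\<And>\<epsilon>. 0 < \<epsilon> \<Longrightarrow> kinetic_solution V M r \<epsilon> \<phi>\<^sub>0 (\<phi> \<epsilon>)"
begin

definition phase :: "real \<Rightarrow> real \<times> (real ^ 'n) \<Rightarrow> real ^ 'n \<Rightarrow> real" where
  "phase \<epsilon> z v = \<phi> \<epsilon> (fst z) (snd z) v"

definition mass :: "real \<Rightarrow> real \<times> (real ^ 'n) \<Rightarrow> real" where
  "mass \<epsilon> z = avg (\<lambda>v. exp (- phase \<epsilon> z v / \<epsilon>))"

text \<open>The form \<open>\<rho> exp (\<phi> / \<epsilon>)\<close> of this average (\<open>gain_eq\<close>) shows its growth in \<open>\<phi>\<close>; the form with
  differences is the one to compare with a profile in \<open>v\<close>.\<close>

definition gain :: "real \<Rightarrow> real \<times> (real ^ 'n) \<Rightarrow> real ^ 'n \<Rightarrow> real" where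
  "gain \<epsilon> z v = avg (\<lambda>v'. exp ((phase \<epsilon> z v - phase \<epsilon> z v') / \<epsilon>))"

text \<open>The derivative along the characteristic that the kinetic equation prescribes.\<close>

definition slope :: "real \<Rightarrow> real \<times> (real ^ 'n) \<Rightarrow> real ^ 'n \<Rightarrow> real" where
  "slope \<epsilon> z v = 1 + r * mass \<epsilon> z - (1 + r) * gain \<epsilon> z v"

lemma phase_continuous:
  assumes "0 < \<epsilon>"
  shows "continuous_on (({0..} \<times> UNIV) \<times> V) (\<lambda>q. phase \<epsilon> (fst q) (snd q))"
proof -
  have "continuous_on ({0..} \<times> UNIV \<times> V) (\<lambda>(t, x, v). \<phi> \<epsilon> t x v)"
    using solution[OF assms] by (simp add: kinetic_solution_def)
  then have "continuous_on (({0..} \<times> UNIV) \<times> V)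
      (\<lambda>q. (\<lambda>(t, x, v). \<phi> \<epsilon> t x v) (fst (fst q), snd (fst q), snd q))"
    by (rule continuous_on_compose2) (auto intro!: continuous_intros)
  then show ?thesis
    by (simp add: phase_def)
qed

lemma phase_nonneg: "0 < \<epsilon> \<Longrightarrow> 0 \<le> fst z \<Longrightarrow> v \<in> V \<Longrightarrow> 0 \<le> phase \<epsilon> z v"
  using solution by (auto simp: kinetic_solution_def phase_def)

lemma phase_initial: "0 < \<epsilon> \<Longrightarrow> v \<in> V \<Longrightarrow> phase \<epsilon> (0, x) v = \<phi>\<^sub>0 x v"
  using solution by (auto simp: kinetic_solution_def phase_def)

lemma phase_continuous_velocity:
  assumes "0 < \<epsilon>" "0 \<le> fst z"
  shows "continuous_on V (phase \<epsilon> z)"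
proof -
  have "continuous_on V (\<lambda>v. (\<lambda>q. phase \<epsilon> (fst q) (snd q)) (z, v))"
    by (rule continuous_on_compose2[OF phase_continuous[OF assms(1)]])
      (use assms(2) in \<open>auto intro!: continuous_intros simp: mem_Times_iff\<close>)
  then show ?thesis by simp
qed

text \<open>The initial datum inherits its continuity from any one of the solutions.\<close>

lemma initial_continuous: "continuous_on (UNIV \<times> V) (\<lambda>q. \<phi>\<^sub>0 (fst q) (snd q))"
proof -
  have "continuous_on (UNIV \<times> V) (\<lambda>q. (\<lambda>q. phase 1 (fst q) (snd q)) ((0, fst q), snd q))"
    by (rule continuous_on_compose2[OF phase_continuous[of 1]])
      (auto intro!: continuous_intros)
  then show ?thesis
    by (rule continuous_on_eq) (auto simp: phase_initial)
qed

lemma continuous_on_boltzmann: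
  assumes "0 < \<epsilon>" "0 \<le> fst z"
  shows "continuous_on V (\<lambda>v. exp (- phase \<epsilon> z v / \<epsilon>))"
    "continuous_on V (\<lambda>v'. exp ((a - phase \<epsilon> z v') / \<epsilon>))"
  using assms by (auto intro!: continuous_intros phase_continuous_velocity)

lemma gain_eq: "gain \<epsilon> z v = exp (phase \<epsilon> z v / \<epsilon>) * mass \<epsilon> z"
proof -
  have "exp ((phase \<epsilon> z v - phase \<epsilon> z v') / \<epsilon>) = exp (phase \<epsilon> z v / \<epsilon>) * exp (- phase \<epsilon> z v' / \<epsilon>)" for v'
    unfolding exp_add[symmetric] by (simp add: diff_divide_distrib)
  then show ?thesis
    by (simp add: gain_def mass_def avg_cmult)
qed

lemma mass_pos: "0 < \<epsilon> \<Longrightarrow> 0 \<le> fst z \<Longrightarrow> 0 < mass \<epsilon> z"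
  unfolding mass_def by (intro avg_pos continuous_on_boltzmann) auto

lemma mass_le_1: "0 < \<epsilon> \<Longrightarrow> 0 \<le> fst z \<Longrightarrow> mass \<epsilon> z \<le> 1"
  unfolding mass_def by (intro avg_le_const continuous_on_boltzmann) (auto simp: phase_nonneg)

lemma gain_pos: "0 < \<epsilon> \<Longrightarrow> 0 \<le> fst z \<Longrightarrow> 0 < gain \<epsilon> z v"
  by (simp add: gain_eq mass_pos)

lemma phase_derivative:
  assumes \<epsilon>: "0 < \<epsilon>" and z: "0 < fst z" and v: "v \<in> V"
  shows "((\<lambda>s. phase \<epsilon> (z + s *\<^sub>R (1, v)) v) has_real_derivative slope \<epsilon> z v) (at 0)"
proof -
  obtain d where d: "((\<lambda>s. \<phi> \<epsilon> (fst z + s) (snd z + s *\<^sub>R v) v) has_real_derivative d) (at 0)"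
      "d + r = (1 + r) * (LINT v':V|lebesgue. M v' * (1 - exp ((phase \<epsilon> z v - phase \<epsilon> z v') / \<epsilon>)))
        + r * rho V M \<epsilon> (\<phi> \<epsilon>) (fst z) (snd z)"
    using solution[OF \<epsilon>] z v unfolding kinetic_solution_def phase_def by blast
  have "rho V M \<epsilon> (\<phi> \<epsilon>) (fst z) (snd z) = mass \<epsilon> z"
    by (simp add: rho_def mass_def avg_def phase_def)
  moreover have "(LINT v':V|lebesgue. M v' * (1 - exp ((phase \<epsilon> z v - phase \<epsilon> z v') / \<epsilon>))) = 1 - gain \<epsilon> z v"
    using avg_diff[OF continuous_on_const continuous_on_boltzmann(2)[OF \<epsilon>], of z 1 "phase \<epsilon> z v"] z
    by (simp add: gain_def avg_def[of "\<lambda>v'. 1 - exp ((phase \<epsilon> z v - phase \<epsilon> z v') / \<epsilon>)"])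
  ultimately have "d + r = (1 + r) * (1 - gain \<epsilon> z v) + r * mass \<epsilon> z"
    using d(2) by (simp only:)
  then have "d = slope \<epsilon> z v"
    by (simp add: slope_def algebra_simps)
  with d(1) show ?thesis
    by (simp add: phase_def)
qed

definition characteristic :: "real \<times> (real ^ 'n) \<Rightarrow> real ^ 'n \<Rightarrow> real \<Rightarrow> real \<times> (real ^ 'n)" where
  "characteristic z v s = (s, snd z - (fst z - s) *\<^sub>R v)"

lemma characteristic_simps [simp]:
  "fst (characteristic z v s) = s" "characteristic z v (fst z) = z"
  "characteristic z v 0 = (0, snd z - fst z *\<^sub>R v)"
  by (auto simp: characteristic_def)

lemma phase_characteristic_derivative:
  assumes "0 < \<epsilon>" "0 < s" "v \<in> V"
  shows "((\<lambda>s. phase \<epsilon> (characteristic z v s) v) has_real_derivative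
      slope \<epsilon> (characteristic z v s) v) (at s)"
proof -
  have "characteristic z v s + h *\<^sub>R (1, v) = characteristic z v (h + s)" for h
    by (simp add: characteristic_def algebra_simps)
  then show ?thesis
    using phase_derivative[OF assms(1) _ assms(3), of "characteristic z v s"] assms(2)
      DERIV_shift[of "\<lambda>s. phase \<epsilon> (characteristic z v s) v" _ 0 s] by simp
qed

lemma phase_characteristic_continuous:
  assumes "0 < \<epsilon>" "v \<in> V"
  shows "continuous_on {0..t} (\<lambda>s. phase \<epsilon> (characteristic z v s) v)"
proof -
  have "continuous_on {0..t} (\<lambda>s. (\<lambda>q. phase \<epsilon> (fst q) (snd q)) (characteristic z v s, v))"
    by (rule continuous_on_compose2[OF phase_continuous[OF assms(1)]])
      (use assms(2) in \<open>auto intro!: continuous_intros simp: characteristic_def\<close>)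
  then show ?thesis by simp
qed

text \<open>The slope never exceeds \<open>1 + r\<close>, as \<open>\<rho> \<le> 1\<close> and the gain is nonnegative.\<close>

lemma phase_le_transported:
  assumes \<epsilon>: "0 < \<epsilon>" and z: "0 \<le> fst z" and v: "v \<in> V"
  shows "phase \<epsilon> z v \<le> \<phi>\<^sub>0 (snd z - fst z *\<^sub>R v) v + (1 + r) * fst z"
proof -
  define f where "f s = phase \<epsilon> (characteristic z v s) v
      - \<phi>\<^sub>0 (snd z - fst z *\<^sub>R v) v - (1 + r) * s" for s
  have "f (fst z) \<le> 0"
  proof (rule nonpos_if_decreasing_where_positive[OF z])
    show "continuous_on {0..fst z} f"
      unfolding f_def by (intro continuous_intros phase_characteristic_continuous \<epsilon> v)
    show "f 0 \<le> 0"
      using phase_initial[OF \<epsilon> v] by (simp add: f_def)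
    fix s
    assume s: "0 < s" "s \<le> fst z"
    let ?d = "slope \<epsilon> (characteristic z v s) v - 0 - (1 + r)"
    have "(f has_real_derivative ?d) (at s)"
      unfolding f_def
      by (intro DERIV_diff phase_characteristic_derivative \<epsilon> s v DERIV_const)
        (auto intro!: derivative_eq_intros)
    moreover have "?d < 0"
    proof -
      have "r * mass \<epsilon> (characteristic z v s) \<le> r * 1"
        using r mass_le_1[OF \<epsilon>, of "characteristic z v s"] s by (intro mult_left_mono) auto
      moreover have "0 < (1 + r) * gain \<epsilon> (characteristic z v s) v"
        using r gain_pos[OF \<epsilon>, of "characteristic z v s" v] s by simp
      ultimately show ?thesis
        by (simp add: slope_def)
    qed
    ultimately show "\<exists>d<0. (f has_real_derivative d) (at s)" by blast
  qed
  then show ?thesis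
    by (simp add: f_def)
qed

lemma velocity_bound: obtains R where "0 < R" "\<And>v. v \<in> V \<Longrightarrow> norm v \<le> R"
  using compact_imp_bounded[OF compact_V] unfolding bounded_pos by blast

lemma initial_bound:
  obtains C where "0 < C" "\<And>y v. y \<in> cball x e \<Longrightarrow> v \<in> V \<Longrightarrow> \<phi>\<^sub>0 y v \<le> C"
proof -
  have "continuous_on (cball x e \<times> V) (\<lambda>q. \<phi>\<^sub>0 (fst q) (snd q))"
    by (rule continuous_on_subset[OF initial_continuous]) auto
  then have "bounded ((\<lambda>q. \<phi>\<^sub>0 (fst q) (snd q)) ` (cball x e \<times> V))"
    by (intro compact_imp_bounded compact_continuous_image compact_Times compact_cball compact_V)
  then obtain C where "0 < C" "\<forall>q\<in>(\<lambda>q. \<phi>\<^sub>0 (fst q) (snd q)) ` (cball x e \<times> V). norm q \<le> C"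
    unfolding bounded_pos by blast
  then show ?thesis
    by (intro that[of C]) force+
qed

lemma phase_locally_bounded:
  assumes "0 < fst z"
  shows "locally_bounded_family V phase z"
proof -
  obtain R where R: "0 < R" "\<And>v. v \<in> V \<Longrightarrow> norm v \<le> R"
    using velocity_bound by blast
  obtain C where C: "0 < C"
      "\<And>y v. y \<in> cball (snd z) (1 + (fst z + 1) * R) \<Longrightarrow> v \<in> V \<Longrightarrow> \<phi>\<^sub>0 y v \<le> C"
    using initial_bound by blast
  have "\<forall>\<^sub>F q in nhds z. q \<in> ball z 1 \<inter> {0<..} \<times> UNIV"
    using assms by (intro eventually_nhds_in_open) (auto simp: open_Times mem_Times_iff)
  from eventually_prodI[OF eventually_at_right_less[of "0::real"] this]
  have "\<forall>\<^sub>F q in at_right (0::real) \<times>\<^sub>F nhds z. \<forall>v\<in>V. \<bar>phase (fst q) (snd q) v\<bar> \<le> C + (1 + r) * (fst z + 1)"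
  proof eventually_elim
    case (elim q)
    show ?case
    proof
      fix v
      assume v: "v \<in> V"
      define t x where "t = fst (snd q)" and "x = snd (snd q)"
      have t: "0 < t" "t \<le> fst z + 1" "dist (snd z) x \<le> 1"
        using elim dist_fst_le[of z "snd q"] dist_snd_le[of z "snd q"]
        by (auto simp: t_def x_def dist_real_def mem_Times_iff abs_le_iff)
      have "dist (snd z) (x - t *\<^sub>R v) \<le> dist (snd z) x + norm (t *\<^sub>R v)"
        by (metis dist_triangle dist_norm add_diff_cancel_left' diff_add_cancel diff_diff_eq2)
      also have "\<dots> \<le> 1 + (fst z + 1) * R"
        using t R(2)[OF v] by (intro add_mono) (auto intro: mult_mono)
      finally have "\<phi>\<^sub>0 (x - t *\<^sub>R v) v \<le> C"
        using C(2) v by simp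
      moreover have "(1 + r) * t \<le> (1 + r) * (fst z + 1)"
        using t r by (intro mult_left_mono) auto
      moreover have "phase (fst q) (snd q) v \<le> \<phi>\<^sub>0 (x - t *\<^sub>R v) v + (1 + r) * t"
        "0 \<le> phase (fst q) (snd q) v"
        using phase_le_transported[of "fst q" "snd q" v] phase_nonneg[of "fst q" "snd q" v] elim v t
        by (auto simp: t_def x_def)
      ultimately show "\<bar>phase (fst q) (snd q) v\<bar> \<le> C + (1 + r) * (fst z + 1)"
        by linarith
    qed
  qed
  then show ?thesis
    by (auto simp: locally_bounded_family_def)
qed

text \<open>The initial layer. For velocities \<open>w\<close> near \<open>v\<^sub>0\<close> transport alone keeps \<open>\<phi>\<close> below some \<open>A < a\<close>
  for a short time, and these velocities have positive mass \<open>m\<close>, so \<open>\<rho> \<ge> m exp (- A / \<epsilon>)\<close>. For any other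
  velocity, as long as \<open>\<phi> > a\<close>, the gain is at least \<open>m exp ((a - A) / \<epsilon>)\<close>, and \<open>\<phi>\<close> falls along its
  characteristic at a rate that tends to infinity. For small \<open>\<epsilon>\<close> this rate exceeds that of the
  linear barrier from \<open>a + C\<close> at time \<open>0\<close> to \<open>a\<close> at time \<open>t \<ge> \<tau>\<close>.\<close>

lemma phase_upper_initial_layer:
  assumes v0: "v\<^sub>0 \<in> V" and a: "\<phi>\<^sub>0 x\<^sub>0 v\<^sub>0 < a"
  obtains \<nu> where "0 < \<nu>" "\<And>\<tau>. 0 < \<tau> \<Longrightarrow> \<forall>\<^sub>F \<epsilon> in at_right 0. \<forall>z. \<tau> \<le> fst z \<and> fst z < \<nu> \<and>
      dist (snd z) x\<^sub>0 < \<nu> \<longrightarrow> (\<forall>v\<in>V. phase \<epsilon> z v \<le> a)"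
proof -
  obtain R where R: "0 < R" "\<And>v. v \<in> V \<Longrightarrow> norm v \<le> R"
    using velocity_bound by blast
  obtain a' where a': "\<phi>\<^sub>0 x\<^sub>0 v\<^sub>0 < a'" "a' < a"
    using a dense by blast
  obtain e where e: "0 < e" "\<And>y w. w \<in> V \<Longrightarrow> dist x\<^sub>0 y < e \<Longrightarrow> dist v\<^sub>0 w < e \<Longrightarrow> \<phi>\<^sub>0 y w < a'"
  proof -
    have "\<forall>\<^sub>F q in nhds (x\<^sub>0, v\<^sub>0). q \<in> UNIV \<times> V \<longrightarrow> \<phi>\<^sub>0 (fst q) (snd q) < a'"
      using usc_onD[OF usc_on_continuous[OF initial_continuous], of "(x\<^sub>0, v\<^sub>0)" a'] v0 a'(1) by simp
    then obtain d where d: "0 < d" "\<And>q. dist q (x\<^sub>0, v\<^sub>0) < d \<Longrightarrow> q \<in> UNIV \<times> V \<Longrightarrow> \<phi>\<^sub>0 (fst q) (snd q) < a'"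
      unfolding eventually_nhds_metric by blast
    have "\<phi>\<^sub>0 y w < a'" if "w \<in> V" "dist x\<^sub>0 y < d / 2" "dist v\<^sub>0 w < d / 2" for y w
    proof -
      have "dist (y, w) (x\<^sub>0, v\<^sub>0) \<le> dist y x\<^sub>0 + dist w v\<^sub>0"
        by (simp add: dist_prod_def sqrt_sum_squares_le_sum)
      also have "\<dots> < d"
        using that by (simp add: dist_commute)
      finally show ?thesis
        using d(2)[of "(y, w)"] that(1) by simp
    qed
    then show ?thesis
      using that[of "d / 2"] d(1) by simp
  qed
  obtain m where m: "0 < m"
      "\<And>f (b::real). continuous_on V f \<Longrightarrow> (\<And>v. v \<in> V \<Longrightarrow> 0 \<le> f v) \<Longrightarrow> 0 \<le> b \<Longrightarrow>
         (\<And>v. v \<in> V \<Longrightarrow> dist v\<^sub>0 v < e \<Longrightarrow> b \<le> f v) \<Longrightarrow> b * m \<le> avg f"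
    using avg_ge_on_ball[OF full v0 e(1)] by blast
  obtain C where C: "0 < C" "\<And>y v. y \<in> cball x\<^sub>0 e \<Longrightarrow> v \<in> V \<Longrightarrow> \<phi>\<^sub>0 y v \<le> C"
    using initial_bound by blast
  define \<sigma> where "\<sigma> = (a - a') / 2"
  define \<nu> where "\<nu> = min (e / (1 + 2 * R)) (\<sigma> / (1 + r))"
  have \<sigma>: "0 < \<sigma>"
    using a' by (simp add: \<sigma>_def)
  have \<nu>: "0 < \<nu>" "\<nu> * (1 + 2 * R) \<le> e" "(1 + r) * \<nu> \<le> \<sigma>"
  proof -
    show "0 < \<nu>"
      using \<sigma> e(1) R(1) r by (simp add: \<nu>_def)
    have "\<nu> \<le> e / (1 + 2 * R)" "\<nu> \<le> \<sigma> / (1 + r)"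
      by (simp_all add: \<nu>_def)
    then show "\<nu> * (1 + 2 * R) \<le> e" "(1 + r) * \<nu> \<le> \<sigma>"
      using R(1) r by (simp_all add: field_simps)
  qed
  have main: "phase \<epsilon> z v \<le> a"
    if \<tau>: "0 < \<tau>" "\<tau> \<le> fst z" "fst z < \<nu>" "dist (snd z) x\<^sub>0 < \<nu>" and v: "v \<in> V"
      and \<epsilon>: "0 < \<epsilon>" "\<epsilon> * ((1 + r) + C / \<tau>) < \<sigma> * ((1 + r) * m)" for \<tau> \<epsilon> z v
  proof -
    define t where "t = fst z"
    define P where "P = characteristic z v"
    define f where "f s = phase \<epsilon> (P s) v - a - C * (1 - s / t)" for s
    have t: "0 < t" "\<tau> \<le> t" "t < \<nu>"
      using \<tau> by (auto simp: t_def)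
    have foot: "dist x\<^sub>0 (snd (P s) - s' *\<^sub>R w) < e"
      if s: "0 \<le> s" "s \<le> t" "0 \<le> s'" "s' \<le> s" and w: "w \<in> V" for s s' w
    proof -
      have "x\<^sub>0 - (snd (P s) - s' *\<^sub>R w) = (x\<^sub>0 - snd z) + ((t - s) *\<^sub>R v + s' *\<^sub>R w)"
        by (simp add: P_def characteristic_def t_def)
      then have "dist x\<^sub>0 (snd (P s) - s' *\<^sub>R w) \<le> dist (snd z) x\<^sub>0 + (norm ((t - s) *\<^sub>R v) + norm (s' *\<^sub>R w))"
        unfolding dist_norm
        by (metis norm_triangle_ineq norm_triangle_le add_left_mono norm_minus_commute)
      also have "\<dots> \<le> dist (snd z) x\<^sub>0 + (\<nu> * R + \<nu> * R)"
        using s t R \<open>w \<in> V\<close> v by (intro add_mono) (auto intro!: mult_mono)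
      also have "\<dots> < \<nu> + (\<nu> * R + \<nu> * R)"
        using \<tau> by simp
      also have "\<dots> \<le> e"
        using \<nu>(2) by (simp add: algebra_simps)
      finally show ?thesis .
    qed
    have "f t \<le> 0"
    proof (rule nonpos_if_decreasing_where_positive[of t f])
      show "0 \<le> t"
        using t by simp
      show "continuous_on {0..t} f"
        unfolding f_def P_def using t
        by (intro continuous_intros phase_characteristic_continuous \<epsilon>(1) v) auto
      have "\<phi>\<^sub>0 (snd (P 0)) v \<le> C"
        using C(2)[OF _ v] foot[of 0 0 v] t v by (simp add: less_imp_le)
      then show "f 0 \<le> 0"
        using phase_initial[OF \<epsilon>(1) v] \<phi>\<^sub>0_nonneg[OF v0, of x\<^sub>0] a by (simp add: f_def P_def)
      fix s
      assume s: "0 < s" "s \<le> t" "0 < f s"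
      define A where "A = a' + \<sigma>"
      have "exp (- A / \<epsilon>) * m \<le> mass \<epsilon> (P s)"
        unfolding mass_def
      proof (rule m(2))
        show "continuous_on V (\<lambda>w. exp (- phase \<epsilon> (P s) w / \<epsilon>))"
          using \<epsilon> s by (intro continuous_on_boltzmann) (auto simp: P_def)
        fix w
        assume w: "w \<in> V" "dist v\<^sub>0 w < e"
        have "phase \<epsilon> (P s) w \<le> \<phi>\<^sub>0 (snd (P s) - s *\<^sub>R w) w + (1 + r) * s"
          using phase_le_transported[OF \<epsilon>(1) _ w(1), of "P s"] s by (simp add: P_def)
        moreover have "\<phi>\<^sub>0 (snd (P s) - s *\<^sub>R w) w < a'"
          using foot[of s s w] s w by (intro e(2)) auto
        moreover have "(1 + r) * s \<le> (1 + r) * \<nu>"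
          using s t r by (intro mult_left_mono) auto
        ultimately have "phase \<epsilon> (P s) w \<le> A"
          using \<nu>(3) by (simp add: A_def)
        then show "exp (- A / \<epsilon>) \<le> exp (- phase \<epsilon> (P s) w / \<epsilon>)"
          using \<epsilon>(1) by (simp add: divide_right_mono)
      qed auto
      moreover have big: "A + \<sigma> \<le> phase \<epsilon> (P s) v"
      proof -
        have "0 \<le> C * (1 - s / t)"
          using C(1) s t by (intro mult_nonneg_nonneg) auto
        then show ?thesis
          using s(3) by (simp add: f_def A_def \<sigma>_def field_simps)
      qed
      ultimately have "exp ((A + \<sigma>) / \<epsilon>) * (exp (- A / \<epsilon>) * m) \<le> gain \<epsilon> (P s) v"
        unfolding gain_eq using \<epsilon>(1) m(1) by (intro mult_mono) (auto simp: divide_right_mono)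
      also have "exp ((A + \<sigma>) / \<epsilon>) * (exp (- A / \<epsilon>) * m) = exp (\<sigma> / \<epsilon>) * m"
        by (simp add: add_divide_distrib exp_add exp_minus)
      finally have gain: "exp (\<sigma> / \<epsilon>) * m \<le> gain \<epsilon> (P s) v" .
      have "(1 + r) + C / t \<le> (1 + r) + C / \<tau>"
        using t \<tau>(1) C(1) by (intro add_left_mono divide_left_mono) auto
      also have "\<dots> < \<sigma> / \<epsilon> * ((1 + r) * m)"
        using \<epsilon> by (simp add: field_simps)
      also have "\<dots> \<le> exp (\<sigma> / \<epsilon>) * ((1 + r) * m)"
      proof (rule mult_right_mono)
        show "\<sigma> / \<epsilon> \<le> exp (\<sigma> / \<epsilon>)"
          using exp_ge_add_one_self[of "\<sigma> / \<epsilon>"] by linarith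
      qed (use r m(1) in simp)
      also have "\<dots> = (1 + r) * (exp (\<sigma> / \<epsilon>) * m)"
        by simp
      also have "\<dots> \<le> (1 + r) * gain \<epsilon> (P s) v"
        using gain r by (intro mult_left_mono) auto
      finally have large: "(1 + r) + C / t < (1 + r) * gain \<epsilon> (P s) v" .
      have "(f has_real_derivative slope \<epsilon> (P s) v - 0 - (- (C / t))) (at s)"
        unfolding f_def P_def using t
        by (intro DERIV_diff phase_characteristic_derivative \<epsilon> s v DERIV_const)
          (auto intro!: derivative_eq_intros)
      moreover have "r * mass \<epsilon> (P s) \<le> r * 1"
        using r mass_le_1[OF \<epsilon>(1), of "P s"] s by (intro mult_left_mono) (auto simp: P_def)
      ultimately show "\<exists>d<0. (f has_real_derivative d) (at s)"
        using large by (intro exI[of _ "slope \<epsilon> (P s) v - 0 - (- (C / t))"]) (simp add: slope_def)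
    qed
    then show ?thesis
      using t by (simp add: f_def P_def t_def)
  qed
  show thesis
  proof (rule that[OF \<nu>(1)])
    fix \<tau> :: real
    assume \<tau>: "0 < \<tau>"
    have pos: "0 < (1 + r) + C / \<tau>"
      using \<tau> r C(1) by (simp add: add_pos_pos)
    have "0 < \<sigma> * ((1 + r) * m) / ((1 + r) + C / \<tau>)"
      using pos \<sigma> r m(1) by simp
    then have "\<forall>\<^sub>F \<epsilon> in at_right 0. \<epsilon> < \<sigma> * ((1 + r) * m) / ((1 + r) + C / \<tau>)"
      by (intro order_tendstoD(2)[OF tendsto_ident_at])
    with eventually_at_right_less[of "0::real"]
    show "\<forall>\<^sub>F \<epsilon> in at_right 0. \<forall>z. \<tau> \<le> fst z \<and> fst z < \<nu> \<and> dist (snd z) x\<^sub>0 < \<nu> \<longrightarrow>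
        (\<forall>v\<in>V. phase \<epsilon> z v \<le> a)"
    proof eventually_elim
      case (elim \<epsilon>)
      then have "\<epsilon> * ((1 + r) + C / \<tau>) < \<sigma> * ((1 + r) * m)"
        using pos by (simp add: pos_less_divide_eq)
      then show ?case
        using main \<tau> elim by blast
    qed
  qed
qed

text \<open>A minimum principle in the backward cone, whose slope \<open>R\<close> keeps the backward characteristics
  inside. Where \<open>\<phi>\<close> is minimal over the velocities, the gain is at most \<open>1\<close>, so the slope is greater than
  \<open>- r\<close>; hence \<open>\<phi> + r t\<close> has its minimum at time \<open>0\<close>.\<close>

lemma phase_lower_bound:
  assumes a: "\<And>v. v \<in> V \<Longrightarrow> a < \<phi>\<^sub>0 x\<^sub>0 v"
  obtains \<nu> where "0 < \<nu>" "\<And>\<epsilon> z v. 0 < \<epsilon> \<Longrightarrow> 0 \<le> fst z \<Longrightarrow> fst z < \<nu> \<Longrightarrow> dist (snd z) x\<^sub>0 < \<nu> \<Longrightarrow>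
      v \<in> V \<Longrightarrow> a \<le> phase \<epsilon> z v"
proof -
  obtain R where R: "0 < R" "\<And>v. v \<in> V \<Longrightarrow> norm v \<le> R"
    using velocity_bound by blast
  have usc: "usc_on (UNIV \<times> V) (\<lambda>q. - \<phi>\<^sub>0 (fst q) (snd q))"
    by (intro usc_on_continuous continuous_intros initial_continuous)
  have "continuous_on V (\<phi>\<^sub>0 x\<^sub>0)"
    using phase_continuous_velocity[of 1 "(0, x\<^sub>0)"] phase_initial[of 1 _ x\<^sub>0]
    by (metis (no_types, lifting) continuous_on_cong fst_conv order_refl zero_less_one)
  then obtain w where w: "w \<in> V" "\<And>v. v \<in> V \<Longrightarrow> \<phi>\<^sub>0 x\<^sub>0 w \<le> \<phi>\<^sub>0 x\<^sub>0 v"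
    using continuous_attains_inf[OF compact_V V_nonempty] by blast
  obtain a' where a': "a < a'" "a' < \<phi>\<^sub>0 x\<^sub>0 w"
    using dense[OF a[OF w(1)]] by blast
  have "\<forall>\<^sub>F y in nhds x\<^sub>0. \<forall>v\<in>V. v \<in> V \<longrightarrow> a' < \<phi>\<^sub>0 y v"
  proof (rule eventually_ball_compact[OF compact_V])
    fix v
    assume "v \<in> V"
    then have "\<forall>\<^sub>F q in nhds (x\<^sub>0, v). q \<in> UNIV \<times> V \<longrightarrow> - \<phi>\<^sub>0 (fst q) (snd q) < - a'"
      using usc_onD[OF usc, of "(x\<^sub>0, v)" "- a'"] w(2)[of v] a'(2) by simp
    then show "\<forall>\<^sub>F q in nhds x\<^sub>0 \<times>\<^sub>F nhds v. snd q \<in> V \<longrightarrow> a' < \<phi>\<^sub>0 (fst q) (snd q)"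
      unfolding nhds_prod by eventually_elim (auto simp: mem_Times_iff)
  qed
  then obtain e where e: "0 < e" "\<And>y v. dist y x\<^sub>0 < e \<Longrightarrow> v \<in> V \<Longrightarrow> a' < \<phi>\<^sub>0 y v"
    unfolding eventually_nhds_metric by blast
  define \<nu> where "\<nu> = min (e / (1 + R)) ((a' - a) / r)"
  have \<nu>: "0 < \<nu>" "\<nu> * (1 + R) \<le> e" "r * \<nu> \<le> a' - a"
  proof -
    show "0 < \<nu>"
      using a' e(1) R(1) r by (simp add: \<nu>_def)
    have "\<nu> \<le> e / (1 + R)" "\<nu> \<le> (a' - a) / r"
      by (simp_all add: \<nu>_def)
    then show "\<nu> * (1 + R) \<le> e" "r * \<nu> \<le> a' - a"
      using R(1) r by (simp_all add: field_simps)
  qed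
  show thesis
  proof (rule that[OF \<nu>(1)])
    fix \<epsilon> :: real and z v
    assume \<epsilon>: "0 < \<epsilon>" and z: "0 \<le> fst z" "fst z < \<nu>" "dist (snd z) x\<^sub>0 < \<nu>" and v: "v \<in> V"
    define T X where "T = fst z" and "X = snd z"
    define K where "K = ({0..T} \<times> cball X (R * T)) \<inter> {q. dist (snd q) X \<le> R * (T - fst q)}"
    have K: "compact K"
      unfolding K_def
      by (intro compact_Int_closed compact_Times compact_Icc compact_cball closed_Collect_le continuous_intros)
    have zK: "z \<in> K"
      using z R(1) by (cases z) (auto simp: K_def T_def X_def)
    define h where "h q = phase \<epsilon> (fst q) (snd q) + r * fst (fst q)" for q :: "(real \<times> (real ^ 'n)) \<times> (real ^ 'n)"
    have "continuous_on (K \<times> V) h"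
      unfolding h_def
      by (intro continuous_intros continuous_on_subset[OF phase_continuous[OF \<epsilon>]])
        (auto simp: K_def)
    moreover have "K \<times> V \<noteq> {}"
      using zK v by blast
    ultimately have "\<exists>p\<in>K \<times> V. \<forall>q\<in>K \<times> V. h p \<le> h q"
      by (intro continuous_attains_inf compact_Times K compact_V)
    then obtain p where p: "p \<in> K \<times> V" "\<forall>q\<in>K \<times> V. h p \<le> h q"
      by (elim bexE)
    obtain q u where qu: "p = (q, u)" "q \<in> K" "u \<in> V"
      using p(1) by auto
    have "fst q = 0"
    proof (rule ccontr)
      assume "fst q \<noteq> 0"
      then have q: "0 < fst q" "fst q \<le> T" "dist (snd q) X \<le> R * (T - fst q)"
        using qu(2) by (auto simp: K_def)
      have "gain \<epsilon> q u \<le> 1"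
        unfolding gain_def
      proof (rule avg_le_const)
        show "continuous_on V (\<lambda>v'. exp ((phase \<epsilon> q u - phase \<epsilon> q v') / \<epsilon>))"
          using q(1) \<epsilon> by (intro continuous_on_boltzmann) auto
        show "exp ((phase \<epsilon> q u - phase \<epsilon> q v') / \<epsilon>) \<le> 1" if "v' \<in> V" for v'
          using p(2)[rule_format, of "(q, v')"] qu that \<epsilon> by (simp add: h_def divide_nonpos_pos)
      qed
      then have "(1 + r) * gain \<epsilon> q u \<le> (1 + r) * 1"
        using r by (intro mult_left_mono) auto
      moreover have "0 < r * mass \<epsilon> q"
        using r mass_pos[OF \<epsilon>, of q] q(1) by simp
      ultimately have pos: "0 < slope \<epsilon> q u + r"
        by (simp add: slope_def)
      have "((\<lambda>s. phase \<epsilon> (characteristic q u s) u + r * s) has_real_derivative slope \<epsilon> q u + r) (at (fst q))"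
        using phase_characteristic_derivative[OF \<epsilon> q(1) qu(3), of q]
        by (intro DERIV_add) (auto intro!: derivative_eq_intros)
      from DERIV_pos_inc_left[OF this pos] obtain d where d: "0 < d"
          "\<forall>s>0. s < d \<longrightarrow> phase \<epsilon> (characteristic q u (fst q - s)) u + r * (fst q - s)
             < phase \<epsilon> (characteristic q u (fst q)) u + r * fst q"
        by (elim exE conjE)
      define s where "s = min (d / 2) (fst q)"
      have s: "0 < s" "s < d" "s \<le> fst q"
        using d(1) q(1) by (simp_all add: s_def min_less_iff_disj)
      have "characteristic q u (fst q - s) \<in> K"
      proof -
        have "dist (snd q - s *\<^sub>R u) X \<le> dist (snd q) X + norm (s *\<^sub>R u)"
          using norm_triangle_ineq4[of "snd q - X" "s *\<^sub>R u"] by (simp add: dist_norm algebra_simps)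
        also have "\<dots> \<le> R * (T - fst q) + s * R"
          using q(3) s(1) R(2)[OF qu(3)] by (intro add_mono) auto
        also have "\<dots> = R * (T - (fst q - s))"
          by (simp add: algebra_simps)
        finally have le: "dist (snd q - s *\<^sub>R u) X \<le> R * (T - (fst q - s))" .
        also have "\<dots> \<le> R * T"
          using s R(1) by simp
        finally show ?thesis
          using le s q by (simp add: K_def characteristic_def dist_commute)
      qed
      then have "h p \<le> h (characteristic q u (fst q - s), u)"
        using qu by (intro p(2)[rule_format]) auto
      with d(2)[rule_format, OF s(1,2)] show False
        by (simp add: h_def qu(1))
    qed
    have "dist (snd q) x\<^sub>0 \<le> dist (snd q) X + dist X x\<^sub>0"
      by (rule dist_triangle)
    also have "\<dots> < R * \<nu> + \<nu>"
    proof (rule add_le_less_mono)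
      have "dist (snd q) X \<le> R * T"
        using qu(2) \<open>fst q = 0\<close> by (auto simp: K_def)
      also have "\<dots> \<le> R * \<nu>"
        using R(1) z by (simp add: T_def)
      finally show "dist (snd q) X \<le> R * \<nu>" .
    qed (use z in \<open>simp add: X_def\<close>)
    also have "\<dots> \<le> e"
      using \<nu>(2) by (simp add: algebra_simps)
    finally have "a' < \<phi>\<^sub>0 (snd q) u"
      using e(2) qu(3) by blast
    also have "\<dots> = h p"
      using phase_initial[OF \<epsilon> qu(3), of "snd q"] \<open>fst q = 0\<close> by (cases q) (simp add: h_def qu(1))
    also have "\<dots> \<le> h (z, v)"
      using zK v by (intro p(2)[rule_format]) auto
    finally have "a' \<le> phase \<epsilon> z v + r * fst z"
      by (simp add: h_def)
    moreover have "r * fst z \<le> r * \<nu>"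
      using r z by (intro mult_left_mono) auto
    ultimately show "a \<le> phase \<epsilon> z v"
      using \<nu>(3) by linarith
  qed
qed

section \<open>Perturbed test functions for the kinetic equation\<close>

text \<open>The characteristic derivative of \<open>\<phi>\<close> is all that the equation provides, and it is all that a
  contact at fixed velocity determines.\<close>

lemma slope_at_contact:
  assumes \<epsilon>: "0 < \<epsilon>" and z: "0 < fst z" and v: "v \<in> V" and \<Psi>: "GDERIV \<Psi> z :> E"
    and extremum: "(\<forall>\<^sub>F q in nhds z. phase \<epsilon> q v - \<Psi> q \<le> phase \<epsilon> z v - \<Psi> z) \<or>
      (\<forall>\<^sub>F q in nhds z. phase \<epsilon> z v - \<Psi> z \<le> phase \<epsilon> q v - \<Psi> q)"
  shows "slope \<epsilon> z v = E \<bullet> (1, v)"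
proof -
  define p where "p s = z + s *\<^sub>R (1, v)" for s :: real
  have p0: "p 0 = z"
    by (simp add: p_def zero_prod_def[symmetric])
  define g where "g s = phase \<epsilon> (p s) v - \<Psi> (p s)" for s
  have "(p has_derivative (\<lambda>s. s *\<^sub>R (1, v))) (at 0)"
    unfolding p_def by (auto intro!: derivative_eq_intros)
  moreover have "(\<Psi> has_derivative (\<lambda>h. h \<bullet> E)) (at (p 0))"
    using \<Psi> by (simp add: gderiv_def p_def zero_prod_def[symmetric])
  ultimately have "((\<lambda>s. \<Psi> (p s)) has_derivative (\<lambda>s. (s *\<^sub>R (1, v)) \<bullet> E)) (at 0)"
    by (rule has_derivative_compose)
  then have "((\<lambda>s. \<Psi> (p s)) has_real_derivative E \<bullet> (1, v)) (at 0)"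
    unfolding has_field_derivative_def
    by (rule has_derivative_eq_rhs) (auto simp: inner_prod_def algebra_simps inner_commute)
  then have g: "(g has_real_derivative slope \<epsilon> z v - E \<bullet> (1, v)) (at 0)"
    using phase_derivative[OF \<epsilon> z v] unfolding g_def p_def by (intro DERIV_diff)
  have "continuous_on UNIV p"
    unfolding p_def by (intro continuous_intros)
  then have "(p \<longlongrightarrow> p 0) (nhds 0)"
    by (simp add: continuous_on_def tendsto_at_iff_tendsto_nhds)
  then have "filterlim p (nhds z) (nhds 0)"
    by (simp only: p0)
  then have "(\<forall>\<^sub>F s in nhds 0. g s \<le> g 0) \<or> (\<forall>\<^sub>F s in nhds 0. g 0 \<le> g s)"
    using extremum unfolding filterlim_iff g_def p0 by blast
  then have "slope \<epsilon> z v - E \<bullet> (1, v) = 0"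
  proof
    assume "\<forall>\<^sub>F s in nhds 0. g s \<le> g 0"
    then obtain d where "0 < d" "\<forall>s. dist s 0 < d \<longrightarrow> g s \<le> g 0"
      unfolding eventually_nhds_metric by blast
    then show ?thesis
      by (intro DERIV_local_max[OF g, of d]) (simp_all add: dist_real_def)
  next
    assume "\<forall>\<^sub>F s in nhds 0. g 0 \<le> g s"
    then obtain d where "0 < d" "\<forall>s. dist s 0 < d \<longrightarrow> g 0 \<le> g s"
      unfolding eventually_nhds_metric by blast
    then show ?thesis
      by (intro DERIV_local_min[OF g, of d]) (simp_all add: dist_real_def)
  qed
  then show ?thesis by simp
qed

definition upper_phase :: "real \<times> (real ^ 'n) \<Rightarrow> real" where
  "upper_phase = upper_limit V phase"

definition lower_phase :: "real \<times> (real ^ 'n) \<Rightarrow> real" where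
  "lower_phase z = - upper_limit V (\<lambda>\<epsilon> z v. - phase \<epsilon> z v) z"

lemma tendsto_if_dist_le_inverse_Suc:
  assumes "\<And>n. dist (f n) l \<le> inverse (real (Suc n))"
  shows "f \<longlonglongrightarrow> l"
proof (subst tendsto_dist_iff, rule tendsto_sandwich[where f="\<lambda>_. 0" and h="\<lambda>n. inverse (real (Suc n))"])
  show "\<forall>\<^sub>F n in sequentially. dist (f n) l \<le> inverse (real (Suc n))"
    by (intro always_eventually allI assms)
  show "(\<lambda>n. inverse (real (Suc n))) \<longlonglongrightarrow> 0"
    by (rule LIMSEQ_inverse_real_of_nat)
qed simp_all

lemma open_positive_times: "open ({0<..} \<times> UNIV :: (real \<times> (real ^ 'n)) set)"
  by (simp add: open_Times)

lemma phase_continuous_case: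
  "0 < \<epsilon> \<Longrightarrow> continuous_on (({0<..} \<times> UNIV) \<times> V) (\<lambda>(z, v). phase \<epsilon> z v)"
  unfolding case_prod_beta by (rule continuous_on_subset[OF phase_continuous]) auto

lemma GDERIV_square_dist:
  fixes z :: "'a::real_inner"
  shows "GDERIV (\<lambda>z. (dist z a)\<^sup>2) z :> 2 *\<^sub>R (z - a)"
  using GDERIV_halfsquare[of 2 a z] by (simp add: dist_norm)

lemma test_function_continuous:
  assumes "test_function \<psi> D"
  shows "continuous_on ({0<..} \<times> UNIV) \<psi>"
proof -
  have "isCont \<psi> z" if "z \<in> {0<..} \<times> UNIV" for z
    using assms that unfolding test_function_def gderiv_def by (blast intro: has_derivative_continuous)
  then show ?thesis
    by (simp add: continuous_at_imp_continuous_on)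
qed

text \<open>Maximality in the velocity with corrector \<open>- ln Q\<close> bounds the gain from below by
  \<open>avg Q / Q v\<close>. The density term \<open>r \<rho>\<close> has the wrong sign; it disappears since the slope identity bounds
  the gain \<open>\<rho> exp (\<phi> / \<epsilon>)\<close> from above while \<open>\<phi>\<close> stays near \<open>U z\<^sub>0 > 0\<close>. Compactness of \<open>V\<close> yields
  the limiting velocity.\<close>

lemma upper_phase_sub_inequality:
  assumes \<psi>: "test_function \<psi> D" and z0: "0 < fst z\<^sub>0" and pos: "0 < upper_phase z\<^sub>0"
    and max: "\<forall>\<^sub>F z in nhds z\<^sub>0. upper_phase z - \<psi> z \<le> upper_phase z\<^sub>0 - \<psi> z\<^sub>0"
    and Q: "continuous_on V Q" "\<And>v. v \<in> V \<Longrightarrow> 0 < Q v" "1 \<le> avg Q"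
  shows "\<exists>v\<in>V. D z\<^sub>0 \<bullet> (1, v) \<le> 1 - (1 + r) / Q v"
proof -
  let ?S = "{0<..} \<times> UNIV :: (real \<times> (real ^ 'n)) set"
  have zS: "z\<^sub>0 \<in> ?S"
    using z0 by (simp add: mem_Times_iff)
  define \<eta> where "\<eta> v = - ln (Q v)" for v
  have \<eta>: "continuous_on V \<eta>"
    unfolding \<eta>_def using Q by (intro continuous_intros) force+
  define X where "X z v = D z \<bullet> (1, v) + (2 *\<^sub>R (z - z\<^sub>0)) \<bullet> (1, v)" for z v
  define contact where "contact n \<epsilon> z v \<longleftrightarrow>
      0 < \<epsilon> \<and> \<epsilon> < inverse (real (Suc n)) \<and> 0 < fst z \<and> dist z z\<^sub>0 < inverse (real (Suc n)) \<and> v \<in> V \<and>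
      \<bar>phase \<epsilon> z v - upper_phase z\<^sub>0\<bar> < inverse (real (Suc n)) \<and>
      X z v \<le> 1 + r * mass \<epsilon> z - (1 + r) / Q v \<and>
      (1 + r) * mass \<epsilon> z \<le> (1 + r - X z v) * exp (- phase \<epsilon> z v / \<epsilon>)"
    for n :: nat and \<epsilon> z v
  have "\<exists>\<epsilon> z v. contact n \<epsilon> z v" for n
  proof -
    have inv: "0 < inverse (real (Suc n))"
      by simp
    have bdd: "locally_bounded_family V phase z" if "z \<in> ?S" for z
      using phase_locally_bounded that by (simp add: mem_Times_iff)
    obtain \<epsilon> z v where *: "0 < \<epsilon>" "\<epsilon> < inverse (real (Suc n))" "z \<in> ?S"
      "dist z z\<^sub>0 < inverse (real (Suc n))" "v \<in> V"
      "\<bar>phase \<epsilon> z v - upper_limit V phase z\<^sub>0\<bar> < inverse (real (Suc n))"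
      "\<And>v'. v' \<in> V \<Longrightarrow> phase \<epsilon> z v' - \<epsilon> * \<eta> v' \<le> phase \<epsilon> z v - \<epsilon> * \<eta> v"
      "\<forall>\<^sub>F z' in nhds z. phase \<epsilon> z' v - \<psi> z' - (dist z' z\<^sub>0)\<^sup>2 \<le> phase \<epsilon> z v - \<psi> z - (dist z z\<^sub>0)\<^sup>2"
      by (rule perturbed_maximum[OF compact_V V_nonempty open_positive_times zS phase_continuous_case
            bdd test_function_continuous[OF \<psi>] \<eta> max[unfolded upper_phase_def] inv]; (rule that; assumption)?)
    have t: "0 < fst z"
      using *(3) by (auto simp: mem_Times_iff)
    have "GDERIV (\<lambda>z. \<psi> z + (dist z z\<^sub>0)\<^sup>2) z :> D z + 2 *\<^sub>R (z - z\<^sub>0)"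
      using \<psi> *(3) unfolding test_function_def by (intro GDERIV_add GDERIV_square_dist) blast
    from slope_at_contact[OF *(1) t *(5) this] *(8) have X: "slope \<epsilon> z v = X z v"
      by (simp add: X_def inner_add_left algebra_simps)
    have gain: "1 / Q v \<le> gain \<epsilon> z v"
    proof -
      have "1 / Q v \<le> 1 / Q v * avg Q"
        using Q(2)[OF *(5)] Q(3) by (simp add: divide_right_mono)
      also have "\<dots> = avg (\<lambda>v'. 1 / Q v * Q v')"
        by (rule avg_cmult[symmetric])
      also have "\<dots> \<le> gain \<epsilon> z v"
        unfolding gain_def
      proof (rule avg_mono)
        show "continuous_on V (\<lambda>v'. 1 / Q v * Q v')"
          using Q(1) by (intro continuous_intros)
        show "continuous_on V (\<lambda>v'. exp ((phase \<epsilon> z v - phase \<epsilon> z v') / \<epsilon>))"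
          using *(1) t by (intro continuous_on_boltzmann) auto
        fix v'
        assume v': "v' \<in> V"
        have "1 / Q v * Q v' = exp (\<eta> v - \<eta> v')"
          using Q(2)[OF v'] Q(2)[OF *(5)] by (simp add: \<eta>_def exp_diff exp_minus divide_inverse exp_add)
        also have "\<dots> \<le> exp ((phase \<epsilon> z v - phase \<epsilon> z v') / \<epsilon>)"
          using *(7)[OF v'] *(1) by (simp add: field_simps)
        finally show "1 / Q v * Q v' \<le> exp ((phase \<epsilon> z v - phase \<epsilon> z v') / \<epsilon>)" .
      qed
      finally show ?thesis .
    qed
    have "(1 + r) * (1 / Q v) \<le> (1 + r) * gain \<epsilon> z v"
      using gain r by (intro mult_left_mono) auto
    then have sub: "X z v \<le> 1 + r * mass \<epsilon> z - (1 + r) / Q v"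
      by (simp add: X[symmetric] slope_def)
    have "mass \<epsilon> z = gain \<epsilon> z v * exp (- phase \<epsilon> z v / \<epsilon>)"
      by (simp add: gain_eq exp_minus)
    moreover have "(1 + r) * gain \<epsilon> z v \<le> 1 + r - X z v"
    proof -
      have "r * mass \<epsilon> z \<le> r * 1"
        using mass_le_1[OF *(1), of z] t r by (intro mult_left_mono) auto
      with X show ?thesis
        by (simp add: slope_def)
    qed
    then have "(1 + r) * gain \<epsilon> z v * exp (- phase \<epsilon> z v / \<epsilon>) \<le> (1 + r - X z v) * exp (- phase \<epsilon> z v / \<epsilon>)"
      by (rule mult_right_mono) simp
    ultimately have "(1 + r) * mass \<epsilon> z \<le> (1 + r - X z v) * exp (- phase \<epsilon> z v / \<epsilon>)"
      by (simp only: mult.assoc)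
    then have "contact n \<epsilon> z v"
      using * t sub by (simp add: contact_def upper_phase_def)
    then show ?thesis by blast
  qed
  then obtain e z w where contact: "\<And>n. contact n (e n) (z n) (w n)"
    by metis
  have approx: "0 < e n" "e n < inverse (real (Suc n))" "0 < fst (z n)"
    "dist (z n) z\<^sub>0 < inverse (real (Suc n))" "w n \<in> V"
    "\<bar>phase (e n) (z n) (w n) - upper_phase z\<^sub>0\<bar> < inverse (real (Suc n))"
    "X (z n) (w n) \<le> 1 + r * mass (e n) (z n) - (1 + r) / Q (w n)"
    "(1 + r) * mass (e n) (z n) \<le> (1 + r - X (z n) (w n)) * exp (- phase (e n) (z n) (w n) / e n)" for n
    using contact[of n] unfolding contact_def by (simp_all only:)
  define a where "a n = phase (e n) (z n) (w n)" for n
  have e: "e \<longlonglongrightarrow> 0"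
    by (rule tendsto_if_dist_le_inverse_Suc) (use approx(1,2) in \<open>simp add: dist_real_def less_imp_le del: of_nat_Suc\<close>)
  have z: "z \<longlonglongrightarrow> z\<^sub>0"
    by (rule tendsto_if_dist_le_inverse_Suc) (rule less_imp_le[OF approx(4)])
  have a: "a \<longlonglongrightarrow> upper_phase z\<^sub>0"
    by (rule tendsto_if_dist_le_inverse_Suc) (use approx(6) in \<open>simp add: dist_real_def a_def less_imp_le del: of_nat_Suc\<close>)
  have exp0: "(\<lambda>n. exp (- a n / e n)) \<longlonglongrightarrow> 0"
  proof (rule tendsto_sandwich[OF _ _ tendsto_const])
    have "\<forall>\<^sub>F n in sequentially. 0 < a n"
      using order_tendstoD(1)[OF a pos] .
    then show "\<forall>\<^sub>F n in sequentially. exp (- a n / e n) \<le> e n / a n"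
    proof eventually_elim
      case (elim n)
      have "a n / e n \<le> exp (a n / e n)"
        using exp_ge_add_one_self[of "a n / e n"] by linarith
      then have "inverse (exp (a n / e n)) \<le> inverse (a n / e n)"
        using elim approx(1)[of n] by (intro le_imp_inverse_le) auto
      then show ?case
        by (simp add: exp_minus)
    qed
    show "(\<lambda>n. e n / a n) \<longlonglongrightarrow> 0"
      using tendsto_divide[OF e a] pos by simp
  qed simp
  obtain v s where vs: "v \<in> V" "strict_mono s" "(w \<circ> s) \<longlonglongrightarrow> v"
    using compact_V[unfolded compact_def, rule_format, of w] approx by auto
  have ws: "(\<lambda>n. w (s n)) \<longlonglongrightarrow> v"
    using vs(3) by (simp add: o_def)
  have zs: "(\<lambda>n. z (s n)) \<longlonglongrightarrow> z\<^sub>0"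
    using LIMSEQ_subseq_LIMSEQ[OF z vs(2)] by (simp add: o_def)
  have D: "continuous_on ?S D"
    using \<psi> by (simp add: test_function_def)
  have "(\<lambda>n. D (z (s n))) \<longlonglongrightarrow> D z\<^sub>0"
    by (rule continuous_on_tendsto_compose[OF D zs zS]) (simp add: mem_Times_iff approx)
  then have X: "(\<lambda>n. X (z (s n)) (w (s n))) \<longlonglongrightarrow> D z\<^sub>0 \<bullet> (1, v) + (2 *\<^sub>R (z\<^sub>0 - z\<^sub>0)) \<bullet> (1, v)"
    unfolding X_def by (intro tendsto_intros zs ws)
  then have X: "(\<lambda>n. X (z (s n)) (w (s n))) \<longlonglongrightarrow> D z\<^sub>0 \<bullet> (1, v)"
    by simp
  have mass: "(\<lambda>n. mass (e (s n)) (z (s n))) \<longlonglongrightarrow> 0"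
  proof (rule tendsto_sandwich[OF _ _ tendsto_const])
    show "\<forall>\<^sub>F n in sequentially. 0 \<le> mass (e (s n)) (z (s n))"
      by (intro always_eventually allI less_imp_le mass_pos approx)
    show "\<forall>\<^sub>F n in sequentially. mass (e (s n)) (z (s n))
        \<le> (1 + r - X (z (s n)) (w (s n))) * exp (- a (s n) / e (s n)) / (1 + r)"
    proof (intro always_eventually allI)
      fix n
      show "mass (e (s n)) (z (s n)) \<le> (1 + r - X (z (s n)) (w (s n))) * exp (- a (s n) / e (s n)) / (1 + r)"
        using approx(8)[of "s n"] r by (simp add: a_def pos_le_divide_eq mult.commute)
    qed
    have "(\<lambda>n. exp (- a (s n) / e (s n))) \<longlonglongrightarrow> 0"
      using LIMSEQ_subseq_LIMSEQ[OF exp0 vs(2)] by (simp add: o_def)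
    then have "(\<lambda>n. (1 + r - X (z (s n)) (w (s n))) * exp (- a (s n) / e (s n)) / (1 + r))
        \<longlonglongrightarrow> (1 + r - D z\<^sub>0 \<bullet> (1, v)) * 0 / (1 + r)"
      using r by (intro tendsto_intros X) auto
    then show "(\<lambda>n. (1 + r - X (z (s n)) (w (s n))) * exp (- a (s n) / e (s n)) / (1 + r)) \<longlonglongrightarrow> 0"
      by simp
  qed
  have "(\<lambda>n. Q (w (s n))) \<longlonglongrightarrow> Q v"
    by (rule continuous_on_tendsto_compose[OF Q(1) ws vs(1)]) (simp add: approx)
  then have "(\<lambda>n. 1 + r * mass (e (s n)) (z (s n)) - (1 + r) / Q (w (s n))) \<longlonglongrightarrow> 1 + r * 0 - (1 + r) / Q v"
    using Q(2)[OF vs(1)] by (intro tendsto_intros mass) auto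
  from LIMSEQ_le[OF X this] have "D z\<^sub>0 \<bullet> (1, v) \<le> 1 + r * 0 - (1 + r) / Q v"
    by (simp add: approx)
  with vs(1) show ?thesis by auto
qed

text \<open>Minimality in the velocity with corrector \<open>ln Q\<close> bounds the gain from above by
  \<open>avg Q / Q v\<close>, and the density term \<open>r \<rho>\<close> is positive, which is the favourable sign.\<close>

lemma lower_phase_super_inequality:
  assumes \<psi>: "test_function \<psi> D" and z0: "0 < fst z\<^sub>0"
    and min: "\<forall>\<^sub>F z in nhds z\<^sub>0. lower_phase z\<^sub>0 - \<psi> z\<^sub>0 \<le> lower_phase z - \<psi> z"
    and Q: "continuous_on V Q" "\<And>v. v \<in> V \<Longrightarrow> 0 < Q v" "avg Q \<le> 1"
  shows "\<exists>v\<in>V. 1 - (1 + r) / Q v \<le> D z\<^sub>0 \<bullet> (1, v)"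
proof -
  let ?S = "{0<..} \<times> UNIV :: (real \<times> (real ^ 'n)) set"
  have zS: "z\<^sub>0 \<in> ?S"
    using z0 by (simp add: mem_Times_iff)
  define \<eta> where "\<eta> v = ln (Q v)" for v
  have \<eta>: "continuous_on V \<eta>"
    unfolding \<eta>_def using Q by (intro continuous_intros) force+
  define X where "X z v = D z \<bullet> (1, v) - (2 *\<^sub>R (z - z\<^sub>0)) \<bullet> (1, v)" for z v
  define contact where "contact n z v \<longleftrightarrow> 0 < fst z \<and> dist z z\<^sub>0 < inverse (real (Suc n)) \<and> v \<in> V \<and>
      1 - (1 + r) / Q v \<le> X z v" for n :: nat and z v
  have "\<exists>z v. contact n z v" for n
  proof -
    have cont: "continuous_on (?S \<times> V) (\<lambda>(z, v). - phase \<epsilon> z v)" if "0 < \<epsilon>" for \<epsilon>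
      using continuous_on_minus[OF phase_continuous_case[OF that]] by (simp add: case_prod_beta)
    have max: "\<forall>\<^sub>F z in nhds z\<^sub>0. upper_limit V (\<lambda>\<epsilon> z v. - phase \<epsilon> z v) z - - \<psi> z
        \<le> upper_limit V (\<lambda>\<epsilon> z v. - phase \<epsilon> z v) z\<^sub>0 - - \<psi> z\<^sub>0"
      using min by eventually_elim (simp add: lower_phase_def)
    have inv: "0 < inverse (real (Suc n))"
      by simp
    have bdd': "locally_bounded_family V (\<lambda>\<epsilon> z v. - phase \<epsilon> z v) z" if "z \<in> ?S" for z
      using phase_locally_bounded that by (simp add: locally_bounded_family_uminus mem_Times_iff)
    have \<psi>': "continuous_on ?S (\<lambda>z. - \<psi> z)"
      by (intro continuous_on_minus test_function_continuous[OF \<psi>])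
    obtain \<epsilon> z v where *: "0 < \<epsilon>" "\<epsilon> < inverse (real (Suc n))" "z \<in> ?S"
      "dist z z\<^sub>0 < inverse (real (Suc n))" "v \<in> V"
      "\<bar>- phase \<epsilon> z v - upper_limit V (\<lambda>\<epsilon> z v. - phase \<epsilon> z v) z\<^sub>0\<bar> < inverse (real (Suc n))"
      "\<And>v'. v' \<in> V \<Longrightarrow> - phase \<epsilon> z v' - \<epsilon> * \<eta> v' \<le> - phase \<epsilon> z v - \<epsilon> * \<eta> v"
      "\<forall>\<^sub>F z' in nhds z. - phase \<epsilon> z' v - - \<psi> z' - (dist z' z\<^sub>0)\<^sup>2 \<le> - phase \<epsilon> z v - - \<psi> z - (dist z z\<^sub>0)\<^sup>2"
      by (rule perturbed_maximum[OF compact_V V_nonempty open_positive_times zS cont bdd' \<psi>' \<eta> max inv]; (rule that; assumption)?)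
    have t: "0 < fst z"
      using *(3) by (auto simp: mem_Times_iff)
    have "GDERIV (\<lambda>z. \<psi> z - (dist z z\<^sub>0)\<^sup>2) z :> D z - 2 *\<^sub>R (z - z\<^sub>0)"
      using \<psi> *(3) unfolding test_function_def by (intro GDERIV_diff GDERIV_square_dist) blast
    moreover have "\<forall>\<^sub>F q in nhds z. phase \<epsilon> z v - (\<psi> z - (dist z z\<^sub>0)\<^sup>2) \<le> phase \<epsilon> q v - (\<psi> q - (dist q z\<^sub>0)\<^sup>2)"
      using *(8) by eventually_elim simp
    ultimately have X: "slope \<epsilon> z v = X z v"
      using slope_at_contact[OF *(1) t *(5)] by (simp add: X_def inner_diff_left)
    have "gain \<epsilon> z v \<le> avg (\<lambda>v'. 1 / Q v * Q v')"
      unfolding gain_def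
    proof (rule avg_mono)
      show "continuous_on V (\<lambda>v'. 1 / Q v * Q v')"
        using Q(1) by (intro continuous_intros)
      show "continuous_on V (\<lambda>v'. exp ((phase \<epsilon> z v - phase \<epsilon> z v') / \<epsilon>))"
        using *(1) t by (intro continuous_on_boltzmann) auto
      fix v'
      assume v': "v' \<in> V"
      have "exp ((phase \<epsilon> z v - phase \<epsilon> z v') / \<epsilon>) \<le> exp (\<eta> v' - \<eta> v)"
        using *(7)[OF v'] *(1) by (simp add: field_simps)
      also have "\<dots> = 1 / Q v * Q v'"
        using Q(2)[OF v'] Q(2)[OF *(5)] by (simp add: \<eta>_def exp_diff)
      finally show "exp ((phase \<epsilon> z v - phase \<epsilon> z v') / \<epsilon>) \<le> 1 / Q v * Q v'" .
    qed
    also have "\<dots> = 1 / Q v * avg Q"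
      by (rule avg_cmult)
    also have "\<dots> \<le> 1 / Q v * 1"
      using Q(2)[OF *(5)] Q(3) by (intro mult_left_mono) auto
    finally have "(1 + r) * gain \<epsilon> z v \<le> (1 + r) * (1 / Q v * 1)"
      using r by (intro mult_left_mono) auto
    moreover have "0 < r * mass \<epsilon> z"
      using r mass_pos[OF *(1), of z] t by simp
    ultimately have "1 - (1 + r) / Q v \<le> X z v"
      by (simp add: X[symmetric] slope_def)
    then have "contact n z v"
      using * t by (simp add: contact_def)
    then show ?thesis by blast
  qed
  then obtain z w where contact: "\<And>n. contact n (z n) (w n)"
    by metis
  have approx: "0 < fst (z n)" "dist (z n) z\<^sub>0 < inverse (real (Suc n))" "w n \<in> V"
    "1 - (1 + r) / Q (w n) \<le> X (z n) (w n)" for n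
    using contact[of n] unfolding contact_def by (simp_all only:)
  have z: "z \<longlonglongrightarrow> z\<^sub>0"
    by (rule tendsto_if_dist_le_inverse_Suc) (rule less_imp_le[OF approx(2)])
  obtain v s where vs: "v \<in> V" "strict_mono s" "(w \<circ> s) \<longlonglongrightarrow> v"
    using compact_V[unfolded compact_def, rule_format, of w] approx by auto
  have ws: "(\<lambda>n. w (s n)) \<longlonglongrightarrow> v"
    using vs(3) by (simp add: o_def)
  have zs: "(\<lambda>n. z (s n)) \<longlonglongrightarrow> z\<^sub>0"
    using LIMSEQ_subseq_LIMSEQ[OF z vs(2)] by (simp add: o_def)
  have D: "continuous_on ?S D"
    using \<psi> by (simp add: test_function_def)
  have "(\<lambda>n. D (z (s n))) \<longlonglongrightarrow> D z\<^sub>0"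
    by (rule continuous_on_tendsto_compose[OF D zs zS]) (simp add: mem_Times_iff approx)
  then have X: "(\<lambda>n. X (z (s n)) (w (s n))) \<longlonglongrightarrow> D z\<^sub>0 \<bullet> (1, v) - (2 *\<^sub>R (z\<^sub>0 - z\<^sub>0)) \<bullet> (1, v)"
    unfolding X_def by (intro tendsto_intros zs ws)
  have "(\<lambda>n. Q (w (s n))) \<longlonglongrightarrow> Q v"
    by (rule continuous_on_tendsto_compose[OF Q(1) ws vs(1)]) (simp add: approx)
  then have "(\<lambda>n. 1 - (1 + r) / Q (w (s n))) \<longlonglongrightarrow> 1 - (1 + r) / Q v"
    using Q(2)[OF vs(1)] by (intro tendsto_intros) auto
  from LIMSEQ_le[OF this X] have "1 - (1 + r) / Q v \<le> D z\<^sub>0 \<bullet> (1, v) - (2 *\<^sub>R (z\<^sub>0 - z\<^sub>0)) \<bullet> (1, v)"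
    by (simp add: approx)
  with vs(1) show ?thesis by auto
qed

section \<open>The Hamilton-Jacobi equation\<close>

definition HJ :: "real ^ 'n \<Rightarrow> real" where
  "HJ p = (1 + r) * Ham V M (p /\<^sub>R (1 + r)) + r"

lemma HJ_Lipschitz:
  assumes "\<And>v. v \<in> V \<Longrightarrow> norm v \<le> R"
  shows "HJ p \<le> HJ q + R * norm (p - q)"
proof -
  have "(1 + r) * Ham V M (p /\<^sub>R (1 + r))
      \<le> (1 + r) * (Ham V M (q /\<^sub>R (1 + r)) + R * norm (q /\<^sub>R (1 + r) - p /\<^sub>R (1 + r)))"
    using r by (intro mult_left_mono Ham_Lipschitz assms) auto
  also have "q /\<^sub>R (1 + r) - p /\<^sub>R (1 + r) = (q - p) /\<^sub>R (1 + r)"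
    by (simp add: scaleR_diff_right)
  also have "(1 + r) * (Ham V M (q /\<^sub>R (1 + r)) + R * norm ((q - p) /\<^sub>R (1 + r)))
      = (1 + r) * Ham V M (q /\<^sub>R (1 + r)) + R * norm (p - q)"
  proof -
    have "norm ((q - p) /\<^sub>R (1 + r)) = norm (p - q) / (1 + r)"
      using r by (simp add: norm_minus_commute divide_inverse mult.commute)
    then show ?thesis
      using r by (simp add: distrib_left)
  qed
  finally show ?thesis
    by (simp add: HJ_def)
qed

text \<open>Below \<open>H(q)\<close> the resolvent profiles have average above \<open>1\<close>, so \<open>h\<close> can increase to \<open>H(q)\<close>
  unless \<open>H(q) = \<mu>(q) - 1\<close>. In that case the profile is a small constant \<open>1 / b\<close> plus a tall tent
  around a velocity \<open>v\<^sub>0\<close> with \<open>v\<^sub>0 \<bullet> q = \<mu>(q)\<close>. Outside the tent \<open>1 / Q = b\<close> outweighs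
  \<open>\<mu>(q) - v \<bullet> q\<close>; inside, \<open>v \<bullet> q\<close> is close to \<open>\<mu>(q)\<close>, and it suffices to drop
  the term \<open>(1 + r) / Q\<close>.\<close>

lemma HJ_le_0_if_sub_inequality:
  assumes sub: "\<And>Q. continuous_on V Q \<Longrightarrow> (\<And>v. v \<in> V \<Longrightarrow> 0 < Q v) \<Longrightarrow> 1 \<le> avg Q \<Longrightarrow>
    \<exists>v\<in>V. a + v \<bullet> p \<le> 1 - (1 + r) / Q v"
  shows "a + HJ p \<le> 0"
proof (rule ccontr)
  assume "\<not> a + HJ p \<le> 0"
  define q where "q = p /\<^sub>R (1 + r)"
  define H where "H = Ham V M q"
  define \<mu> where "\<mu> = support_fun V q"
  define \<theta> where "\<theta> = a + HJ p"
  have \<theta>: "0 < \<theta>" "a + (1 + r) * H + r = \<theta>"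
    using \<open>\<not> a + HJ p \<le> 0\<close> by (auto simp: \<theta>_def H_def q_def HJ_def)
  have p: "v \<bullet> p = (1 + r) * (v \<bullet> q)" for v
    using r by (simp add: q_def)
  have "\<mu> - 1 \<le> H"
    unfolding H_def \<mu>_def by (rule Ham_ge_support)
  then consider "\<mu> - 1 < H" | "H = \<mu> - 1"
    by linarith
  then show False
  proof cases
    case 1
    define h where "h = max ((\<mu> - 1 + H) / 2) (H - \<theta> / (2 * (1 + r)))"
    have h: "\<mu> - 1 < h" "h < H"
      using 1 \<theta>(1) r by (auto simp: h_def less_max_iff_disj)
    have "\<exists>v\<in>V. a + v \<bullet> p \<le> 1 - (1 + r) / (1 / (1 + h - v \<bullet> q))"
    proof (rule sub)
      show "continuous_on V (\<lambda>v. 1 / (1 + h - v \<bullet> q))"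
        using h(1) by (intro continuous_on_resolvent) (simp add: \<mu>_def)
      show "0 < 1 / (1 + h - v \<bullet> q)" if "v \<in> V" for v
        using resolvent_denominator_pos[of q h v] h(1) that by (simp add: \<mu>_def)
      show "1 \<le> avg (\<lambda>v. 1 / (1 + h - v \<bullet> q))"
        using resolvent_avg_gt_1_below_Ham[of q h] h by (simp add: \<mu>_def H_def resolvent_avg_def)
    qed
    then have "a + (1 + r) * h + r \<le> 0"
      by (auto simp: p algebra_simps)
    moreover have "(1 + r) * (H - \<theta> / (2 * (1 + r))) \<le> (1 + r) * h"
      using r by (intro mult_left_mono) (auto simp: h_def)
    moreover have "(1 + r) * (H - \<theta> / (2 * (1 + r))) = (1 + r) * H - \<theta> / 2"
      using r by (simp add: field_simps)
    ultimately show False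
      using \<theta> by linarith
  next
    case 2
    obtain v\<^sub>0 where v0: "v\<^sub>0 \<in> V" "v\<^sub>0 \<bullet> q = \<mu>"
      using support_fun_attained[OF compact_V V_nonempty, of q] by (auto simp: \<mu>_def)
    define \<delta> where "\<delta> = \<theta> / ((1 + r) * (norm q + 1))"
    have \<delta>: "0 < \<delta>"
      using \<theta>(1) r by (simp add: \<delta>_def add_nonneg_pos)
    obtain m where m: "0 < m"
      "\<And>f (b::real). continuous_on V f \<Longrightarrow> (\<And>v. v \<in> V \<Longrightarrow> 0 \<le> f v) \<Longrightarrow> 0 \<le> b \<Longrightarrow>
         (\<And>v. v \<in> V \<Longrightarrow> dist v\<^sub>0 v < \<delta> / 2 \<Longrightarrow> b \<le> f v) \<Longrightarrow> b * m \<le> avg f"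
      using avg_ge_on_ball[OF full v0(1), of "\<delta> / 2"] \<delta> by auto
    obtain R where R: "0 < R" "\<And>v. v \<in> V \<Longrightarrow> norm v \<le> R"
      using velocity_bound by blast
    define b where "b = 2 * R * norm q + 1"
    define Q where "Q v = 1 / b + 2 / m * max 0 (1 - dist v\<^sub>0 v / \<delta>)" for v
    have b: "0 < b"
      using R(1) by (simp add: b_def add_nonneg_pos)
    have Q_pos: "0 < Q v" for v
      using b m(1) by (simp add: Q_def add_pos_nonneg)
    have Q_cont: "continuous_on V Q"
      unfolding Q_def by (intro continuous_intros) (use \<delta> in auto)
    have "1 / m * m \<le> avg Q"
    proof (rule m(2)[OF Q_cont])
      fix v
      assume v: "dist v\<^sub>0 v < \<delta> / 2"
      then have "1 / 2 \<le> max 0 (1 - dist v\<^sub>0 v / \<delta>)"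
        using \<delta> by (simp add: field_simps le_max_iff_disj)
      then have "2 / m * (1 / 2) \<le> 2 / m * max 0 (1 - dist v\<^sub>0 v / \<delta>)"
        by (rule mult_left_mono) (use m(1) in simp)
      moreover have "0 \<le> 1 / b"
        using b by simp
      ultimately have "2 / m * (1 / 2) \<le> Q v"
        unfolding Q_def by linarith
      then show "1 / m \<le> Q v"
        by simp
    qed (use Q_pos m(1) in \<open>auto intro: less_imp_le\<close>)
    then have "1 \<le> avg Q"
      using m(1) by simp
    from sub[OF Q_cont Q_pos this] obtain v where v: "v \<in> V" "a + v \<bullet> p \<le> 1 - (1 + r) / Q v"
      by blast
    have a: "a = \<theta> + 1 - (1 + r) * \<mu>"
      using \<theta>(2) 2 by (simp add: algebra_simps)
    have diff: "\<theta> \<le> (1 + r) * (\<mu> - v \<bullet> q - 1 / Q v)"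
      using v(2) by (simp add: a p algebra_simps)
    show False
    proof (cases "dist v\<^sub>0 v < \<delta>")
      case True
      have "\<mu> - v \<bullet> q = (v\<^sub>0 - v) \<bullet> q"
        by (simp add: inner_diff_left v0(2))
      also have "\<dots> \<le> norm (v\<^sub>0 - v) * norm q"
        by (rule norm_cauchy_schwarz)
      also have "\<dots> \<le> \<delta> * norm q"
        using True by (intro mult_right_mono) (auto simp: dist_norm)
      also have "\<dots> < \<delta> * (norm q + 1)"
        using \<delta> by simp
      finally have "(1 + r) * (\<mu> - v \<bullet> q) < (1 + r) * (\<delta> * (norm q + 1))"
        using r by simp
      also have "\<dots> = \<theta>"
      proof -
        have "(1 + r) * (norm q + 1) \<noteq> 0"
          using r norm_ge_zero[of q] by (simp add: add_nonneg_eq_0_iff)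
        then show ?thesis
          by (simp add: \<delta>_def)
      qed
      finally have "(1 + r) * (\<mu> - v \<bullet> q) < \<theta>" .
      moreover have "(1 + r) * (\<mu> - v \<bullet> q - 1 / Q v) \<le> (1 + r) * (\<mu> - v \<bullet> q)"
        using r Q_pos[of v] by (intro mult_left_mono) auto
      ultimately show False
        using diff by linarith
    next
      case False
      then have "max 0 (1 - dist v\<^sub>0 v / \<delta>) = 0"
        using \<delta> by simp
      then have "1 / Q v = b"
        by (simp add: Q_def)
      moreover have "\<mu> - v \<bullet> q \<le> b"
      proof -
        have "\<mu> - v \<bullet> q = (v\<^sub>0 - v) \<bullet> q"
          by (simp add: inner_diff_left v0(2))
        also have "\<dots> \<le> norm (v\<^sub>0 - v) * norm q"
          by (rule norm_cauchy_schwarz)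
        also have "\<dots> \<le> (2 * R) * norm q"
        proof (rule mult_right_mono)
          show "norm (v\<^sub>0 - v) \<le> 2 * R"
            using norm_triangle_ineq4[of v\<^sub>0 v] R(2)[OF v0(1)] R(2)[OF v(1)] by linarith
        qed simp
        finally show ?thesis
          by (simp add: b_def)
      qed
      ultimately have "(1 + r) * (\<mu> - v \<bullet> q - 1 / Q v) \<le> 0"
        using r by (simp add: mult_le_0_iff)
      with diff \<theta>(1) show False by linarith
    qed
  qed
qed

text \<open>Every \<open>h > H(q)\<close> has a resolvent profile with average at most \<open>1\<close>, and \<open>h\<close> decreases to
  \<open>H(q)\<close>.\<close>

lemma HJ_ge_0_if_super_inequality:
  assumes super: "\<And>Q. continuous_on V Q \<Longrightarrow> (\<And>v. v \<in> V \<Longrightarrow> 0 < Q v) \<Longrightarrow> avg Q \<le> 1 \<Longrightarrow>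
    \<exists>v\<in>V. 1 - (1 + r) / Q v \<le> a + v \<bullet> p"
  shows "0 \<le> a + HJ p"
proof (rule ccontr)
  assume neg: "\<not> 0 \<le> a + HJ p"
  define q where "q = p /\<^sub>R (1 + r)"
  define h where "h = Ham V M q - (a + HJ p) / (2 * (1 + r))"
  have p: "v \<bullet> p = (1 + r) * (v \<bullet> q)" for v
    using r by (simp add: q_def)
  have h: "Ham V M q < h"
    using neg r by (simp add: h_def divide_neg_pos)
  then have h': "support_fun V q - 1 < h"
    using Ham_ge_support[of q] by simp
  have "\<exists>v\<in>V. 1 - (1 + r) / (1 / (1 + h - v \<bullet> q)) \<le> a + v \<bullet> p"
  proof (rule super)
    show "continuous_on V (\<lambda>v. 1 / (1 + h - v \<bullet> q))"
      by (rule continuous_on_resolvent[OF h'])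
    show "0 < 1 / (1 + h - v \<bullet> q)" if "v \<in> V" for v
      using resolvent_denominator_pos[OF h' that] by simp
    show "avg (\<lambda>v. 1 / (1 + h - v \<bullet> q)) \<le> 1"
      using resolvent_avg_le_1_above_Ham[OF h] by (simp add: resolvent_avg_def)
  qed
  then have "0 \<le> a + (1 + r) * h + r"
    by (auto simp: p algebra_simps)
  moreover have "(1 + r) * h = (1 + r) * Ham V M q - (a + HJ p) / 2"
    using r by (simp add: h_def field_simps)
  moreover have "HJ p = (1 + r) * Ham V M q + r"
    by (simp add: HJ_def q_def)
  moreover have False if "0 \<le> a + y + r" "y = x - (a + k) / 2" "k = x + r" "\<not> 0 \<le> a + k" for x y k :: real
    using that by (simp add: field_simps)
  ultimately show False
    using neg by blast
qed

definition initial_min :: "real ^ 'n \<Rightarrow> real" where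
  "initial_min x = (INF v\<in>V. \<phi>\<^sub>0 x v)"

lemma initial_min_le: "v \<in> V \<Longrightarrow> initial_min x \<le> \<phi>\<^sub>0 x v"
  unfolding initial_min_def by (intro cINF_lower bdd_belowI2[of _ 0]) (auto simp: \<phi>\<^sub>0_nonneg)

lemma initial_min_ge: "(\<And>v. v \<in> V \<Longrightarrow> a \<le> \<phi>\<^sub>0 x v) \<Longrightarrow> a \<le> initial_min x"
  unfolding initial_min_def by (intro cINF_greatest V_nonempty)

lemma initial_min_less:
  assumes "initial_min x < a"
  obtains v where "v \<in> V" "\<phi>\<^sub>0 x v < a"
  using assms V_nonempty unfolding initial_min_def
  by (subst (asm) cINF_less_iff) (auto intro: bdd_belowI2[of _ 0] simp: \<phi>\<^sub>0_nonneg)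

text \<open>The half-relaxed limits are formed at positive times only and are continued by the expected
  initial value. At time \<open>0\<close> itself the upper limit would be the maximum of \<open>\<phi>\<^sub>0\<close> over the velocities,
  since times shorter than the initial layer would be included. Semicontinuity of the continuation
  is the content of the initial estimates.\<close>

definition upper_envelope :: "real \<Rightarrow> real ^ 'n \<Rightarrow> real" where
  "upper_envelope t x = (if 0 < t then upper_phase (t, x) else initial_min x)"

definition lower_envelope :: "real \<Rightarrow> real ^ 'n \<Rightarrow> real" where
  "lower_envelope t x = (if 0 < t then lower_phase (t, x) else initial_min x)"

lemma eventually_positive_time:
  "0 < fst z \<Longrightarrow> \<forall>\<^sub>F q in nhds (z :: real \<times> (real ^ 'n)). 0 < fst q"
  using eventually_nhds_in_open[OF open_positive_times, of z]
  by (auto simp: mem_Times_iff elim: eventually_mono)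

lemma eventually_phase_bounded_near:
  "0 < fst z \<Longrightarrow> \<forall>\<^sub>F q in nhds z. locally_bounded_family V phase q"
  using eventually_positive_time[of z] by (auto elim: eventually_mono intro: phase_locally_bounded)

lemma viscosity_subsolution_upper_envelope:
  "viscosity_subsolution (\<lambda>u a p. min (a + HJ p) u) upper_envelope"
  unfolding viscosity_subsolution_def
proof (intro allI impI, elim conjE)
  fix \<psi> :: "real \<times> (real ^ 'n) \<Rightarrow> real" and D t x
  assume \<psi>: "test_function \<psi> D" and t: "0 < t"
    and max: "\<forall>\<^sub>F (s, y) in nhds (t, x). upper_envelope s y - \<psi> (s, y) \<le> upper_envelope t x - \<psi> (t, x)"
  have max': "\<forall>\<^sub>F z in nhds (t, x). upper_phase z - \<psi> z \<le> upper_phase (t, x) - \<psi> (t, x)"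
  proof -
    have "\<forall>\<^sub>F z in nhds (t, x). 0 < fst z"
      using t by (intro eventually_positive_time) simp
    with max show ?thesis
      by eventually_elim (use t in \<open>auto simp: upper_envelope_def\<close>)
  qed
  show "min (fst (D (t, x)) + HJ (snd (D (t, x)))) (upper_envelope t x) \<le> 0"
  proof (cases "0 < upper_phase (t, x)")
    case True
    have "fst (D (t, x)) + HJ (snd (D (t, x))) \<le> 0"
    proof (rule HJ_le_0_if_sub_inequality)
      fix Q
      assume "continuous_on V Q" "\<And>v. v \<in> V \<Longrightarrow> 0 < Q v" "1 \<le> avg Q"
      from upper_phase_sub_inequality[OF \<psi> _ True max' this] t
      show "\<exists>v\<in>V. fst (D (t, x)) + v \<bullet> snd (D (t, x)) \<le> 1 - (1 + r) / Q v"
        by (simp add: inner_prod_def inner_commute)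
    qed
    then show ?thesis by simp
  next
    case False
    then show ?thesis
      using t by (simp add: upper_envelope_def min_le_iff_disj)
  qed
qed

lemma lower_phase_nonneg:
  assumes "0 < fst z"
  shows "0 \<le> lower_phase z"
proof -
  have "\<forall>\<^sub>F q in at_right (0::real) \<times>\<^sub>F nhds z. \<forall>v\<in>V. - phase (fst q) (snd q) v \<le> 0"
    using eventually_prodI[OF eventually_at_right_less[of "0::real"] eventually_positive_time[OF assms]]
    by eventually_elim (auto simp: phase_nonneg)
  then show ?thesis
    unfolding lower_phase_def
    using upper_limit_le[OF V_nonempty, of "\<lambda>\<epsilon> z v. - phase \<epsilon> z v" z 0] phase_locally_bounded[OF assms]
    by (simp add: locally_bounded_family_uminus)
qed

lemma viscosity_supersolution_lower_envelope:
  "viscosity_supersolution (\<lambda>u a p. min (a + HJ p) u) lower_envelope"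
  unfolding viscosity_supersolution_def
proof (intro allI impI, elim conjE)
  fix \<psi> :: "real \<times> (real ^ 'n) \<Rightarrow> real" and D t x
  assume \<psi>: "test_function \<psi> D" and t: "0 < t"
    and min: "\<forall>\<^sub>F (s, y) in nhds (t, x). lower_envelope s y - \<psi> (s, y) \<ge> lower_envelope t x - \<psi> (t, x)"
  have min': "\<forall>\<^sub>F z in nhds (t, x). lower_phase (t, x) - \<psi> (t, x) \<le> lower_phase z - \<psi> z"
  proof -
    have "\<forall>\<^sub>F z in nhds (t, x). 0 < fst z"
      using t by (intro eventually_positive_time) simp
    with min show ?thesis
      by eventually_elim (use t in \<open>auto simp: lower_envelope_def\<close>)
  qed
  have "0 \<le> fst (D (t, x)) + HJ (snd (D (t, x)))"
  proof (rule HJ_ge_0_if_super_inequality)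
    fix Q
    assume "continuous_on V Q" "\<And>v. v \<in> V \<Longrightarrow> 0 < Q v" "avg Q \<le> 1"
    from lower_phase_super_inequality[OF \<psi> _ min' this] t
    show "\<exists>v\<in>V. 1 - (1 + r) / Q v \<le> fst (D (t, x)) + v \<bullet> snd (D (t, x))"
      by (simp add: inner_prod_def inner_commute)
  qed
  then show "0 \<le> min (fst (D (t, x)) + HJ (snd (D (t, x)))) (lower_envelope t x)"
    using t lower_phase_nonneg[of "(t, x)"] by (simp add: lower_envelope_def)
qed

lemma usc_upper_envelope: "usc_on ({0..} \<times> UNIV) (\<lambda>z. upper_envelope (fst z) (snd z))"
  unfolding usc_on_def
proof (intro ballI allI impI)
  fix z :: "real \<times> (real ^ 'n)" and a
  assume z: "z \<in> {0..} \<times> UNIV" and a: "upper_envelope (fst z) (snd z) < a"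
  show "\<forall>\<^sub>F q in nhds z. q \<in> {0..} \<times> UNIV \<longrightarrow> upper_envelope (fst q) (snd q) < a"
  proof (cases "0 < fst z")
    case True
    then have "\<forall>\<^sub>F q in nhds z. upper_phase q < a"
      using a eventually_phase_bounded_near[OF True] phase_locally_bounded[OF True] V_nonempty
      unfolding upper_phase_def by (intro upper_limit_usc) (auto simp: upper_envelope_def upper_phase_def)
    with eventually_positive_time[OF True] show ?thesis
      by eventually_elim (simp add: upper_envelope_def)
  next
    case False
    define x where "x = snd z"
    have zx: "z = (0, x)"
      using z False by (cases z) (auto simp: x_def)
    have "initial_min x < a"
      using a by (simp add: upper_envelope_def zx)
    then obtain v where v: "v \<in> V" "\<phi>\<^sub>0 x v < a"
      by (rule initial_min_less)
    then obtain b where b: "\<phi>\<^sub>0 x v < b" "b < a"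
      using dense by blast
    obtain \<nu> where \<nu>: "0 < \<nu>" "\<And>\<tau>. 0 < \<tau> \<Longrightarrow> \<forall>\<^sub>F \<epsilon> in at_right 0. \<forall>z. \<tau> \<le> fst z \<and> fst z < \<nu> \<and>
        dist (snd z) x < \<nu> \<longrightarrow> (\<forall>v\<in>V. phase \<epsilon> z v \<le> b)"
      using phase_upper_initial_layer[OF v(1) b(1)] by blast
    define N where "N = {..<\<nu>} \<times> ball x \<nu>"
    have "open N" "z \<in> N"
      using \<nu>(1) by (auto simp: N_def zx open_Times)
    then have "\<forall>\<^sub>F q in nhds z. q \<in> N"
      by (rule eventually_nhds_in_open)
    moreover have "\<forall>\<^sub>F q in nhds z. q \<in> UNIV \<times> UNIV \<longrightarrow> \<phi>\<^sub>0 (snd q) v < a"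
    proof (rule usc_onD)
      have "continuous_on UNIV (\<lambda>q :: real \<times> (real ^ 'n). (\<lambda>q. \<phi>\<^sub>0 (fst q) (snd q)) (snd q, v))"
        by (rule continuous_on_compose2[OF initial_continuous]) (use v in \<open>auto intro!: continuous_intros\<close>)
      then show "usc_on (UNIV \<times> UNIV) (\<lambda>q :: real \<times> (real ^ 'n). \<phi>\<^sub>0 (snd q) v)"
        by (intro usc_on_continuous) simp
    qed (use v zx in auto)
    ultimately show ?thesis
    proof eventually_elim
      case (elim q)
      have "upper_envelope (fst q) (snd q) < a" if "0 \<le> fst q"
      proof (cases "0 < fst q")
        case True
        \<comment> \<open>The estimate holds after any fixed delay \<open>\<tau>\<close>; half the time of \<open>q\<close> covers a neighbourhood of \<open>q\<close>.\<close>
        define S where "S = {fst q / 2<..<\<nu>} \<times> ball x \<nu>"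
        have "\<forall>\<^sub>F q' in nhds q. q' \<in> S"
          using elim(1) True
          by (intro eventually_nhds_in_open) (auto simp: S_def N_def open_Times mem_Times_iff)
        from eventually_prodI[OF \<nu>(2)[of "fst q / 2"] this] True
        have "\<forall>\<^sub>F p in at_right (0::real) \<times>\<^sub>F nhds q. \<forall>v\<in>V. phase (fst p) (snd p) v \<le> b"
          by (auto elim!: eventually_mono simp: S_def mem_Times_iff dist_commute)
        from upper_limit_le[OF V_nonempty phase_locally_bounded[OF True] this]
        have "upper_phase q \<le> b"
          by (simp add: upper_phase_def)
        with b(2) True show ?thesis
          by (simp add: upper_envelope_def)
      next
        case False
        then show ?thesis
          using elim(2) initial_min_le[OF v(1), of "snd q"] by (simp add: upper_envelope_def)
      qed
      then show ?case
        by (auto simp: mem_Times_iff)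
    qed
  qed
qed

lemma lsc_lower_envelope: "usc_on ({0..} \<times> UNIV) (\<lambda>z. - lower_envelope (fst z) (snd z))"
  unfolding usc_on_def
proof (intro ballI allI impI)
  fix z :: "real \<times> (real ^ 'n)" and a
  assume z: "z \<in> {0..} \<times> UNIV" and a: "- lower_envelope (fst z) (snd z) < a"
  show "\<forall>\<^sub>F q in nhds z. q \<in> {0..} \<times> UNIV \<longrightarrow> - lower_envelope (fst q) (snd q) < a"
  proof (cases "0 < fst z")
    case True
    have "\<forall>\<^sub>F q in nhds z. upper_limit V (\<lambda>\<epsilon> z v. - phase \<epsilon> z v) q < a"
      using a True eventually_phase_bounded_near[OF True] phase_locally_bounded[OF True] V_nonempty
      by (intro upper_limit_usc) (auto simp: lower_envelope_def lower_phase_def locally_bounded_family_uminus)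
    with eventually_positive_time[OF True] show ?thesis
      by eventually_elim (simp add: lower_envelope_def lower_phase_def)
  next
    case False
    define x where "x = snd z"
    have zx: "z = (0, x)"
      using z False by (cases z) (auto simp: x_def)
    obtain b where b: "- a < b" "b < initial_min x"
      using dense[of "- a" "initial_min x"] a by (auto simp: lower_envelope_def zx)
    have "b < \<phi>\<^sub>0 x v" if "v \<in> V" for v
      using initial_min_le[OF that, of x] b(2) by simp
    then obtain \<nu> where \<nu>: "0 < \<nu>" "\<And>\<epsilon> z v. 0 < \<epsilon> \<Longrightarrow> 0 \<le> fst z \<Longrightarrow> fst z < \<nu> \<Longrightarrow>
        dist (snd z) x < \<nu> \<Longrightarrow> v \<in> V \<Longrightarrow> b \<le> phase \<epsilon> z v"
      using phase_lower_bound[of b x] by blast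
    define N where "N = {..<\<nu>} \<times> ball x \<nu>"
    have N: "open N" "z \<in> N"
      using \<nu>(1) by (auto simp: N_def zx open_Times)
    show ?thesis
      using eventually_nhds_in_open[OF N]
    proof eventually_elim
      case (elim q)
      have "b \<le> lower_envelope (fst q) (snd q)" if "0 \<le> fst q"
      proof (cases "0 < fst q")
        case True
        have "\<forall>\<^sub>F q' in nhds q. q' \<in> N"
          by (rule eventually_nhds_in_open[OF N(1) elim])
        from eventually_prodI[OF eventually_at_right_less[of "0::real"]
            eventually_conj[OF this eventually_positive_time[OF True]]]
        have "\<forall>\<^sub>F p in at_right (0::real) \<times>\<^sub>F nhds q. \<forall>v\<in>V. - phase (fst p) (snd p) v \<le> - b"
          by eventually_elim (auto simp: N_def mem_Times_iff dist_commute intro!: \<nu>(2))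
        then have "upper_limit V (\<lambda>\<epsilon> z v. - phase \<epsilon> z v) q \<le> - b"
          using phase_locally_bounded[OF True]
          by (intro upper_limit_le[OF V_nonempty]) (simp_all add: locally_bounded_family_uminus)
        with True show ?thesis
          by (simp add: lower_envelope_def lower_phase_def)
      next
        case False
        then have "q = (0, snd q)"
          using that by (cases q) auto
        moreover have "b \<le> initial_min (snd q)"
        proof (rule initial_min_ge)
          fix v
          assume "v \<in> V"
          then have "b \<le> phase 1 (0, snd q) v"
            using elim \<nu>(1) by (intro \<nu>(2)) (auto simp: N_def mem_Times_iff dist_commute)
          with \<open>v \<in> V\<close> show "b \<le> \<phi>\<^sub>0 (snd q) v"
            by (simp add: phase_initial)
        qed
        ultimately show ?thesis
          using False by (simp add: lower_envelope_def)
      qed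
      then show ?case
        using b(1) by (auto simp: mem_Times_iff)
    qed
  qed
qed

lemma lower_envelope_nonneg: "0 \<le> lower_envelope t x"
  using lower_phase_nonneg[of "(t, x)"] initial_min_ge[of 0 x] \<phi>\<^sub>0_nonneg
  by (auto simp: lower_envelope_def)

section \<open>Convergence and uniqueness\<close>

text \<open>One inequality is comparison, the other holds by construction.\<close>

lemma envelopes_agree:
  assumes "0 \<le> t"
  shows "upper_envelope t x = lower_envelope t x"
proof (rule antisym)
  obtain R where R: "0 < R" "\<And>v. v \<in> V \<Longrightarrow> norm v \<le> R"
    using velocity_bound by blast
  show "upper_envelope t x \<le> lower_envelope t x"
  proof (rule viscosity_comparison[OF viscosity_subsolution_upper_envelope
        viscosity_supersolution_lower_envelope usc_upper_envelope lsc_lower_envelope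
        lower_envelope_nonneg _ _ HJ_Lipschitz[OF R(2)] assms])
  qed (use R(1) in \<open>simp_all add: upper_envelope_def lower_envelope_def\<close>)
  show "lower_envelope t x \<le> upper_envelope t x"
    using lower_limit_le_upper_limit[OF V_nonempty phase_locally_bounded, of "(t, x)"]
    by (simp add: upper_envelope_def lower_envelope_def upper_phase_def lower_phase_def)
qed

lemma continuous_upper_envelope:
  "continuous_on ({0..} \<times> UNIV) (\<lambda>(t, x). upper_envelope t x)"
proof -
  have "usc_on ({0..} \<times> UNIV) (\<lambda>z. - upper_envelope (fst z) (snd z))"
    using lsc_lower_envelope envelopes_agree unfolding usc_on_def by (simp add: mem_Times_iff)
  from continuous_on_if_usc_on[OF usc_upper_envelope this] show ?thesis
    by (simp add: case_prod_beta)
qed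

lemma viscosity_solution_upper_envelope:
  "viscosity_solution (\<lambda>u a p. min (a + HJ p) u) initial_min upper_envelope"
  unfolding viscosity_solution_def
proof (intro conjI allI)
  show "viscosity_supersolution (\<lambda>u a p. min (a + HJ p) u) upper_envelope"
    by (rule viscosity_supersolution_cong[OF viscosity_supersolution_lower_envelope])
      (simp add: envelopes_agree)
qed (simp_all add: continuous_upper_envelope viscosity_subsolution_upper_envelope upper_envelope_def)

lemma viscosity_solution_le:
  assumes u: "viscosity_solution (\<lambda>u a p. min (a + HJ p) u) initial_min u"
    and w: "viscosity_solution (\<lambda>u a p. min (a + HJ p) u) initial_min w"
    and "0 \<le> t"
  shows "u t x \<le> w t x"
proof -
  obtain R where R: "0 < R" "\<And>v. v \<in> V \<Longrightarrow> norm v \<le> R"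
    using velocity_bound by blast
  have w_nonneg: "0 \<le> w s y" if "0 \<le> s" for s y
  proof (cases "0 < s")
    case True
    then show ?thesis
      using w unfolding viscosity_solution_def
      by (intro viscosity_supersolution_nonneg[where H="\<lambda>a p. a + HJ p"]) auto
  next
    case False
    then show ?thesis
      using w that initial_min_ge[of 0 y] \<phi>\<^sub>0_nonneg by (simp add: viscosity_solution_def)
  qed
  show ?thesis
  proof (rule viscosity_comparison[OF _ _ _ _ w_nonneg _ _ HJ_Lipschitz[OF R(2)] \<open>0 \<le> t\<close>])
    show "usc_on ({0..} \<times> UNIV) (\<lambda>z. u (fst z) (snd z))"
      using u by (intro usc_on_continuous) (simp add: viscosity_solution_def case_prod_beta)
    show "usc_on ({0..} \<times> UNIV) (\<lambda>z. - w (fst z) (snd z))"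
      using w by (intro usc_on_continuous continuous_on_minus) (simp add: viscosity_solution_def case_prod_beta)
  qed (use u w R(1) in \<open>simp_all add: viscosity_solution_def\<close>)
qed

text \<open>Where the two half-relaxed limits coincide, the family is eventually close to the common value
  on a neighbourhood of each point, uniformly in the velocity; compactness makes this uniform.\<close>

lemma phase_converges_uniformly:
  assumes K: "compact K" "K \<subseteq> {0<..} \<times> UNIV \<times> V"
  shows "uniform_limit K (\<lambda>\<epsilon> (t, x, v). \<phi> \<epsilon> t x v) (\<lambda>(t, x, v). upper_envelope t x) (at_right 0)"
  unfolding uniform_limit_iff
proof (intro allI impI)
  fix e :: real
  assume e: "0 < e"
  define K' where "K' = (\<lambda>(t, x, v). (t, x)) ` K"
  have "compact K'"
    unfolding K'_def case_prod_beta
    by (intro compact_continuous_image K continuous_intros)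
  then have "\<forall>\<^sub>F \<epsilon> in at_right 0. \<forall>z\<in>K'. \<forall>v\<in>V. \<bar>phase \<epsilon> z v - upper_envelope (fst z) (snd z)\<bar> < e"
  proof (rule eventually_ball_compact)
    fix z
    assume "z \<in> K'"
    then have t: "0 < fst z"
      using K(2) by (auto simp: K'_def)
    have agree: "upper_envelope (fst z) (snd z) = upper_phase z" "lower_phase z = upper_phase z"
      using t envelopes_agree[of "fst z" "snd z"] by (auto simp: upper_envelope_def lower_envelope_def)
    have "\<forall>\<^sub>F p in at_right (0::real) \<times>\<^sub>F nhds z. \<forall>v\<in>V. phase (fst p) (snd p) v \<le> upper_phase z + e / 3"
      using eventually_less_upper_limit[OF V_nonempty phase_locally_bounded[OF t], of "upper_phase z + e / 3"] e
      by (simp add: upper_phase_def)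
    moreover have "\<forall>\<^sub>F p in at_right (0::real) \<times>\<^sub>F nhds z. \<forall>v\<in>V. - phase (fst p) (snd p) v \<le> - upper_phase z + e / 3"
      using eventually_less_upper_limit[OF V_nonempty, of "\<lambda>\<epsilon> z v. - phase \<epsilon> z v" z "- lower_phase z + e / 3"] e
        phase_locally_bounded[OF t]
      by (simp add: lower_phase_def[of z] locally_bounded_family_uminus flip: agree(2))
    moreover have "\<forall>\<^sub>F p in at_right (0::real) \<times>\<^sub>F nhds z. \<bar>upper_envelope (fst (snd p)) (snd (snd p)) - upper_phase z\<bar> < e / 3"
    proof -
      have "continuous_on ({0<..} \<times> UNIV) (\<lambda>(t, x). upper_envelope t x)"
        by (rule continuous_on_subset[OF continuous_upper_envelope]) auto
      then have "isCont (\<lambda>(t, x). upper_envelope t x) z"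
        using t by (cases z) (simp add: continuous_on_eq_continuous_at[OF open_positive_times])
      then have "((\<lambda>(t, x). upper_envelope t x) \<longlongrightarrow> upper_phase z) (nhds z)"
        unfolding isCont_def tendsto_at_iff_tendsto_nhds by (simp add: case_prod_beta agree)
      from tendstoD[OF this, of "e / 3"] e
      have "\<forall>\<^sub>F q in nhds z. \<bar>upper_envelope (fst q) (snd q) - upper_phase z\<bar> < e / 3"
        by (simp add: case_prod_beta dist_real_def)
      from eventually_prodI[OF always_eventually this, of "\<lambda>_. True"] show ?thesis by simp
    qed
    ultimately show "\<forall>\<^sub>F p in at_right (0::real) \<times>\<^sub>F nhds z.
        \<forall>v\<in>V. \<bar>phase (fst p) (snd p) v - upper_envelope (fst (snd p)) (snd (snd p))\<bar> < e"
    proof eventually_elim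
      case (elim p)
      show ?case
      proof
        fix v
        assume "v \<in> V"
        with elim have "phase (fst p) (snd p) v \<le> upper_phase z + e / 3"
          "- phase (fst p) (snd p) v \<le> - upper_phase z + e / 3"
          "\<bar>upper_envelope (fst (snd p)) (snd (snd p)) - upper_phase z\<bar> < e / 3"
          by auto
        then show "\<bar>phase (fst p) (snd p) v - upper_envelope (fst (snd p)) (snd (snd p))\<bar> < e"
          using e by linarith
      qed
    qed
  qed
  then show "\<forall>\<^sub>F \<epsilon> in at_right 0. \<forall>k\<in>K. dist (case k of (t, x, v) \<Rightarrow> \<phi> \<epsilon> t x v)
      (case k of (t, x, v) \<Rightarrow> upper_envelope t x) < e"
  proof eventually_elim
    case (elim \<epsilon>)
    show ?case
    proof
      fix k
      assume k: "k \<in> K"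
      obtain t x v where k_eq: "k = (t, x, v)"
        by (cases k)
      have "(t, x) \<in> K'" "v \<in> V"
        using k K(2) by (force simp: K'_def k_eq)+
      with elim have "\<bar>phase \<epsilon> (t, x) v - upper_envelope t x\<bar> < e"
        by force
      then show "dist (case k of (t, x, v) \<Rightarrow> \<phi> \<epsilon> t x v) (case k of (t, x, v) \<Rightarrow> upper_envelope t x) < e"
        by (simp add: k_eq phase_def dist_real_def)
    qed
  qed
qed

end

theorem theorem1p3:
  fixes V :: "(real ^ 'n) set"
    and M :: "real ^ 'n \<Rightarrow> real"
    and r :: real
    and \<phi>\<^sub>0 :: "real ^ 'n \<Rightarrow> real ^ 'n \<Rightarrow> real"
    and \<phi> :: "real \<Rightarrow> real \<Rightarrow> real ^ 'n \<Rightarrow> real ^ 'n \<Rightarrow> real"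
  assumes "compact V"
    and "r > 0"
    and "prob_density_on V M"
    and "full_support V M"
    and "(LINT v:V|lebesgue. M v *\<^sub>R v) = 0"
    and "\<And>x v. v \<in> V \<Longrightarrow> 0 \<le> \<phi>\<^sub>0 x v"
    and "\<And>\<epsilon>. \<epsilon> > 0 \<Longrightarrow> kinetic_solution V M r \<epsilon> \<phi>\<^sub>0 (\<phi> \<epsilon>)"
  shows "let F = \<lambda>(u::real) (a::real) (p::real ^ 'n).
                   min (a + (1 + r) * Ham V M (p /\<^sub>R (1 + r)) + r) u;
             g = \<lambda>x. INF v\<in>V. \<phi>\<^sub>0 x v
         in \<exists>\<phi>0 :: real \<Rightarrow> real ^ 'n \<Rightarrow> real.
              (\<forall>K. compact K \<and> K \<subseteq> {0<..} \<times> UNIV \<times> V \<longrightarrow>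
                 uniform_limit K (\<lambda>\<epsilon> (t, x, v). \<phi> \<epsilon> t x v) (\<lambda>(t, x, v). \<phi>0 t x) (at_right 0)) \<and>
              viscosity_solution F g \<phi>0 \<and>
              (\<forall>u. viscosity_solution F g u \<longrightarrow> (\<forall>t\<ge>0. \<forall>x. u t x = \<phi>0 t x))"
proof -
  interpret kinetic_family V M r \<phi>\<^sub>0 \<phi>
    by unfold_locales (use assms in auto)
  define F where "F = (\<lambda>(u::real) (a::real) (p::real ^ 'n).
      min (a + (1 + r) * Ham V M (p /\<^sub>R (1 + r)) + r) u)"
  define g where "g = (\<lambda>x. INF v\<in>V. \<phi>\<^sub>0 x v)"
  \<comment> \<open>The Hamiltonian of the comparison lemma absorbs the constant \<open>r\<close>.\<close>
  have F: "(\<lambda>u a p. min (a + HJ p) u) = F"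
    by (intro ext) (simp add: F_def HJ_def add.assoc)
  have g: "initial_min = g"
    by (intro ext) (simp add: g_def initial_min_def)
  have "uniform_limit K (\<lambda>\<epsilon> (t, x, v). \<phi> \<epsilon> t x v) (\<lambda>(t, x, v). upper_envelope t x) (at_right 0)"
    if "compact K \<and> K \<subseteq> {0<..} \<times> UNIV \<times> V" for K
    using phase_converges_uniformly that by blast
  moreover have "viscosity_solution F g upper_envelope"
    using viscosity_solution_upper_envelope by (simp only: F g)
  moreover have "u t x = upper_envelope t x" if "viscosity_solution F g u" "0 \<le> t" for u t x
    using viscosity_solution_le[OF _ viscosity_solution_upper_envelope that(2), of u x]
      viscosity_solution_le[OF viscosity_solution_upper_envelope _ that(2), of u x] that(1)
    unfolding F g by simp
  ultimately show ?thesis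
    unfolding Let_def F_def[symmetric] g_def[symmetric] by blast
qed

end
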